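(* Let $c>0$ be a constant and let $p=\frac{c}{n}$. Let $\operatorname{Perm}(n)_p$ denote the random subgraph of the $n$-dimensional permutahedron $\operatorname{Perm}(n)$ obtained by keeping each edge independently with probability $p$. Then, with probability tending to one as $n\to\infty$: (i) if $c<1$, the largest connected component of $\operatorname{Perm}(n)_p$ has order $\Theta(n\log n)$; (ii) if $c>1$, there exists a connected component of $\operatorname{Perm}(n)_p$ of order $(1+o(1))\gamma(c)\,(n+1)!$, and the second-largest component has order $\Theta(n\log n)$.
   Context: The $n$-dimensional permutahedron $\operatorname{Perm}(n)$ is the graph with vertex set the symmetric group $S_{n+1}$ and edge set $\{\{\pi,\tau_i\pi\}:\pi\in S_{n+1},\,1\le i\le n\}$, where $\tau_i$ is the transposition $(i,i+1)$ and products are composition, $(\sigma\pi)(j)=\sigma(\pi(j))$. It is $n$-regular with $(n+1)!$ vertices. For a constant $c>1$, $\gamma(c)$ denotes the unique solution in $(0,1)$ of $\gamma(c)=1-\exp(-c\gamma(c))$. Logarithms are natural. *)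

theory Defs
  imports
    "HOL-Probability.Probability"
    "HOL-Probability.Product_PMF"
    "HOL-Combinatorics.Permutations"
    "HOL-Library.Multiset"
    "HOL-Library.More_List"
    "HOL-Library.Landau_Symbols"
begin

text \<open>An undirected graph is given by a vertex set \<open>V\<close> and a set \<open>E\<close> of two-element subsets of \<open>V\<close>.\<close>

definition perm_verts :: "nat \<Rightarrow> (nat \<Rightarrow> nat) set" where
  "perm_verts n = {\<pi>. \<pi> permutes {1..n+1}}"

definition perm_edges :: "nat \<Rightarrow> (nat \<Rightarrow> nat) set set" where
  "perm_edges n = {{\<pi>, Transposition.transpose i (i+1) \<circ> \<pi>} | \<pi> i. \<pi> \<in> perm_verts n \<and> 1 \<le> i \<and> i \<le> n}"

text \<open>The random set of retained edges when each edge of the finite set \<open>E\<close> is kept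
  independently with probability \<open>p\<close>. All vertices are retained. The distribution
  \<open>bernoulli_pmf p\<close> truncates \<open>p\<close> to the unit interval.\<close>

definition random_edges :: "'a set set \<Rightarrow> real \<Rightarrow> 'a set set pmf" where
  "random_edges E p = map_pmf (\<lambda>keep. {e \<in> E. keep e}) (Pi_pmf E False (\<lambda>_. bernoulli_pmf p))"

definition connected_in :: "'a set \<Rightarrow> 'a set set \<Rightarrow> 'a rel" where
  "connected_in V E = {(u, v) \<in> V \<times> V. (u, v) \<in> {(x, y). {x, y} \<in> E}\<^sup>*}"

definition graph_components :: "'a set \<Rightarrow> 'a set set \<Rightarrow> 'a set set" where
  "graph_components V E = V // connected_in V E"

text \<open>The orders of the components of a finite graph, with multiplicity, in decreasing order.\<close>

definition component_orders :: "'a set \<Rightarrow> 'a set set \<Rightarrow> nat list" where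
  "component_orders V E =
     rev (sorted_list_of_multiset (image_mset card (mset_set (graph_components V E))))"

definition largest_order :: "'a set \<Rightarrow> 'a set set \<Rightarrow> nat" where
  "largest_order V E = nth_default 0 (component_orders V E) 0"

text \<open>This is \<open>0\<close> if there are fewer than two components, and equals the largest order if
  two components share it.\<close>

definition second_largest_order :: "'a set \<Rightarrow> 'a set set \<Rightarrow> nat" where
  "second_largest_order V E = nth_default 0 (component_orders V E) 1"

definition gamma_const :: "real \<Rightarrow> real" where
  "gamma_const c = (THE g. 0 < g \<and> g < 1 \<and> g = 1 - exp (- c * g))"

end

theory Submission
  imports Defs "HOL-Real_Asymp.Real_Asymp"
begin

text \<open>
  Exploring the cluster \<open>C\<close> of a vertex edge by edge, the weight \<open>\<lambda>\<^bsup>|C|\<^esup> \<theta>\<^bsup>q\<^esup>\<close> with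
  \<open>\<theta> = 1 / (1 + p (\<lambda> - 1))\<close> and \<open>q\<close> the number of queried edges is a martingale. Since \<open>q\<close> is at most
  \<open>n |C|\<close>, and at least \<open>(1 - o(1)) n |C|\<close> for clusters of polynomial size (a set of \<open>s\<close> permutations spans
  only \<open>O(s log s)\<close> edges), this yields exponential tails for \<open>c < 1\<close>, and for \<open>c > 1\<close> both the absence of
  clusters of order between \<open>b n log n\<close> and \<open>n\<^bsup>30\<^esup>\<close> and the limit \<open>1 - \<gamma>(c)\<close> for the probability that a
  cluster has fewer than \<open>n\<^bsup>30\<^esup>\<close> vertices. An Efron-Stein type variance bound gives concentration of the number of
  vertices in clusters of a given bounded order, and the existence of clusters of order exactly
  \<open>\<lceil>a n log n\<rceil>\<close>, each vertex lying in one with probability \<open>exp (- O(n log n))\<close>.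

  The large clusters are merged by sprinkling with probability \<open>n\<^bsup>-4\<^esup>\<close>. Every vertex is within distance 2 of a
  large cluster, since it has of order \<open>n\<^sup>2\<close> independent chances for this in disjoint cosets of a parabolic
  subgroup, and a Cayley graph of diameter \<open>O(n\<^sup>2)\<close> has edge expansion of order \<open>n\<^bsup>-2\<^esup>\<close>. So two sides of a
  partition of the large clusters are joined by polynomially dense disjoint paths of length at most 5, whereas there
  are few partitions because each large cluster has \<open>n\<^bsup>30\<^esup>\<close> vertices.
\<close>

section \<open>Random subsets of a finite set\<close>

text \<open>Union bounds over the \<open>(n + 1)!\<close> vertices cost a factor
  \<open>exp (O(n log n))\<close>, and this sets every scale. In particular the neighbours of a
  vertex are too few to guarantee a large cluster next to it: \<open>n\<close> independent chances
  of constant probability all fail with probability \<open>exp (- O(n))\<close>, so two steps are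
  taken. The exploration weights stand in for a coupling with a branching process. When
  \<open>n p\<close> tends to \<open>c\<close>, the weight per vertex tends to
  \<open>exp (surv c lam)\<close>, which crosses 1 at \<open>lam = 1 - \<gamma>(c)\<close>, the
  extinction probability of the Poisson branching process; values of \<open>lam\<close> on either
  side give the two bounds on small clusters. Sprinkling is squeezed from two sides: it must be too
  sparse to build a large cluster out of leftovers of order below \<open>n^2\<close>, yet five open
  edges in a row must stay likely enough to merge. The polynomial order of the large clusters pays
  for that. The order of the giant is not stable under changing one edge, but the number of vertices
  in clusters of bounded order is. The giant is therefore measured as a complement, once it is known
  to be unique.\<close>

text \<open>A plain finite sum, so that revealing one edge (\<open>pexp_insert\<close>) is an
  algebraic identity for every real \<open>p\<close>; positivity enters only with
  inequalities.\<close>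

definition pexp :: "'e set \<Rightarrow> real \<Rightarrow> ('e set \<Rightarrow> real) \<Rightarrow> real" where
  "pexp U p f = (\<Sum>R\<in>Pow U. p ^ card R * (1 - p) ^ card (U - R) * f R)"

abbreviation pprob :: "'e set \<Rightarrow> real \<Rightarrow> ('e set \<Rightarrow> bool) \<Rightarrow> real" where
  "pprob U p P \<equiv> pexp U p (\<lambda>R. of_bool (P R))"

lemma pexp_empty [simp]: "pexp {} p f = f {}"
  by (simp add: pexp_def)

lemma pexp_insert:
  assumes "finite U" "e \<notin> U"
  shows "pexp (insert e U) p f = p * pexp U p (\<lambda>R. f (insert e R)) + (1 - p) * pexp U p f"
proof -
  let ?w = "\<lambda>R. p ^ card R * (1 - p) ^ card (insert e U - R) * f R"
  have inj: "inj_on (insert e) (Pow U)"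
    using assms(2) by (auto simp: inj_on_def)
  have "pexp (insert e U) p f = sum ?w (Pow U) + sum ?w (insert e ` Pow U)"
    unfolding pexp_def Pow_insert using assms by (intro sum.union_disjoint) auto
  also have "sum ?w (Pow U) = (1 - p) * pexp U p f"
    unfolding pexp_def sum_distrib_left
  proof (rule sum.cong[OF refl])
    fix R assume "R \<in> Pow U"
    then have "card (insert e U - R) = Suc (card (U - R))"
      using assms by (subst insert_Diff_if) auto
    then show "?w R = (1 - p) * (p ^ card R * (1 - p) ^ card (U - R) * f R)" by simp
  qed
  also have "sum ?w (insert e ` Pow U) = p * pexp U p (\<lambda>R. f (insert e R))"
    unfolding pexp_def sum_distrib_left sum.reindex[OF inj]
  proof (rule sum.cong[OF refl])
    fix R assume R: "R \<in> Pow U"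
    then have "finite R" "e \<notin> R" using assms finite_subset by auto
    moreover have "insert e U - insert e R = U - R" using assms by auto
    ultimately show "(?w \<circ> insert e) R = p * (p ^ card R * (1 - p) ^ card (U - R) * f (insert e R))"
      by simp
  qed
  finally show ?thesis by simp
qed

lemma pexp_cong: "(\<And>R. R \<subseteq> U \<Longrightarrow> f R = g R) \<Longrightarrow> pexp U p f = pexp U p g"
  unfolding pexp_def by (rule sum.cong) auto

lemma pexp_mono:
  assumes "0 \<le> p" "p \<le> 1" "\<And>R. R \<subseteq> U \<Longrightarrow> f R \<le> g R"
  shows "pexp U p f \<le> pexp U p g"
  unfolding pexp_def using assms by (intro sum_mono mult_left_mono) auto

lemma pexp_add: "pexp U p (\<lambda>R. f R + g R) = pexp U p f + pexp U p g"
  by (simp add: pexp_def algebra_simps sum.distrib)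

lemma pexp_cmult: "pexp U p (\<lambda>R. a * f R) = a * pexp U p f"
  by (simp add: pexp_def algebra_simps sum_distrib_left)

lemma pexp_diff: "pexp U p (\<lambda>R. f R - g R) = pexp U p f - pexp U p g"
  by (simp add: pexp_def algebra_simps sum_subtractf)

lemma pexp_sum: "pexp U p (\<lambda>R. \<Sum>i\<in>I. f i R) = (\<Sum>i\<in>I. pexp U p (f i))"
  unfolding pexp_def by (subst sum.swap) (simp add: sum_distrib_left)

lemma pexp_const:
  assumes "finite U" shows "pexp U p (\<lambda>_. a) = a"
  using assms by induction (simp_all add: pexp_insert algebra_simps)

lemma pexp_nonneg:
  assumes "0 \<le> p" "p \<le> 1" "\<And>R. R \<subseteq> U \<Longrightarrow> 0 \<le> f R"
  shows "0 \<le> pexp U p f"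
  unfolding pexp_def using assms by (intro sum_nonneg mult_nonneg_nonneg) auto

lemma pprob_le_1: "finite U \<Longrightarrow> 0 \<le> p \<Longrightarrow> p \<le> 1 \<Longrightarrow> pprob U p P \<le> 1"
  using pexp_mono[of p U "\<lambda>R. of_bool (P R)" "\<lambda>_. 1"] by (simp add: pexp_const)

lemma pprob_mono:
  "0 \<le> p \<Longrightarrow> p \<le> 1 \<Longrightarrow> (\<And>R. R \<subseteq> U \<Longrightarrow> P R \<Longrightarrow> Q R) \<Longrightarrow> pprob U p P \<le> pprob U p Q"
  by (rule pexp_mono) auto

lemma pprob_not: "finite U \<Longrightarrow> pprob U p (\<lambda>R. \<not> P R) = 1 - pprob U p P"
  by (simp add: of_bool_not_iff pexp_diff pexp_const)

lemma pprob_disj: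
  assumes "0 \<le> p" "p \<le> 1"
  shows "pprob U p (\<lambda>R. P R \<or> Q R) \<le> pprob U p P + pprob U p Q"
  unfolding pexp_add[symmetric] using assms by (intro pexp_mono) auto

lemma pprob_ex:
  assumes "0 \<le> p" "p \<le> 1" "finite I"
  shows "pprob U p (\<lambda>R. \<exists>i\<in>I. P i R) \<le> (\<Sum>i\<in>I. pprob U p (P i))"
  unfolding pexp_sum[symmetric]
proof (intro pexp_mono assms(1,2))
  fix R
  show "of_bool (\<exists>i\<in>I. P i R) \<le> (\<Sum>i\<in>I. of_bool (P i R) :: real)"
  proof (cases "\<exists>i\<in>I. P i R")
    case True
    then obtain i where i: "i \<in> I" "P i R" by auto
    have "of_bool (P i R) \<le> (\<Sum>i\<in>I. of_bool (P i R) :: real)"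
      using assms(3) i(1) by (intro member_le_sum) auto
    with i True show ?thesis by simp
  qed (simp add: sum_nonneg)
qed

lemma markov_pexp:
  assumes "0 \<le> p" "p \<le> 1" "0 < t" "\<And>R. R \<subseteq> U \<Longrightarrow> 0 \<le> f R" "\<And>R. R \<subseteq> U \<Longrightarrow> P R \<Longrightarrow> t \<le> f R"
  shows "t * pprob U p P \<le> pexp U p f"
  unfolding pexp_cmult[symmetric] using assms by (intro pexp_mono) (auto simp: of_bool_def)

lemma pexp_union:
  assumes "finite A" "finite B" "A \<inter> B = {}"
  shows "pexp (A \<union> B) p f = pexp A p (\<lambda>X. pexp B p (\<lambda>Y. f (X \<union> Y)))"
  using assms
proof (induction A arbitrary: f)
  case (insert e A)
  have "pexp (insert e A \<union> B) p f = pexp (insert e (A \<union> B)) p f" by simp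
  also have "\<dots> = p * pexp (A \<union> B) p (\<lambda>R. f (insert e R)) + (1 - p) * pexp (A \<union> B) p f"
    using insert by (intro pexp_insert) auto
  also have "\<dots> = p * pexp A p (\<lambda>X. pexp B p (\<lambda>Y. f (insert e (X \<union> Y)))) +
      (1 - p) * pexp A p (\<lambda>X. pexp B p (\<lambda>Y. f (X \<union> Y)))"
    using insert by simp
  also have "\<dots> = pexp (insert e A) p (\<lambda>X. pexp B p (\<lambda>Y. f (X \<union> Y)))"
    using insert by (simp add: pexp_insert)
  finally show ?case .
qed simp

lemma pexp_restrict:
  assumes "finite U" "A \<subseteq> U"
  shows "pexp U p (\<lambda>R. f (R \<inter> A)) = pexp A p f"
proof -
  have fin: "finite A" "finite (U - A)" using assms finite_subset by auto
  have "pexp U p (\<lambda>R. f (R \<inter> A)) = pexp (A \<union> (U - A)) p (\<lambda>R. f (R \<inter> A))"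
    using assms by (simp add: Un_absorb1)
  also have "\<dots> = pexp A p (\<lambda>X. pexp (U - A) p (\<lambda>Y. f ((X \<union> Y) \<inter> A)))"
    using fin by (intro pexp_union) auto
  also have "\<dots> = pexp A p (\<lambda>X. pexp (U - A) p (\<lambda>Y. f X))"
  proof (intro pexp_cong)
    fix X Y assume "X \<subseteq> A" "Y \<subseteq> U - A"
    then have "(X \<union> Y) \<inter> A = X" by auto
    then show "f ((X \<union> Y) \<inter> A) = f X" by simp
  qed
  finally show ?thesis by (simp add: pexp_const[OF fin(2)])
qed

lemma pexp_prod_disjoint:
  assumes "finite I" "finite U" "\<And>i. i \<in> I \<Longrightarrow> A i \<subseteq> U" "disjoint_family_on A I"
  shows "pexp U p (\<lambda>R. \<Prod>i\<in>I. f i (R \<inter> A i)) = (\<Prod>i\<in>I. pexp (A i) p (f i))"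
  using assms
proof (induction I arbitrary: U)
  case empty
  then show ?case by (simp add: pexp_const)
next
  case (insert j I)
  let ?B = "U - A j"
  have fin: "finite (A j)" "finite ?B"
    using insert.prems by (auto intro: finite_subset)
  have U: "U = A j \<union> ?B" using insert.prems(2)[of j] by auto
  have dj: "A i \<inter> A j = {}" if "i \<in> I" for i
    using insert.prems(3) insert.hyps that by (auto simp: disjoint_family_on_def)
  have "pexp U p (\<lambda>R. \<Prod>i\<in>insert j I. f i (R \<inter> A i)) =
      pexp (A j \<union> ?B) p (\<lambda>R. f j (R \<inter> A j) * (\<Prod>i\<in>I. f i (R \<inter> A i)))"
    using insert.hyps U by simp
  also have "\<dots> = pexp (A j) p (\<lambda>X. pexp ?B p (\<lambda>Y. f j ((X \<union> Y) \<inter> A j) * (\<Prod>i\<in>I. f i ((X \<union> Y) \<inter> A i))))"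
    using fin by (intro pexp_union) auto
  also have "\<dots> = pexp (A j) p (\<lambda>X. pexp ?B p (\<lambda>Y. f j X * (\<Prod>i\<in>I. f i (Y \<inter> A i))))"
  proof (intro pexp_cong arg_cong2[where f = "(*)"] prod.cong refl)
    fix X Y assume *: "X \<subseteq> A j" "Y \<subseteq> ?B"
    then have "(X \<union> Y) \<inter> A j = X" by auto
    then show "f j ((X \<union> Y) \<inter> A j) = f j X" by simp
    fix i assume "i \<in> I"
    then have "(X \<union> Y) \<inter> A i = Y \<inter> A i" using * dj[of i] by auto
    then show "f i ((X \<union> Y) \<inter> A i) = f i (Y \<inter> A i)" by simp
  qed
  also have "\<dots> = pexp (A j) p (\<lambda>X. f j X * (\<Prod>i\<in>I. pexp (A i) p (f i)))"
  proof -
    have "pexp ?B p (\<lambda>Y. \<Prod>i\<in>I. f i (Y \<inter> A i)) = (\<Prod>i\<in>I. pexp (A i) p (f i))"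
    proof (intro insert.IH fin)
      show "A i \<subseteq> ?B" if "i \<in> I" for i using insert.prems(2)[of i] dj[OF that] that by auto
      show "disjoint_family_on A I"
        using insert.prems(3) by (auto simp: disjoint_family_on_def)
    qed
    then show ?thesis by (simp add: pexp_cmult)
  qed
  also have "\<dots> = (\<Prod>i\<in>insert j I. pexp (A i) p (f i))"
    using insert.hyps pexp_cmult[of "A j" p "\<Prod>i\<in>I. pexp (A i) p (f i)" "f j"]
    by (simp add: mult.commute)
  finally show ?case .
qed

lemma pprob_all_disjoint:
  assumes "finite I" "finite U" "\<And>i. i \<in> I \<Longrightarrow> A i \<subseteq> U" "disjoint_family_on A I"
  shows "pprob U p (\<lambda>R. \<forall>i\<in>I. P i (R \<inter> A i)) = (\<Prod>i\<in>I. pprob (A i) p (P i))"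
proof -
  have "of_bool (\<forall>i\<in>I. P i (R \<inter> A i)) = (\<Prod>i\<in>I. of_bool (P i (R \<inter> A i)) :: real)" for R
    using assms(1) by (induction I) auto
  then show ?thesis using pexp_prod_disjoint[OF assms, of p "\<lambda>i R. of_bool (P i R)"] by simp
qed

text \<open>An edge is missing from \<open>X \<union> Y\<close> exactly when both rounds miss it,
  hence the product condition. The second round can then be analysed with the first one
  frozen.\<close>

lemma pexp_sprinkle:
  assumes "finite U" "1 - p = (1 - p1) * (1 - p2)"
  shows "pexp U p f = pexp U p1 (\<lambda>X. pexp U p2 (\<lambda>Y. f (X \<union> Y)))"
  using assms(1)
proof (induction U arbitrary: f)
  case (insert e U)
  have p: "p = p1 + (1 - p1) * p2" using assms(2) by (simp add: algebra_simps)
  let ?G = "\<lambda>g. pexp U p1 (\<lambda>X. pexp U p2 (\<lambda>Y. g (X \<union> Y)))"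
  have "pexp (insert e U) p1 (\<lambda>X. pexp (insert e U) p2 (\<lambda>Y. f (X \<union> Y))) =
      p1 * (p2 * ?G (\<lambda>R. f (insert e R)) + (1 - p2) * ?G (\<lambda>R. f (insert e R)))
      + (1 - p1) * (p2 * ?G (\<lambda>R. f (insert e R)) + (1 - p2) * ?G f)"
    using insert by (simp add: pexp_insert pexp_add pexp_cmult) (simp add: algebra_simps)
  also have "\<dots> = p * ?G (\<lambda>R. f (insert e R)) + (1 - p) * ?G f"
    unfolding assms(2) unfolding p by algebra
  also have "\<dots> = pexp (insert e U) p f"
    using insert by (simp add: pexp_insert)
  finally show ?case by simp
qed simp

text \<open>Law of total variance, one edge at a time: revealing \<open>e\<close> adds the variance
  \<open>p (1 - p) (a - b)^2\<close> of a two-valued conditional mean, and the two values differ by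
  at most \<open>L\<close>.\<close>

lemma pexp_second_moment_le:
  assumes "finite U" "0 \<le> p" "p \<le> 1"
    "\<And>e R. e \<in> U \<Longrightarrow> R \<subseteq> U \<Longrightarrow> \<bar>f (insert e R) - f R\<bar> \<le> L"
  shows "pexp U p (\<lambda>R. (f R)\<^sup>2) - (pexp U p f)\<^sup>2 \<le> real (card U) * (p * L\<^sup>2)"
  using assms(1,4)
proof (induction U arbitrary: f)
  case (insert e U)
  define g where "g = (\<lambda>R. f (insert e R))"
  define a b where "a = pexp U p g" and "b = pexp U p f"
  let ?V = "real (card U) * (p * L\<^sup>2)"
  have f: "pexp U p (\<lambda>R. (f R)\<^sup>2) - b\<^sup>2 \<le> ?V"
    unfolding b_def using insert.prems by (intro insert.IH) auto
  have g: "pexp U p (\<lambda>R. (g R)\<^sup>2) - a\<^sup>2 \<le> ?V"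
    unfolding a_def
  proof (rule insert.IH)
    fix e' R assume "e' \<in> U" "R \<subseteq> U"
    then show "\<bar>g (insert e' R) - g R\<bar> \<le> L"
      using insert.prems[of e' "insert e R"] by (auto simp: g_def insert_commute)
  qed
  have d: "\<bar>g R - f R\<bar> \<le> L" if "R \<subseteq> U" for R
    using insert.prems[of e R] that by (auto simp: g_def)
  have "a - b \<le> L" "b - a \<le> L"
  proof -
    have "pexp U p (\<lambda>R. g R - f R) \<le> pexp U p (\<lambda>_. L)"
      using d by (intro pexp_mono assms) (auto simp: abs_le_iff)
    then show "a - b \<le> L" using insert by (simp add: pexp_diff pexp_const a_def b_def)
    have "pexp U p (\<lambda>R. f R - g R) \<le> pexp U p (\<lambda>_. L)"
      using d by (intro pexp_mono assms) (auto simp: abs_le_iff)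
    then show "b - a \<le> L" using insert by (simp add: pexp_diff pexp_const a_def b_def)
  qed
  then have ab: "(a - b)\<^sup>2 \<le> L\<^sup>2" by (intro abs_le_square_iff[THEN iffD1]) auto
  have "p * (1 - p) * (a - b)\<^sup>2 \<le> p * 1 * L\<^sup>2"
    using assms(2,3) ab by (intro mult_mono) auto
  moreover have "p * (pexp U p (\<lambda>R. (g R)\<^sup>2) - a\<^sup>2) \<le> p * ?V"
    "(1 - p) * (pexp U p (\<lambda>R. (f R)\<^sup>2) - b\<^sup>2) \<le> (1 - p) * ?V"
    using f g assms(2,3) by (intro mult_left_mono; simp)+
  moreover have "pexp (insert e U) p (\<lambda>R. (f R)\<^sup>2) - (pexp (insert e U) p f)\<^sup>2 =
      p * (pexp U p (\<lambda>R. (g R)\<^sup>2) - a\<^sup>2) + (1 - p) * (pexp U p (\<lambda>R. (f R)\<^sup>2) - b\<^sup>2)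
      + p * (1 - p) * (a - b)\<^sup>2"
    using insert.hyps
    by (simp add: pexp_insert power2_eq_square algebra_simps a_def b_def g_def)
  ultimately have "pexp (insert e U) p (\<lambda>R. (f R)\<^sup>2) - (pexp (insert e U) p f)\<^sup>2
      \<le> p * ?V + (1 - p) * ?V + p * L\<^sup>2" by simp
  also have "\<dots> = real (card (insert e U)) * (p * L\<^sup>2)"
    using insert.hyps by (simp add: algebra_simps)
  finally show ?case .
qed simp

lemma chebyshev_pexp:
  assumes "finite U" "0 \<le> p" "p \<le> 1" "0 < t"
    "\<And>e R. e \<in> U \<Longrightarrow> R \<subseteq> U \<Longrightarrow> \<bar>f (insert e R) - f R\<bar> \<le> L"
  shows "pprob U p (\<lambda>R. t \<le> \<bar>f R - pexp U p f\<bar>) \<le> real (card U) * (p * L\<^sup>2) / t\<^sup>2"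
proof -
  define m where "m = pexp U p f"
  have "t\<^sup>2 * pprob U p (\<lambda>R. t \<le> \<bar>f R - m\<bar>) \<le> pexp U p (\<lambda>R. (f R - m)\<^sup>2)"
    using assms(4) by (intro markov_pexp assms) (auto intro: power_mono simp: abs_le_square_iff[symmetric])
  also have "pexp U p (\<lambda>R. (f R - m)\<^sup>2) = pexp U p (\<lambda>R. (f R)\<^sup>2) - m\<^sup>2"
  proof -
    have "pexp U p (\<lambda>R. (f R - m)\<^sup>2) = pexp U p (\<lambda>R. (f R)\<^sup>2 + m\<^sup>2 - (2 * m) * f R)"
      by (intro pexp_cong) (simp add: power2_diff)
    also have "\<dots> = pexp U p (\<lambda>R. (f R)\<^sup>2) + m\<^sup>2 - (2 * m) * m"
      unfolding pexp_diff pexp_add pexp_cmult pexp_const[OF assms(1)] by (simp add: m_def)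
    finally show ?thesis by (simp add: power2_eq_square)
  qed
  also have "\<dots> \<le> real (card U) * (p * L\<^sup>2)"
    unfolding m_def by (intro pexp_second_moment_le assms)
  finally show ?thesis using assms(4) by (simp add: m_def field_simps)
qed

section \<open>Transfer to the probability mass function\<close>

lemma random_edges_insert:
  assumes "finite E" "e \<notin> E"
  shows "random_edges (insert e E) p =
    bernoulli_pmf p \<bind> (\<lambda>b. map_pmf (\<lambda>R. if b then insert e R else R) (random_edges E p))"
proof -
  have *: "{x \<in> insert e E. (k(e := b)) x} = (if b then insert e {x \<in> E. k x} else {x \<in> E. k x})" for k b
    using assms(2) by auto
  show ?thesis
    unfolding random_edges_def Pi_pmf_insert[OF assms] map_pmf_comp pair_pmf_def map_bind_pmf
    unfolding map_pmf_def bind_assoc_pmf bind_return_pmf case_prod_conv * ..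
qed

text \<open>Finiteness of the support is carried through the induction because the expectation of a
  bind is split into a finite sum there.\<close>

lemma expectation_random_edges:
  assumes "finite E" "0 \<le> p" "p \<le> 1"
  shows "finite (set_pmf (random_edges E p)) \<and> measure_pmf.expectation (random_edges E p) f = pexp E p f"
  using assms(1)
proof (induction E arbitrary: f)
  case empty
  then show ?case by (simp add: random_edges_def)
next
  case (insert e E)
  let ?g = "\<lambda>b. map_pmf (\<lambda>R. if b then insert e R else R) (random_edges E p)"
  have fin: "finite (set_pmf (?g b))" for b using insert.IH by auto
  have "measure_pmf.expectation (random_edges (insert e E) p) f =
      (\<Sum>b\<in>UNIV. pmf (bernoulli_pmf p) b *\<^sub>R measure_pmf.expectation (?g b) f)"
    unfolding random_edges_insert[OF insert.hyps] using fin by (intro pmf_expectation_bind) auto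
  also have "\<dots> = pexp (insert e E) p f"
    using insert assms by (simp add: UNIV_bool pexp_insert)
  finally show ?case
    unfolding random_edges_insert[OF insert.hyps] using fin by auto
qed

lemma prob_random_edges:
  assumes "finite E" "0 \<le> p" "p \<le> 1"
  shows "measure_pmf.prob (random_edges E p) A = pprob E p (\<lambda>R. R \<in> A)"
proof -
  have "measure_pmf.prob (random_edges E p) A = measure_pmf.expectation (random_edges E p) (indicator A)"
    by simp
  also have "\<dots> = pexp E p (indicator A)"
    using expectation_random_edges[OF assms] by blast
  finally show ?thesis by (simp add: indicator_def[abs_def] of_bool_def)
qed

section \<open>Exploration of clusters\<close>

text \<open>The vertices of the explored graph are the values of \<open>f\<close>. With the identity
  one gets ordinary clusters; with \<open>f = cluster X\<close> the same exploration runs on the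
  graph in which the clusters of \<open>X\<close> are contracted.\<close>

inductive_set reach :: "('a \<Rightarrow> 'b) \<Rightarrow> 'a set set \<Rightarrow> 'b set \<Rightarrow> 'b set"
  for f :: "'a \<Rightarrow> 'b" and R :: "'a set set" and S :: "'b set" where
  reach_base: "x \<in> S \<Longrightarrow> x \<in> reach f R S"
| reach_step: "x \<in> reach f R S \<Longrightarrow> e \<in> R \<Longrightarrow> x \<in> f ` e \<Longrightarrow> y \<in> f ` e \<Longrightarrow> y \<in> reach f R S"

lemma subset_reach: "S \<subseteq> reach f R S"
  by (auto intro: reach_base)

lemma reach_minimal:
  assumes "S \<subseteq> T" "\<And>e. e \<in> R \<Longrightarrow> f ` e \<inter> T \<noteq> {} \<Longrightarrow> f ` e \<subseteq> T"
  shows "reach f R S \<subseteq> T"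
proof
  fix x assume "x \<in> reach f R S"
  then show "x \<in> T" by induction (use assms in auto)
qed

lemma reach_closed: "e \<in> R \<Longrightarrow> f ` e \<inter> reach f R S \<noteq> {} \<Longrightarrow> f ` e \<subseteq> reach f R S"
  by (auto intro: reach_step)

lemma reach_mono:
  assumes "R \<subseteq> R'" "S \<subseteq> S'"
  shows "reach f R S \<subseteq> reach f R' S'"
proof (rule reach_minimal)
  show "S \<subseteq> reach f R' S'" using assms(2) subset_reach by (rule subset_trans)
qed (use assms(1) in \<open>auto intro: reach_step\<close>)

lemma reach_idem: "reach f R (reach f R S) = reach f R S"
  by (intro antisym subset_reach reach_minimal) (auto intro: reach_step)

lemma reach_subset: "reach f R S \<subseteq> S \<union> f ` \<Union>R"
  by (rule reach_minimal) auto

text \<open>An open edge at \<open>S\<close> can be absorbed into the starting set and forgotten.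
  This turns an exploration into an induction on the number of unrevealed edges.\<close>

lemma reach_insert:
  assumes "f ` e \<inter> S \<noteq> {}"
  shows "reach f (insert e R) S = reach f R (S \<union> f ` e)"
proof (rule antisym)
  show "reach f (insert e R) S \<subseteq> reach f R (S \<union> f ` e)"
  proof (rule reach_minimal)
    show "S \<subseteq> reach f R (S \<union> f ` e)" using subset_reach[of "S \<union> f ` e" f R] by simp
    fix e' assume *: "e' \<in> insert e R" "f ` e' \<inter> reach f R (S \<union> f ` e) \<noteq> {}"
    have "f ` e \<subseteq> reach f R (S \<union> f ` e)" using subset_reach[of "S \<union> f ` e" f R] by simp
    then show "f ` e' \<subseteq> reach f R (S \<union> f ` e)" using * reach_closed[of e' R f "S \<union> f ` e"] by (cases "e' = e") simp_all
  qed
  have S: "S \<subseteq> reach f (insert e R) S" by (rule subset_reach)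
  then have "f ` e \<subseteq> reach f (insert e R) S" using assms by (intro reach_closed) auto
  with S have "S \<union> f ` e \<subseteq> reach f (insert e R) S" by simp
  then show "reach f R (S \<union> f ` e) \<subseteq> reach f (insert e R) S"
    using reach_mono[of R "insert e R" "S \<union> f ` e" "reach f (insert e R) S" f] by (auto simp: reach_idem)
qed

text \<open>Exploring a cluster completely queries every edge of \<open>touch\<close>; an
  exploration that skips edges inside the explored set still has to query every edge of
  \<open>bnd\<close>. The two counts serve as exponents of \<open>th\<close> in the weights
  below.\<close>

definition touch :: "('a \<Rightarrow> 'b) \<Rightarrow> 'a set set \<Rightarrow> 'b set \<Rightarrow> 'a set set" where
  "touch f U C = {e \<in> U. f ` e \<inter> C \<noteq> {}}"

definition bnd :: "('a \<Rightarrow> 'b) \<Rightarrow> 'a set set \<Rightarrow> 'b set \<Rightarrow> 'a set set" where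
  "bnd f U C = {e \<in> U. f ` e \<inter> C \<noteq> {} \<and> \<not> f ` e \<subseteq> C}"

lemma finite_touch [intro]: "finite U \<Longrightarrow> finite (touch f U C)"
  and finite_bnd [intro]: "finite U \<Longrightarrow> finite (bnd f U C)"
  by (auto simp: touch_def bnd_def)

lemma reach_eq_self: "bnd f R S = {} \<Longrightarrow> reach f R S = S"
  by (intro antisym subset_reach reach_minimal) (auto simp: bnd_def)

definition graph_edges :: "'a set set \<Rightarrow> bool" where
  "graph_edges U \<longleftrightarrow> finite U \<and> (\<forall>e\<in>U. \<exists>x y. e = {x, y})"

lemma graph_edges_finite: "graph_edges U \<Longrightarrow> finite U"
  by (simp add: graph_edges_def)

lemma graph_edges_subset: "graph_edges U \<Longrightarrow> U' \<subseteq> U \<Longrightarrow> graph_edges U'"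
  by (auto simp: graph_edges_def intro: finite_subset)

lemma finite_reach:
  assumes "graph_edges U" "R \<subseteq> U" "finite S"
  shows "finite (reach f R S)"
proof -
  have "finite (\<Union>R)"
    using assms by (auto simp: graph_edges_def intro!: finite_Union finite_subset[of R U])
  then have "finite (S \<union> f ` \<Union>R)" using assms by auto
  then show ?thesis by (rule finite_subset[OF reach_subset])
qed

lemma card_Un_edge:
  assumes "graph_edges U" "e \<in> U" "f ` e \<inter> S \<noteq> {}" "finite S"
  shows "card (S \<union> f ` e) \<le> Suc (card S)" "finite (S \<union> f ` e)"
    "\<not> f ` e \<subseteq> S \<Longrightarrow> card (S \<union> f ` e) = Suc (card S)"
proof -
  obtain x y where e: "e = {x, y}" using assms(1,2) unfolding graph_edges_def by meson
  consider "f x \<in> S" | "f y \<in> S" using assms(3) e by auto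
  then have "card (S \<union> f ` e) \<le> Suc (card S) \<and> (\<not> f ` e \<subseteq> S \<longrightarrow> card (S \<union> f ` e) = Suc (card S))"
  proof cases
    case 1
    then have "S \<union> f ` e = insert (f y) S" using e by auto
    then show ?thesis using assms(4) 1 e by (auto simp: card_insert_if)
  next
    case 2
    then have "S \<union> f ` e = insert (f x) S" using e by auto
    then show ?thesis using assms(4) 2 e by (auto simp: card_insert_if)
  qed
  then show "card (S \<union> f ` e) \<le> Suc (card S)" "\<not> f ` e \<subseteq> S \<Longrightarrow> card (S \<union> f ` e) = Suc (card S)"
    by auto
  show "finite (S \<union> f ` e)" using assms(4) e by auto
qed

lemma card_touch_insert:
  assumes "finite U" "e \<notin> U" "f ` e \<inter> C \<noteq> {}"
  shows "card (touch f (insert e U) C) = Suc (card (touch f U C))"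
proof -
  have "touch f (insert e U) C = insert e (touch f U C)" using assms(3) by (auto simp: touch_def)
  moreover have "e \<notin> touch f U C" using assms(2) by (auto simp: touch_def)
  ultimately show ?thesis using assms(1) by (simp add: finite_touch)
qed

lemma card_bnd_insert_le:
  assumes "finite U"
  shows "card (bnd f (insert e U) C) \<le> Suc (card (bnd f U C))"
proof -
  have "bnd f (insert e U) C \<subseteq> insert e (bnd f U C)" by (auto simp: bnd_def)
  then have "card (bnd f (insert e U) C) \<le> card (insert e (bnd f U C))"
    using assms by (intro card_mono) auto
  also have "\<dots> \<le> Suc (card (bnd f U C))" using assms by (simp add: card_insert_if finite_bnd)
  finally show ?thesis .
qed

section \<open>Exploration weights\<close>

text \<open>A query multiplies the weight by \<open>th\<close>, and by \<open>lam\<close> with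
  probability \<open>p\<close> when it finds a new vertex; the second conclusion says that
  \<open>th\<close> makes this fair.\<close>

lemma exploration_theta:
  fixes p lam th :: real
  assumes "0 \<le> p" "0 \<le> lam" "p < 1 \<or> 1 \<le> lam" "th = 1 / (1 + p * (lam - 1))"
  shows "0 < th" "th * (p * lam + (1 - p)) = 1" "lam \<le> 1 \<Longrightarrow> 1 \<le> th"
proof -
  have D: "0 < 1 + p * (lam - 1)"
  proof (cases "p < 1")
    case True
    then have "0 < (1 - p) + p * lam" using assms by (intro add_pos_nonneg) auto
    then show ?thesis by (simp add: algebra_simps)
  next
    case False
    then show ?thesis using assms by (intro add_pos_nonneg) auto
  qed
  then show "0 < th" using assms(4) by simp
  show "th * (p * lam + (1 - p)) = 1" using D assms(4) by (simp add: algebra_simps)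
  assume "lam \<le> 1"
  then have "p * (lam - 1) \<le> 0" using assms(1) by (simp add: mult_nonneg_nonpos)
  then show "1 \<le> th" using D assms(4) by simp
qed

text \<open>Each edge at the cluster is queried once. An open edge adds at most one vertex, and none
  if both ends are already explored; for \<open>lam \<ge> 1\<close> such a waste only lowers the
  weight.\<close>

lemma exploration_touch_upper:
  assumes "graph_edges U" "finite S" "0 \<le> p" "p \<le> 1" "1 \<le> lam" "th = 1 / (1 + p * (lam - 1))"
  shows "pexp U p (\<lambda>R. lam ^ card (reach f R S) * th ^ card (touch f U (reach f R S))) \<le> lam ^ card S"
  using assms(1,2)
proof (induction "card U" arbitrary: U S)
  case 0
  then show ?case by (auto simp: graph_edges_def touch_def reach_eq_self bnd_def)
next
  case (Suc k)
  have fin: "finite U" using Suc.prems by (simp add: graph_edges_def)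
  show ?case
  proof (cases "touch f U S = {}")
    case True
    have "reach f R S = S" if "R \<subseteq> U" for R
      using True that by (intro reach_eq_self) (auto simp: touch_def bnd_def)
    then have "pexp U p (\<lambda>R. lam ^ card (reach f R S) * th ^ card (touch f U (reach f R S)))
        = pexp U p (\<lambda>R. lam ^ card S)"
      using True by (intro pexp_cong) simp
    then show ?thesis using fin by (simp add: pexp_const)
  next
    case False
    then obtain e where e: "e \<in> U" "f ` e \<inter> S \<noteq> {}" by (auto simp: touch_def)
    define U' where "U' = U - {e}"
    have U': "U = insert e U'" "e \<notin> U'" "finite U'" "graph_edges U'" "k = card U'"
      using e fin Suc.hyps(2) Suc.prems(1) by (auto simp: U'_def graph_edges_def)
    let ?g = "\<lambda>S R. lam ^ card (reach f R S) * th ^ card (touch f U' (reach f R S))"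
    have t: "card (touch f U (reach f R S')) = Suc (card (touch f U' (reach f R S')))"
      if "S \<subseteq> S'" for R S'
      unfolding U'(1) using e(2) subset_reach[of S' f R] that U' by (intro card_touch_insert) auto
    have gt: "lam ^ card (reach f R S') * th ^ card (touch f U (reach f R S')) = th * ?g S' R"
      if "S \<subseteq> S'" for R S'
      unfolding t[OF that] by simp
    have th: "0 < th" "th * (p * lam + (1 - p)) = 1"
      using exploration_theta[of p lam th] assms by auto
    have "pexp U p (\<lambda>R. lam ^ card (reach f R S) * th ^ card (touch f U (reach f R S))) =
        p * (th * pexp U' p (?g (S \<union> f ` e))) + (1 - p) * (th * pexp U' p (?g S))"
      unfolding pexp_insert[OF U'(3,2), folded U'(1)] reach_insert[of f e S, OF e(2)]
      unfolding gt[OF subset_refl] gt[OF Un_upper1] pexp_cmult ..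
    also have "\<dots> \<le> p * (th * lam ^ Suc (card S)) + (1 - p) * (th * lam ^ card S)"
    proof -
      have "pexp U' p (?g (S \<union> f ` e)) \<le> lam ^ card (S \<union> f ` e)"
        using Suc.hyps(1)[OF U'(5,4)] card_Un_edge(2)[OF Suc.prems(1) e Suc.prems(2)] by blast
      also have "\<dots> \<le> lam ^ Suc (card S)"
        using card_Un_edge(1)[OF Suc.prems(1) e Suc.prems(2)] assms by (intro power_increasing) auto
      finally have "pexp U' p (?g (S \<union> f ` e)) \<le> lam ^ Suc (card S)" .
      moreover have "pexp U' p (?g S) \<le> lam ^ card S"
        using Suc.hyps(1)[OF U'(5,4) Suc.prems(2)] .
      ultimately show ?thesis using assms th by (intro add_mono mult_left_mono) auto
    qed
    also have "\<dots> = (th * (p * lam + (1 - p))) * lam ^ card S" by (simp add: algebra_simps)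
    finally show ?thesis using th by simp
  qed
qed

text \<open>For \<open>lam \<le> 1\<close> an open edge that adds no vertex raises the weight
  compared with a fair query, so the inequality turns around.\<close>

lemma exploration_touch_lower:
  assumes "graph_edges U" "finite S" "0 \<le> p" "p < 1" "0 \<le> lam" "lam \<le> 1" "th = 1 / (1 + p * (lam - 1))"
  shows "lam ^ card S \<le> pexp U p (\<lambda>R. lam ^ card (reach f R S) * th ^ card (touch f U (reach f R S)))"
  using assms(1,2)
proof (induction "card U" arbitrary: U S)
  case 0
  then show ?case by (auto simp: graph_edges_def touch_def reach_eq_self bnd_def)
next
  case (Suc k)
  have fin: "finite U" using Suc.prems by (simp add: graph_edges_def)
  show ?case
  proof (cases "touch f U S = {}")
    case True
    have "reach f R S = S" if "R \<subseteq> U" for R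
      using True that by (intro reach_eq_self) (auto simp: touch_def bnd_def)
    then have "pexp U p (\<lambda>R. lam ^ card (reach f R S) * th ^ card (touch f U (reach f R S)))
        = pexp U p (\<lambda>R. lam ^ card S)"
      using True by (intro pexp_cong) simp
    then show ?thesis using fin by (simp add: pexp_const)
  next
    case False
    then obtain e where e: "e \<in> U" "f ` e \<inter> S \<noteq> {}" by (auto simp: touch_def)
    define U' where "U' = U - {e}"
    have U': "U = insert e U'" "e \<notin> U'" "finite U'" "graph_edges U'" "k = card U'"
      using e fin Suc.hyps(2) Suc.prems(1) by (auto simp: U'_def graph_edges_def)
    let ?g = "\<lambda>S R. lam ^ card (reach f R S) * th ^ card (touch f U' (reach f R S))"
    have t: "card (touch f U (reach f R S')) = Suc (card (touch f U' (reach f R S')))"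
      if "S \<subseteq> S'" for R S'
      unfolding U'(1) using e(2) subset_reach[of S' f R] that U' by (intro card_touch_insert) auto
    have gt: "lam ^ card (reach f R S') * th ^ card (touch f U (reach f R S')) = th * ?g S' R"
      if "S \<subseteq> S'" for R S'
      unfolding t[OF that] by simp
    have th: "0 < th" "th * (p * lam + (1 - p)) = 1"
      using exploration_theta[of p lam th] assms by auto
    have "lam ^ card S = (th * (p * lam + (1 - p))) * lam ^ card S" using th by simp
    also have "\<dots> = p * (th * lam ^ Suc (card S)) + (1 - p) * (th * lam ^ card S)"
      by (simp add: algebra_simps)
    also have "\<dots> \<le> p * (th * pexp U' p (?g (S \<union> f ` e))) + (1 - p) * (th * pexp U' p (?g S))"
    proof -
      have "lam ^ Suc (card S) \<le> lam ^ card (S \<union> f ` e)"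
        using card_Un_edge(1)[OF Suc.prems(1) e Suc.prems(2)] assms by (intro power_decreasing) auto
      also have "\<dots> \<le> pexp U' p (?g (S \<union> f ` e))"
        using Suc.hyps(1)[OF U'(5,4)] card_Un_edge(2)[OF Suc.prems(1) e Suc.prems(2)] by blast
      finally have "lam ^ Suc (card S) \<le> pexp U' p (?g (S \<union> f ` e))" .
      moreover have "lam ^ card S \<le> pexp U' p (?g S)"
        using Suc.hyps(1)[OF U'(5,4) Suc.prems(2)] .
      ultimately show ?thesis using assms th by (intro add_mono mult_left_mono) auto
    qed
    also have "\<dots> = pexp U p (\<lambda>R. lam ^ card (reach f R S) * th ^ card (touch f U (reach f R S)))"
      unfolding pexp_insert[OF U'(3,2), folded U'(1)] reach_insert[of f e S, OF e(2)]
      unfolding gt[OF subset_refl] gt[OF Un_upper1] pexp_cmult ..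
    finally show ?thesis .
  qed
qed

text \<open>To keep an upper bound for \<open>lam \<le> 1\<close>, only edges leaving the explored
  set are queried, so that an open one adds exactly one vertex. A queried edge may end up inside the
  final cluster; \<open>bnd\<close> then undercounts the queries, which is harmless as
  \<open>th \<ge> 1\<close>.\<close>

lemma exploration_bnd_upper:
  assumes "graph_edges U" "finite S" "0 \<le> p" "p < 1" "0 \<le> lam" "lam \<le> 1" "th = 1 / (1 + p * (lam - 1))"
  shows "pexp U p (\<lambda>R. lam ^ card (reach f R S) * th ^ card (bnd f U (reach f R S))) \<le> lam ^ card S"
  using assms(1,2)
proof (induction "card U" arbitrary: U S)
  case 0
  then show ?case by (auto simp: graph_edges_def reach_eq_self bnd_def)
next
  case (Suc k)
  have fin: "finite U" using Suc.prems by (simp add: graph_edges_def)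
  show ?case
  proof (cases "bnd f U S = {}")
    case True
    have "reach f R S = S" if "R \<subseteq> U" for R
      using True that by (intro reach_eq_self) (auto simp: bnd_def)
    then have "pexp U p (\<lambda>R. lam ^ card (reach f R S) * th ^ card (bnd f U (reach f R S)))
        = pexp U p (\<lambda>R. lam ^ card S)"
      using True by (intro pexp_cong) simp
    then show ?thesis using fin by (simp add: pexp_const)
  next
    case False
    then obtain e where e: "e \<in> U" "f ` e \<inter> S \<noteq> {}" "\<not> f ` e \<subseteq> S" by (auto simp: bnd_def)
    define U' where "U' = U - {e}"
    have U': "U = insert e U'" "e \<notin> U'" "finite U'" "graph_edges U'" "k = card U'"
      using e fin Suc.hyps(2) Suc.prems(1) by (auto simp: U'_def graph_edges_def)
    let ?g = "\<lambda>S R. lam ^ card (reach f R S) * th ^ card (bnd f U' (reach f R S))"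
    have th: "1 \<le> th" "th * (p * lam + (1 - p)) = 1"
      using exploration_theta[of p lam th] assms by auto
    have t: "lam ^ card (reach f R S') * th ^ card (bnd f U (reach f R S')) \<le> th * ?g S' R" for R S'
    proof -
      have "th ^ card (bnd f U (reach f R S')) \<le> th ^ Suc (card (bnd f U' (reach f R S')))"
        unfolding U'(1) using th U' by (intro power_increasing card_bnd_insert_le) auto
      then have "lam ^ card (reach f R S') * th ^ card (bnd f U (reach f R S'))
          \<le> lam ^ card (reach f R S') * th ^ Suc (card (bnd f U' (reach f R S')))"
        using assms by (intro mult_left_mono) auto
      then show ?thesis by (simp add: mult.left_commute)
    qed
    have "pexp U p (\<lambda>R. lam ^ card (reach f R S) * th ^ card (bnd f U (reach f R S))) =
       p * pexp U' p (\<lambda>R. lam ^ card (reach f R (S \<union> f ` e)) * th ^ card (bnd f U (reach f R (S \<union> f ` e))))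
       + (1 - p) * pexp U' p (\<lambda>R. lam ^ card (reach f R S) * th ^ card (bnd f U (reach f R S)))"
      unfolding U'(1) pexp_insert[OF U'(3,2)] reach_insert[of f e S, OF e(2)] ..
    also have "\<dots> \<le> p * pexp U' p (\<lambda>R. th * ?g (S \<union> f ` e) R) + (1 - p) * pexp U' p (\<lambda>R. th * ?g S R)"
      using assms t by (intro add_mono mult_left_mono pexp_mono) auto
    also have "\<dots> = p * (th * pexp U' p (?g (S \<union> f ` e))) + (1 - p) * (th * pexp U' p (?g S))"
      unfolding pexp_cmult ..
    also have "\<dots> \<le> p * (th * lam ^ Suc (card S)) + (1 - p) * (th * lam ^ card S)"
    proof -
      have "pexp U' p (?g (S \<union> f ` e)) \<le> lam ^ Suc (card S)"
        using Suc.hyps(1)[OF U'(5,4) card_Un_edge(2)[OF Suc.prems(1) e(1,2) Suc.prems(2)]]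
        unfolding card_Un_edge(3)[OF Suc.prems(1) e(1,2) Suc.prems(2) e(3)] .
      moreover have "pexp U' p (?g S) \<le> lam ^ card S"
        using Suc.hyps(1)[OF U'(5,4) Suc.prems(2)] .
      ultimately show ?thesis using assms(3,4) th(1) by (intro add_mono mult_left_mono) auto
    qed
    also have "\<dots> = (th * (p * lam + (1 - p))) * lam ^ card S" by (simp add: algebra_simps)
    finally show ?thesis using th by simp
  qed
qed

text \<open>With at most \<open>D\<close> queries per vertex the weight of a cluster
  \<open>C\<close> is at least \<open>rho ^ card C\<close>, and Markov's inequality applies.\<close>

lemma cluster_tail_subcritical:
  assumes "graph_edges U" "0 \<le> p" "p \<le> 1" "1 \<le> lam"
    "\<And>R. R \<subseteq> U \<Longrightarrow> card (touch f U (reach f R {s})) \<le> D * card (reach f R {s})"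
    "1 \<le> rho" "rho * (1 + p * (lam - 1)) ^ D \<le> lam"
  shows "rho ^ m * pprob U p (\<lambda>R. m \<le> card (reach f R {s})) \<le> lam"
proof -
  define th where "th = 1 / (1 + p * (lam - 1))"
  have D: "1 \<le> 1 + p * (lam - 1)" using assms by simp
  have th: "0 < th" "th \<le> 1" using D by (auto simp: th_def)
  have rho: "rho \<le> lam * th ^ D"
    using assms(7) D by (simp add: th_def power_one_over field_simps)
  have "rho ^ m * pprob U p (\<lambda>R. m \<le> card (reach f R {s})) \<le>
      pexp U p (\<lambda>R. lam ^ card (reach f R {s}) * th ^ card (touch f U (reach f R {s})))"
  proof (intro markov_pexp assms)
    fix R assume R: "R \<subseteq> U"
    let ?C = "reach f R {s}"
    show "0 \<le> lam ^ card ?C * th ^ card (touch f U ?C)" using assms th by simp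
    assume "m \<le> card ?C"
    then have "rho ^ m \<le> rho ^ card ?C" using assms by (intro power_increasing) auto
    also have "\<dots> \<le> (lam * th ^ D) ^ card ?C" using rho assms by (intro power_mono) auto
    also have "\<dots> = lam ^ card ?C * th ^ (D * card ?C)"
      by (simp add: power_mult_distrib power_mult)
    also have "\<dots> \<le> lam ^ card ?C * th ^ card (touch f U ?C)"
      using assms(4) assms(5)[OF R] th by (intro mult_left_mono power_decreasing) auto
    finally show "rho ^ m \<le> lam ^ card ?C * th ^ card (touch f U ?C)" .
  qed (use assms(6) in simp)
  also have "\<dots> \<le> lam ^ card {s}"
    by (rule exploration_touch_upper) (use assms th_def in auto)
  finally show ?thesis by simp
qed

text \<open>Here the weight is at most \<open>rho ^ card C\<close>, thus at most 1 on small clusters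
  and at most \<open>rho ^ m\<close> on the others, while its mean is at least
  \<open>lam\<close>.\<close>

lemma cluster_small_lower:
  assumes "graph_edges U" "0 \<le> p" "p < 1" "0 \<le> lam" "lam \<le> 1"
    "\<And>R. R \<subseteq> U \<Longrightarrow> card (touch f U (reach f R {s})) \<le> D * card (reach f R {s})"
    "rho \<le> 1" "lam \<le> rho * (1 - p * (1 - lam)) ^ D"
  shows "lam \<le> pprob U p (\<lambda>R. card (reach f R {s}) < m) + rho ^ m"
proof -
  define th where "th = 1 / (1 + p * (lam - 1))"
  have th: "1 \<le> th" using exploration_theta(3)[OF assms(2,4) _ th_def] assms by auto
  have D: "0 < 1 - p * (1 - lam)" "th = 1 / (1 - p * (1 - lam))"
    using exploration_theta(1)[OF assms(2,4) _ th_def] assms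
    by (auto simp: th_def algebra_simps zero_less_divide_iff)
  have rho: "lam * th ^ D \<le> rho"
    unfolding D(2) power_one_over using assms(8) D(1)
    by (simp add: pos_le_divide_eq pos_divide_le_eq)
  have rho0: "0 \<le> rho" using order_trans[OF _ rho, of 0] assms(4) th by simp
  have "lam ^ card {s} \<le> pexp U p (\<lambda>R. lam ^ card (reach f R {s}) * th ^ card (touch f U (reach f R {s})))"
    by (rule exploration_touch_lower) (use assms th_def in auto)
  also have "\<dots> \<le> pexp U p (\<lambda>R. of_bool (card (reach f R {s}) < m) + rho ^ m)"
  proof (intro pexp_mono)
    fix R assume R: "R \<subseteq> U"
    let ?C = "reach f R {s}"
    have "lam ^ card ?C * th ^ card (touch f U ?C) \<le> lam ^ card ?C * th ^ (D * card ?C)"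
      using assms(4) assms(6)[OF R] th by (intro mult_left_mono power_increasing) auto
    also have "\<dots> = (lam * th ^ D) ^ card ?C"
      by (simp add: power_mult_distrib power_mult)
    also have "\<dots> \<le> rho ^ card ?C" using rho assms(4) th by (intro power_mono) auto
    also have "\<dots> \<le> of_bool (card ?C < m) + rho ^ m"
    proof (cases "card ?C < m")
      case True
      have "rho ^ card ?C \<le> 1" "0 \<le> rho ^ m" using rho0 assms(7) by (auto simp: power_le_one)
      then show ?thesis using True by simp
    next
      case False
      then show ?thesis using rho0 assms(7) by (auto intro: power_decreasing)
    qed
    finally show "lam ^ card ?C * th ^ card (touch f U ?C) \<le> of_bool (card ?C < m) + rho ^ m" .
  qed (use assms in auto)
  also have "\<dots> = pprob U p (\<lambda>R. card (reach f R {s}) < m) + rho ^ m"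
    unfolding pexp_add pexp_const[OF graph_edges_finite[OF assms(1)]] ..
  finally show ?thesis by simp
qed

text \<open>Below order \<open>M\<close> isoperimetry supplies \<open>d\<close> boundary queries per
  vertex, so the weight is at least \<open>rho ^ card C\<close>. The case \<open>m = 0\<close>
  bounds the probability of a small cluster by \<open>lam\<close>.\<close>

lemma cluster_gap_upper:
  assumes "graph_edges U" "0 \<le> p" "p < 1" "0 \<le> lam" "lam \<le> 1"
    "\<And>R. R \<subseteq> U \<Longrightarrow> card (reach f R {s}) < M \<Longrightarrow> d * card (reach f R {s}) \<le> card (bnd f U (reach f R {s}))"
    "1 \<le> rho" "rho * (1 - p * (1 - lam)) ^ d \<le> lam"
  shows "rho ^ m * pprob U p (\<lambda>R. m \<le> card (reach f R {s}) \<and> card (reach f R {s}) < M) \<le> lam"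
proof -
  define th where "th = 1 / (1 + p * (lam - 1))"
  have th: "1 \<le> th" using exploration_theta(3)[OF assms(2,4) _ th_def] assms by auto
  have D: "0 < 1 - p * (1 - lam)" "th = 1 / (1 - p * (1 - lam))"
    using exploration_theta(1)[OF assms(2,4) _ th_def] assms
    by (auto simp: th_def algebra_simps zero_less_divide_iff)
  have rho: "rho \<le> lam * th ^ d"
    unfolding D(2) power_one_over using assms(8) D(1)
    by (simp add: pos_le_divide_eq pos_divide_le_eq)
  have "rho ^ m * pprob U p (\<lambda>R. m \<le> card (reach f R {s}) \<and> card (reach f R {s}) < M) \<le>
      pexp U p (\<lambda>R. lam ^ card (reach f R {s}) * th ^ card (bnd f U (reach f R {s})))"
  proof (intro markov_pexp)
    fix R assume R: "R \<subseteq> U"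
    let ?C = "reach f R {s}"
    show "0 \<le> lam ^ card ?C * th ^ card (bnd f U ?C)" using assms th by simp
    assume C: "m \<le> card ?C \<and> card ?C < M"
    then have "rho ^ m \<le> rho ^ card ?C" using assms by (intro power_increasing) auto
    also have "\<dots> \<le> (lam * th ^ d) ^ card ?C" using rho assms by (intro power_mono) auto
    also have "\<dots> = lam ^ card ?C * th ^ (d * card ?C)"
      by (simp add: power_mult_distrib power_mult)
    also have "\<dots> \<le> lam ^ card ?C * th ^ card (bnd f U ?C)"
      using assms(4) assms(6)[OF R] C th by (intro mult_left_mono power_increasing) auto
    finally show "rho ^ m \<le> lam ^ card ?C * th ^ card (bnd f U ?C)" .
  qed (use assms in auto)
  also have "\<dots> \<le> lam ^ card {s}"
    by (rule exploration_bnd_upper) (use assms th_def in auto)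
  finally show ?thesis by simp
qed

lemma pprob_avoid:
  assumes "finite U" "A \<subseteq> U"
  shows "pprob U p (\<lambda>R. R \<inter> A = {}) = (1 - p) ^ card A"
proof -
  have "finite A" using assms finite_subset by auto
  then have "pprob A p (\<lambda>R. R = {}) = (1 - p) ^ card A"
  proof induction
    case (insert e A)
    have "pprob A p (\<lambda>R. insert e R = {}) = 0"
      using insert.hyps by (simp add: pexp_const)
    then show ?case using insert by (simp add: pexp_insert pexp_const)
  qed simp
  then show ?thesis using pexp_restrict[OF assms, of p "\<lambda>R. of_bool (R = {})"] by simp
qed

text \<open>At each size the exploration queries at most \<open>h\<close> boundary edges until one is open;
  once the cluster has exactly \<open>k\<close> vertices, all remaining edges at it are required to be closed.\<close>

lemma staged_exploration:
  assumes "graph_edges U" "0 \<le> p" "p \<le> 1" "S \<subseteq> V" "\<And>e. e \<in> U \<Longrightarrow> f ` e \<subseteq> V"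
    "finite S" "F \<subseteq> bnd f U S" "card F \<le> h" "card S < k"
    "\<And>T. S \<subseteq> T \<Longrightarrow> T \<subseteq> V \<Longrightarrow> finite T \<Longrightarrow> card S < card T \<Longrightarrow> card T < k \<Longrightarrow>
      h * (card T - card S) + card F \<le> card (bnd f U T)"
    "\<And>T. T \<subseteq> V \<Longrightarrow> finite T \<Longrightarrow> card T = k \<Longrightarrow> card (touch f U T) \<le> D"
  shows "(1 - (1 - p) ^ card F) * ((1 - (1 - p) ^ h) ^ (k - card S - 1) * (1 - p) ^ D)
    \<le> pprob U p (\<lambda>R. card (reach f R S) = k)"
  using assms(1,4-11)
proof (induction "card U" arbitrary: U S F)
  case 0
  then have "U = {}" by (auto simp: graph_edges_def)
  then have "F = {}" using 0 by (auto simp: bnd_def)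
  then show ?case using \<open>U = {}\<close> by simp
next
  case (Suc j)
  note IH = Suc.hyps(1)
  note gU = Suc.prems(1) and SV = Suc.prems(2) and UV = Suc.prems(3) and finS = Suc.prems(4)
    and F = Suc.prems(5) and cF = Suc.prems(6) and Sk = Suc.prems(7) and isop = Suc.prems(8)
    and tch = Suc.prems(9)
  have finU: "finite U" using gU by (simp add: graph_edges_def)
  have finF: "finite F" using F finU by (auto intro: finite_subset)
  define L where "L = (1 - (1 - p) ^ h) ^ (k - card S - 1) * (1 - p) ^ D"
  show ?case
  proof (cases "F = {}")
    case True
    then show ?thesis using assms by (simp add: pexp_nonneg)
  next
    case False
    then obtain e where e: "e \<in> F" by auto
    then have eU: "e \<in> U" "f ` e \<inter> S \<noteq> {}" "\<not> f ` e \<subseteq> S" using F by (auto simp: bnd_def)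
    define U' where "U' = U - {e}"
    have U': "U = insert e U'" "e \<notin> U'" "finite U'" "graph_edges U'" "j = card U'"
      using eU finU Suc.hyps(2) gU by (auto simp: U'_def graph_edges_def)
    have UV': "\<And>e. e \<in> U' \<Longrightarrow> f ` e \<subseteq> V" using UV U' by auto
    have bnd': "card (bnd f U T) \<le> Suc (card (bnd f U' T))" for T
      unfolding U'(1) by (intro card_bnd_insert_le U')
    have tch': "card (touch f U' T) \<le> D" if "T \<subseteq> V" "finite T" "card T = k" for T
    proof -
      have "touch f U' T \<subseteq> touch f U T" using U' by (auto simp: touch_def)
      then have "card (touch f U' T) \<le> card (touch f U T)" using finU by (intro card_mono) auto
      with tch[OF that] show ?thesis by simp
    qed
    obtain m where m: "card F = Suc m" using e finF by (cases "card F") auto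
    have mF: "card (F - {e}) = m" using m e finF by simp
    have L0: "0 \<le> L" using assms(2,3) by (simp add: L_def power_le_one)
    \<comment> \<open>If \<open>e\<close> is closed, both sides of the edge budget
      \<open>isop\<close> may drop by one: \<open>e\<close> leaves \<open>U\<close> and also
      \<open>F\<close>.\<close>
    have closed: "(1 - (1 - p) ^ m) * L \<le> pprob U' p (\<lambda>R. card (reach f R S) = k)"
    proof -
      have "(1 - (1 - p) ^ card (F - {e})) * ((1 - (1 - p) ^ h) ^ (k - card S - 1) * (1 - p) ^ D)
          \<le> pprob U' p (\<lambda>R. card (reach f R S) = k)"
      proof (rule IH[OF U'(5,4) SV UV' finS _ _ Sk _ tch'])
        show "F - {e} \<subseteq> bnd f U' S" using F by (auto simp: bnd_def U'_def)
        show "card (F - {e}) \<le> h" using mF m cF by simp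
        fix T assume T: "S \<subseteq> T" "T \<subseteq> V" "finite T" "card S < card T" "card T < k"
        show "h * (card T - card S) + card (F - {e}) \<le> card (bnd f U' T)"
          using isop[OF T] bnd'[of T] m mF by simp
      qed
      then show ?thesis unfolding mF L_def .
    qed
    define S' where "S' = S \<union> f ` e"
    have S': "finite S'" "card S' = Suc (card S)" "S' \<subseteq> V" "S \<subseteq> S'"
      using card_Un_edge[OF gU eU(1,2) finS] eU(3) SV UV[OF eU(1)] by (auto simp: S'_def)
    \<comment> \<open>If \<open>e\<close> is open, the next stage gets \<open>h\<close> fresh
      candidates. The summand \<open>card F\<close>, which is positive, covers the loss of
      \<open>e\<close> from the boundaries of larger sets.\<close>
    have opened: "L \<le> pprob U' p (\<lambda>R. card (reach f R S') = k)"
    proof (cases "card S' = k")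
      case True
      \<comment> \<open>No stage remains, as \<open>k - card S - 1 = 0\<close>; only closing the
        edges at \<open>S'\<close> has to be paid for.\<close>
      have "L = (1 - p) ^ D" using S' True by (simp add: L_def)
      also have "\<dots> \<le> (1 - p) ^ card (touch f U' S')"
        using tch'[OF S'(3,1) True] assms by (intro power_decreasing) auto
      also have "\<dots> = pprob U' p (\<lambda>R. R \<inter> touch f U' S' = {})"
        using U' by (intro pprob_avoid[symmetric]) (auto simp: touch_def)
      also have "\<dots> \<le> pprob U' p (\<lambda>R. card (reach f R S') = k)"
      proof (intro pprob_mono assms)
        fix R assume "R \<subseteq> U'" "R \<inter> touch f U' S' = {}"
        then have "reach f R S' = S'" by (intro reach_eq_self) (auto simp: touch_def bnd_def)
        then show "card (reach f R S') = k" using True by simp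
      qed
      finally show ?thesis .
    next
      case False
      then have Sk': "card S' < k" using S' Sk by simp
      have "h + card F \<le> card (bnd f U S')"
        using isop[OF S'(4,3,1)] S'(2) Sk' by simp
      then have "h \<le> card (bnd f U' S')" using bnd'[of S'] m by simp
      then obtain F' where F': "F' \<subseteq> bnd f U' S'" "card F' = h"
        by (meson obtain_subset_with_card_n)
      have "(1 - (1 - p) ^ card F') * ((1 - (1 - p) ^ h) ^ (k - card S' - 1) * (1 - p) ^ D)
          \<le> pprob U' p (\<lambda>R. card (reach f R S') = k)"
      proof (rule IH[OF U'(5,4) S'(3) UV' S'(1) F'(1) _ Sk' _ tch'])
        fix T assume T: "S' \<subseteq> T" "T \<subseteq> V" "finite T" "card S' < card T" "card T < k"
        have "h * (card T - card S) + card F \<le> card (bnd f U T)"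
          using T S' by (intro isop) auto
        moreover have "card T - card S = Suc (card T - card S')" using T S' by simp
        ultimately show "h * (card T - card S') + card F' \<le> card (bnd f U' T)"
          using bnd'[of T] m F' by simp
      qed (simp_all add: F'(2))
      moreover have "k - card S - 1 = Suc (k - card S' - 1)" using S' Sk' by simp
      ultimately show ?thesis unfolding F' L_def by (simp add: mult.assoc)
    qed
    \<comment> \<open>Conditioning on \<open>e\<close>: a stage with \<open>Suc m\<close> candidates
      succeeds at once or falls back to \<open>m\<close> candidates.\<close>
    have "(1 - (1 - p) ^ card F) * L = p * L + (1 - p) * ((1 - (1 - p) ^ m) * L)"
      by (simp add: m algebra_simps)
    also have "\<dots> \<le> p * pprob U' p (\<lambda>R. card (reach f R S') = k) + (1 - p) * pprob U' p (\<lambda>R. card (reach f R S) = k)"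
      using closed opened assms(2,3) by (intro add_mono mult_left_mono) auto
    also have "\<dots> = pprob U p (\<lambda>R. card (reach f R S) = k)"
      unfolding pexp_insert[OF U'(3,2), folded U'(1)] reach_insert[of f e S, OF eU(2)] S'_def ..
    finally show ?thesis unfolding L_def .
  qed
qed

section \<open>Ordered component sizes\<close>

text \<open>In a decreasing list the entries that are at least \<open>k\<close> form a prefix, so
  what stands at position \<open>i\<close> is decided by their number. This and the next lemma trade
  positions for counts of components.\<close>

lemma nth_default_desc_ge:
  assumes "sorted (rev xs)" "i < length (filter (\<lambda>x. k \<le> x) xs)"
  shows "k \<le> nth_default 0 xs i"
proof (rule ccontr)
  assume neg: "\<not> k \<le> nth_default 0 xs i"
  have "filter (\<lambda>x. k \<le> x) (drop i xs) = []"
  proof (rule filter_False, rule ballI)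
    fix x assume "x \<in> set (drop i xs)"
    then obtain j where j: "i \<le> j" "j < length xs" "x = xs ! j"
      by (auto simp: in_set_conv_nth) (metis add.commute le_add1 less_diff_conv)
    then have "xs ! j \<le> xs ! i" using assms(1) by (simp add: sorted_rev_iff_nth_mono)
    then show "\<not> k \<le> x" using neg j by (simp add: nth_default_nth)
  qed
  then have "filter (\<lambda>x. k \<le> x) xs = filter (\<lambda>x. k \<le> x) (take i xs)"
    by (metis append_Nil2 append_take_drop_id filter_append)
  then have "length (filter (\<lambda>x. k \<le> x) xs) \<le> i"
    by (metis length_filter_le length_take min.bounded_iff)
  with assms(2) show False by simp
qed

lemma nth_default_desc_le:
  assumes "sorted (rev xs)" "length (filter (\<lambda>x. m < x) xs) \<le> i"
  shows "nth_default 0 xs i \<le> (m :: nat)"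
proof (rule ccontr)
  assume neg: "\<not> nth_default 0 xs i \<le> m"
  then have i: "i < length xs" "m < xs ! i"
    by (auto simp: nth_default_def split: if_splits)
  have "filter (\<lambda>x. m < x) (take (Suc i) xs) = take (Suc i) xs"
  proof (rule filter_True, rule ballI)
    fix x assume "x \<in> set (take (Suc i) xs)"
    then obtain j where j: "j \<le> i" "x = xs ! j" by (auto simp: in_set_conv_nth less_Suc_eq_le)
    then have "xs ! i \<le> xs ! j" using assms(1) i by (simp add: sorted_rev_iff_nth_mono)
    then show "m < x" using i j by simp
  qed
  then have "length (take (Suc i) xs) \<le> length (filter (\<lambda>x. m < x) xs)"
    by (metis append_take_drop_id filter_append length_append le_add1)
  with assms(2) i show False by simp
qed

lemma component_orders_desc: "sorted (rev (component_orders V E))"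
  by (simp add: component_orders_def)

lemma length_filter_component_orders:
  assumes "finite (graph_components V E)"
  shows "length (filter P (component_orders V E)) = card {C \<in> graph_components V E. P (card C)}"
proof -
  have "length (filter P (component_orders V E)) = size (filter_mset P (mset (component_orders V E)))"
    by (metis mset_filter size_mset)
  also have "\<dots> = size {#C \<in># mset_set (graph_components V E). P (card C)#}"
    by (simp add: component_orders_def filter_mset_image_mset)
  also have "\<dots> = card {C \<in> graph_components V E. P (card C)}"
    by (simp add: filter_mset_mset_set[OF assms])
  finally show ?thesis .
qed

lemma card_le_largest_order:
  assumes "finite (graph_components V E)" "C \<in> graph_components V E"
  shows "card C \<le> largest_order V E"
proof -
  have "{C} \<subseteq> {C' \<in> graph_components V E. card C \<le> card C'}" using assms by auto
  then have "card {C} \<le> card {C' \<in> graph_components V E. card C \<le> card C'}"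
    using assms by (intro card_mono) auto
  then show ?thesis unfolding largest_order_def
    by (intro nth_default_desc_ge component_orders_desc) (simp add: length_filter_component_orders[OF assms(1)])
qed

lemma largest_order_le:
  assumes "finite (graph_components V E)" "\<And>C. C \<in> graph_components V E \<Longrightarrow> card C \<le> m"
  shows "largest_order V E \<le> m"
proof -
  have "{C' \<in> graph_components V E. m < card C'} = {}" using assms by force
  then have "length (filter (\<lambda>x. m < x) (component_orders V E)) = 0"
    unfolding length_filter_component_orders[OF assms(1)] by (simp only: card.empty)
  then show ?thesis unfolding largest_order_def
    by (intro nth_default_desc_le component_orders_desc) simp
qed

lemma second_largest_order_ge:
  assumes "finite (graph_components V E)" "C \<in> graph_components V E" "C' \<in> graph_components V E"
    "C \<noteq> C'" "k \<le> card C" "k \<le> card C'"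
  shows "k \<le> second_largest_order V E"
proof -
  have "{C, C'} \<subseteq> {K \<in> graph_components V E. k \<le> card K}" using assms by auto
  then have "card {C, C'} \<le> card {K \<in> graph_components V E. k \<le> card K}"
    using assms by (intro card_mono) auto
  then have "2 \<le> length (filter (\<lambda>x. k \<le> x) (component_orders V E))"
    using assms(4) by (simp add: length_filter_component_orders[OF assms(1)])
  then show ?thesis unfolding second_largest_order_def
    by (intro nth_default_desc_ge component_orders_desc) simp
qed

lemma second_largest_order_le:
  assumes "finite (graph_components V E)" "\<And>C. C \<in> graph_components V E \<Longrightarrow> C \<noteq> K \<Longrightarrow> card C \<le> m"
  shows "second_largest_order V E \<le> m"
proof -
  have "{C' \<in> graph_components V E. m < card C'} \<subseteq> {K}" using assms by force
  then have "card {C' \<in> graph_components V E. m < card C'} \<le> card {K}"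
    by (intro card_mono) auto
  then have "length (filter (\<lambda>x. m < x) (component_orders V E)) \<le> 1"
    unfolding length_filter_component_orders[OF assms(1)] by simp
  then show ?thesis unfolding second_largest_order_def
    by (intro nth_default_desc_le component_orders_desc) simp
qed

section \<open>Clusters of vertices\<close>

abbreviation cluster :: "'a set set \<Rightarrow> 'a \<Rightarrow> 'a set" where
  "cluster R v \<equiv> reach (\<lambda>x. x) R {v}"

lemma self_in_cluster [simp]: "v \<in> cluster R v"
  by (simp add: reach_base)

lemma cluster_subset: "u \<in> cluster R v \<Longrightarrow> cluster R u \<subseteq> cluster R v"
  using reach_mono[of R R "{u}" "cluster R v" "\<lambda>x. x"] by (simp add: reach_idem)

lemma cluster_edge: "e \<in> R \<Longrightarrow> x \<in> e \<Longrightarrow> y \<in> e \<Longrightarrow> y \<in> cluster R x"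
  by (rule reach_step[of x _ _ _ e]) auto

lemma cluster_sym:
  assumes "u \<in> cluster R v" shows "v \<in> cluster R u"
  using assms
proof induction
  case (reach_step x e y)
  then have "x \<in> cluster R y" by (auto intro: cluster_edge)
  then have "cluster R x \<subseteq> cluster R y" by (rule cluster_subset)
  with reach_step.IH show ?case by auto
qed simp

lemma cluster_eq: "u \<in> cluster R v \<Longrightarrow> cluster R u = cluster R v"
  using cluster_subset[of u R v] cluster_subset[of v R u] cluster_sym[of u R v] by simp

lemma cluster_mono: "R \<subseteq> R' \<Longrightarrow> cluster R v \<subseteq> cluster R' v"
  by (rule reach_mono) auto

lemma cluster_in_verts: "\<Union>R \<subseteq> V \<Longrightarrow> v \<in> V \<Longrightarrow> cluster R v \<subseteq> V"
  by (rule order_trans[OF reach_subset]) auto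

lemma graph_components_eq:
  assumes "graph_edges E" "\<Union>E \<subseteq> V"
  shows "graph_components V E = cluster E ` V"
proof -
  have "connected_in V E `` {v} = cluster E v" if v: "v \<in> V" for v
  proof (intro antisym subsetI)
    fix u assume "u \<in> connected_in V E `` {v}"
    then have "(v, u) \<in> {(x, y). {x, y} \<in> E}\<^sup>*" by (simp add: connected_in_def)
    then show "u \<in> cluster E v"
    proof induction
      case (step y z)
      then have "z \<in> cluster E y" by (auto intro: cluster_edge)
      with step.IH show ?case using cluster_subset[of y E v] by auto
    qed simp
  next
    fix u assume u: "u \<in> cluster E v"
    then have "u \<in> V" using cluster_in_verts[OF assms(2) v] by auto
    moreover from u have "(v, u) \<in> {(x, y). {x, y} \<in> E}\<^sup>*"
    proof induction
      case (reach_step x e y)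
      then obtain a b where "e = {a, b}" using assms(1) unfolding graph_edges_def by meson
      then have "x = y \<or> {x, y} \<in> E" using reach_step by (auto simp: insert_commute)
      then show ?case
      proof
        assume "{x, y} \<in> E"
        then have "(x, y) \<in> {(x, y). {x, y} \<in> E}" by simp
        with reach_step.IH show ?thesis by (rule rtrancl_into_rtrancl)
      qed (use reach_step.IH in simp)
    qed simp
    ultimately show "u \<in> connected_in V E `` {v}" using v by (simp add: connected_in_def)
  qed
  then show ?thesis unfolding graph_components_def quotient_def by force
qed

lemma cluster_insert_in:
  assumes "v \<in> cluster R x \<union> cluster R y"
  shows "cluster (insert {x, y} R) v = cluster R x \<union> cluster R y"
proof (rule antisym)
  show "cluster (insert {x, y} R) v \<subseteq> cluster R x \<union> cluster R y"
  proof (rule reach_minimal)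
    fix e assume e: "e \<in> insert {x, y} R" "(\<lambda>x. x) ` e \<inter> (cluster R x \<union> cluster R y) \<noteq> {}"
    show "(\<lambda>x. x) ` e \<subseteq> cluster R x \<union> cluster R y"
    proof (cases "e = {x, y}")
      case False
      then have "e \<in> R" using e by auto
      then show ?thesis
        using e(2) reach_closed[of e R "\<lambda>x. x" "{x}"] reach_closed[of e R "\<lambda>x. x" "{y}"]
        by (cases "e \<inter> cluster R x = {}") auto
    qed auto
  qed (use assms in auto)
  let ?R = "insert {x, y} R"
  have "y \<in> cluster ?R x" by (auto intro: cluster_edge)
  then have xy: "cluster ?R y = cluster ?R x" by (rule cluster_eq)
  have sub: "cluster R x \<union> cluster R y \<subseteq> cluster ?R x"
    using cluster_mono[of R ?R x] cluster_mono[of R ?R y] xy by auto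
  then have "v \<in> cluster ?R x" using assms by auto
  then show "cluster R x \<union> cluster R y \<subseteq> cluster ?R v"
    using sub cluster_eq[of v ?R x] by simp
qed

lemma cluster_insert_out:
  assumes "v \<notin> cluster R x \<union> cluster R y"
  shows "cluster (insert {x, y} R) v = cluster R v"
proof (rule antisym)
  show "cluster (insert {x, y} R) v \<subseteq> cluster R v"
  proof (rule reach_minimal)
    fix e assume e: "e \<in> insert {x, y} R" "(\<lambda>x. x) ` e \<inter> cluster R v \<noteq> {}"
    have "x \<notin> cluster R v" "y \<notin> cluster R v" using assms cluster_sym[of x R v] cluster_sym[of y R v] by auto
    then have "e \<in> R" using e by auto
    then show "(\<lambda>x. x) ` e \<subseteq> cluster R v" using e(2) by (rule reach_closed)
  qed auto
  show "cluster R v \<subseteq> cluster (insert {x, y} R) v" by (rule cluster_mono) auto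
qed

text \<open>Only the two clusters joined by \<open>e\<close> are affected. Before and after, a
  cluster contributes its vertices only if its order satisfies \<open>Q\<close>, hence at most
  \<open>B\<close> of them; larger clusters do not enter the count at all.\<close>

lemma cluster_count_lipschitz:
  assumes "finite V" "\<And>s. Q s \<Longrightarrow> s \<le> B" "e = {x, y}"
    "finite (cluster R x)" "finite (cluster R y)"
  shows "\<bar>real (card {v \<in> V. Q (card (cluster (insert e R) v))}) -
    real (card {v \<in> V. Q (card (cluster R v))})\<bar> \<le> 2 * real B"
proof -
  let ?Z = "cluster R x \<union> cluster R y"
  let ?N1 = "{v \<in> V. Q (card (cluster (insert e R) v))}" and ?N0 = "{v \<in> V. Q (card (cluster R v))}"
  have out: "?N1 - ?Z = ?N0 - ?Z" using cluster_insert_out[of _ R x y] assms(3) by auto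
  have "card N = card (N - ?Z) + card (N \<inter> ?Z)" if "N \<subseteq> V" for N
  proof -
    have "card ((N - ?Z) \<union> (N \<inter> ?Z)) = card (N - ?Z) + card (N \<inter> ?Z)"
      using that assms(1) finite_subset[of N V] by (intro card_Un_disjoint) auto
    then show ?thesis by (simp add: Un_Diff_Int)
  qed
  from this[of ?N1] this[of ?N0]
  have c: "card ?N1 = card (?N1 - ?Z) + card (?N1 \<inter> ?Z)" "card ?N0 = card (?N0 - ?Z) + card (?N0 \<inter> ?Z)"
    by auto
  have d: "real (card ?N1) - real (card ?N0) = real (card (?N1 \<inter> ?Z)) - real (card (?N0 \<inter> ?Z))"
    unfolding c out by simp
  have "card (?N1 \<inter> ?Z) \<le> 2 * B"
  proof (cases "Q (card ?Z)")
    case True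
    have "card (?N1 \<inter> ?Z) \<le> card ?Z" using assms by (intro card_mono) auto
    with assms(2)[OF True] show ?thesis by simp
  next
    case False
    then have "?N1 \<inter> ?Z = {}" using cluster_insert_in[of _ R x y] assms(3) by auto
    then show ?thesis by simp
  qed
  moreover have "card (?N0 \<inter> ?Z) \<le> 2 * B"
  proof -
    have *: "card (?N0 \<inter> cluster R z) \<le> B" if "finite (cluster R z)" for z
    proof (cases "Q (card (cluster R z))")
      case True
      have "card (?N0 \<inter> cluster R z) \<le> card (cluster R z)" using that by (intro card_mono) auto
      with assms(2)[OF True] show ?thesis by simp
    next
      case False
      have "v \<notin> ?N0" if "v \<in> cluster R z" for v
        using cluster_eq[OF that] False by simp
      then have "?N0 \<inter> cluster R z = {}" by blast
      then show ?thesis by simp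
    qed
    have "card (?N0 \<inter> ?Z) \<le> card (?N0 \<inter> cluster R x) + card (?N0 \<inter> cluster R y)"
      unfolding Int_Un_distrib by (rule card_Un_le)
    with *[OF assms(4)] *[OF assms(5)] show ?thesis by linarith
  qed
  ultimately show ?thesis unfolding d by linarith
qed

section \<open>The permutahedron\<close>

abbreviation adj_swap :: "nat \<Rightarrow> nat \<Rightarrow> nat" where
  "adj_swap i \<equiv> Transposition.transpose i (Suc i)"

lemma finite_perm_verts [simp]: "finite (perm_verts n)"
  by (simp add: perm_verts_def finite_permutations)

lemma card_perm_verts: "card (perm_verts n) = fact (n + 1)"
  unfolding perm_verts_def by (intro card_permutations) auto

lemma adj_swap_invol [simp]: "adj_swap i \<circ> (adj_swap i \<circ> v) = v"
  by (auto simp: fun_eq_iff)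

lemma adj_swap_in_verts:
  assumes "v \<in> perm_verts n" "i \<in> {1..n}"
  shows "adj_swap i \<circ> v \<in> perm_verts n"
  using assms unfolding perm_verts_def mem_Collect_eq
  by (intro permutes_compose permutes_swap_id) auto

lemma perm_verts_surj: "v \<in> perm_verts n \<Longrightarrow> surj v"
  and perm_verts_inj: "v \<in> perm_verts n \<Longrightarrow> inj v"
  by (auto simp: perm_verts_def permutes_surj permutes_inj)

lemma comp_surj_cancel: "surj v \<Longrightarrow> g \<circ> v = h \<circ> v \<Longrightarrow> g = h"
  by (metis surj_fun_eq surjI surj_def fun_eq_iff comp_apply)

lemma adj_swap_inj: "adj_swap i = adj_swap j \<Longrightarrow> i = j"
  by (drule fun_cong[of _ _ i]) (auto simp: Transposition.transpose_def split: if_splits)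

lemma adj_swap_comp_inj:
  assumes "v \<in> perm_verts n" "adj_swap i \<circ> v = adj_swap j \<circ> v" shows "i = j"
  using adj_swap_inj comp_surj_cancel[OF perm_verts_surj[OF assms(1)] assms(2)] by blast

lemma adj_swap_comp_neq:
  assumes "v \<in> perm_verts n" shows "adj_swap i \<circ> v \<noteq> v"
proof
  assume "adj_swap i \<circ> v = v"
  then have "adj_swap i \<circ> v = id \<circ> v" by simp
  then have "adj_swap i = id" using comp_surj_cancel[OF perm_verts_surj[OF assms]] by blast
  then have "adj_swap i i = i" by simp
  then show False by simp
qed

text \<open>The index set is variable: \<open>{1..n}\<close> gives the permutahedron,
  \<open>{1..<m}\<close> the cosets that provide independence.\<close>

definition swap_edges :: "nat \<Rightarrow> nat set \<Rightarrow> (nat \<Rightarrow> nat) set set" where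
  "swap_edges n I = {{v, adj_swap i \<circ> v} | v i. v \<in> perm_verts n \<and> i \<in> I}"

lemma perm_edges_eq: "perm_edges n = swap_edges n {1..n}"
  by (auto simp: perm_edges_def swap_edges_def)

lemma swap_edges_mono: "I \<subseteq> J \<Longrightarrow> swap_edges n I \<subseteq> swap_edges n J"
  by (auto simp: swap_edges_def)

lemma swap_edges_finite: "finite I \<Longrightarrow> finite (swap_edges n I)"
proof -
  assume "finite I"
  moreover have "swap_edges n I = (\<lambda>(v, i). {v, adj_swap i \<circ> v}) ` (perm_verts n \<times> I)"
    by (auto simp: swap_edges_def image_def)
  ultimately show ?thesis by simp
qed

lemma graph_edges_swap: "finite I \<Longrightarrow> graph_edges (swap_edges n I)"
  unfolding graph_edges_def by (rule conjI[OF swap_edges_finite]) (auto simp: swap_edges_def)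

lemma swap_edges_verts: "I \<subseteq> {1..n} \<Longrightarrow> \<Union>(swap_edges n I) \<subseteq> perm_verts n"
  using adj_swap_in_verts by (auto simp: swap_edges_def)

lemma swap_edges_at:
  assumes "I \<subseteq> {1..n}" "e \<in> swap_edges n I" "v \<in> e"
  shows "\<exists>i\<in>I. e = {v, adj_swap i \<circ> v}"
proof -
  obtain u i where u: "e = {u, adj_swap i \<circ> u}" "i \<in> I" using assms(2) by (auto simp: swap_edges_def)
  from assms(3) u(1) consider "v = u" | "v = adj_swap i \<circ> u" by auto
  then show ?thesis
  proof cases
    case 2
    then have "u = adj_swap i \<circ> v" by simp
    then have "e = {v, adj_swap i \<circ> v}" using u(1) 2 by (simp add: insert_commute)
    then show ?thesis using u by auto
  qed (use u in auto)
qed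

lemma card_edges_at_le:
  assumes "I \<subseteq> {1..n}"
  shows "card {e \<in> swap_edges n I. v \<in> e} \<le> card I" "finite {e \<in> swap_edges n I. v \<in> e}"
proof -
  have fin: "finite I" using finite_subset[OF assms] by simp
  have "{e \<in> swap_edges n I. v \<in> e} \<subseteq> (\<lambda>i. {v, adj_swap i \<circ> v}) ` I"
    using swap_edges_at[OF assms] by auto
  then have "card {e \<in> swap_edges n I. v \<in> e} \<le> card ((\<lambda>i. {v, adj_swap i \<circ> v}) ` I)"
    using fin by (intro card_mono) auto
  also have "\<dots> \<le> card I" using fin by (rule card_image_le)
  finally show "card {e \<in> swap_edges n I. v \<in> e} \<le> card I" .
  show "finite {e \<in> swap_edges n I. v \<in> e}" using fin swap_edges_finite by auto
qed

lemma card_touch_swap_le: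
  assumes "I \<subseteq> {1..n}" "finite C"
  shows "card (touch (\<lambda>x. x) (swap_edges n I) C) \<le> card I * card C"
proof -
  have "touch (\<lambda>x. x) (swap_edges n I) C \<subseteq> (\<Union>v\<in>C. {e \<in> swap_edges n I. v \<in> e})"
    by (auto simp: touch_def)
  then have "card (touch (\<lambda>x. x) (swap_edges n I) C) \<le> card (\<Union>v\<in>C. {e \<in> swap_edges n I. v \<in> e})"
    using card_edges_at_le(2)[OF assms(1)] assms(2) by (intro card_mono) auto
  also have "\<dots> \<le> (\<Sum>v\<in>C. card {e \<in> swap_edges n I. v \<in> e})" using assms(2) by (rule card_UN_le)
  also have "\<dots> \<le> (\<Sum>v\<in>C. card I)" using card_edges_at_le(1)[OF assms(1)] by (intro sum_mono) auto
  finally show ?thesis by (simp add: mult.commute)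
qed

section \<open>Edges spanned by few permutations\<close>

text \<open>Edges are counted with direction: an edge inside \<open>A\<close> contributes twice to
  \<open>arcs n A A\<close>.\<close>

definition arcs :: "nat \<Rightarrow> (nat \<Rightarrow> nat) set \<Rightarrow> (nat \<Rightarrow> nat) set \<Rightarrow> ((nat \<Rightarrow> nat) \<times> nat) set" where
  "arcs n A B = {(v, i). v \<in> A \<and> i \<in> {1..n} \<and> adj_swap i \<circ> v \<in> B}"

lemma finite_arcs: "finite A \<Longrightarrow> finite (arcs n A B)"
  by (rule finite_subset[of _ "A \<times> {1..n}"]) (auto simp: arcs_def)

lemma adj_swap_flip:
  assumes "x < y" "adj_swap i y < adj_swap i x" shows "x = i" "y = i + 1"
  using assms by (auto simp: Transposition.transpose_def split: if_splits)

text \<open>An edge changes the relative order of the values at positions \<open>a\<close> and \<open>b\<close> only if these values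
  are \<open>i\<close> and \<open>i + 1\<close>; so the edges that do so form a matching.\<close>

lemma card_cross_arcs:
  assumes "finite A" "finite B" "\<And>v. v \<in> A \<Longrightarrow> v a < v b" "\<And>v. v \<in> B \<Longrightarrow> v b < v a"
  shows "card (arcs n A B) \<le> min (card A) (card B)"
proof -
  have key: "v a = i \<and> v b = i + 1" if "(v, i) \<in> arcs n A B" for v i
    using that adj_swap_flip[of "v a" "v b" i] assms(3)[of v] assms(4)[of "adj_swap i \<circ> v"]
    by (auto simp: arcs_def)
  have "card (arcs n A B) \<le> card A"
  proof (rule card_inj_on_le)
    show "inj_on fst (arcs n A B)"
    proof (rule inj_onI, clarify)
      fix v i w j assume "(v, i) \<in> arcs n A B" "(w, j) \<in> arcs n A B" "fst (v, i) = fst (w, j)"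
      then show "v = w \<and> i = j" using key[of v i] key[of w j] by simp
    qed
  qed (use assms in \<open>auto simp: arcs_def\<close>)
  moreover have "card (arcs n A B) \<le> card B"
  proof (rule card_inj_on_le)
    show "inj_on (\<lambda>(v, i). adj_swap i \<circ> v) (arcs n A B)"
    proof (rule inj_onI, clarify)
      fix v i w j assume *: "(v, i) \<in> arcs n A B" "(w, j) \<in> arcs n A B"
        "adj_swap i \<circ> v = adj_swap j \<circ> w"
      have "(adj_swap i \<circ> v) b = i" "(adj_swap j \<circ> w) b = j" using key[OF *(1)] key[OF *(2)] by auto
      then have "i = j" using *(3) by simp
      then have "adj_swap i \<circ> (adj_swap i \<circ> v) = adj_swap i \<circ> (adj_swap i \<circ> w)" using *(3) by simp
      then show "v = w \<and> i = j" using \<open>i = j\<close> by simp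
    qed
  qed (use assms in \<open>auto simp: arcs_def\<close>)
  ultimately show ?thesis by simp
qed

text \<open>If no pair of positions were ordered oppositely, \<open>w \<circ> inv v\<close> would be
  an increasing permutation, hence the identity.\<close>

lemma perm_verts_separated:
  assumes "v \<in> perm_verts n" "w \<in> perm_verts n" "v \<noteq> w"
  shows "\<exists>a b. v a < v b \<and> w b < w a"
proof (rule ccontr)
  assume neg: "\<not> ?thesis"
  have v: "v permutes {1..n+1}" and w: "w permutes {1..n+1}" using assms by (auto simp: perm_verts_def)
  let ?t = "w \<circ> inv v"
  have "strict_mono ?t"
  proof (rule strict_monoI)
    fix x y :: nat assume "x < y"
    moreover have "v (inv v x) = x" "v (inv v y) = y" using permutes_inverses(1)[OF v] by auto
    ultimately have "\<not> w (inv v y) < w (inv v x)" "inv v x \<noteq> inv v y" using neg by (metis, metis less_irrefl)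
    moreover have "inj w" using w by (rule permutes_inj)
    ultimately show "?t x < ?t y" by (metis comp_apply injD linorder_cases)
  qed
  then have "\<forall>i\<in>{1..n+1}. i \<le> ?t i" using strict_mono_imp_increasing by blast
  moreover have "?t permutes {1..n+1}" by (intro permutes_compose permutes_inv v w)
  ultimately have t: "?t = id" by (intro permutes_natset_ge)
  have "w = ?t \<circ> v" using permutes_inverses(2)[OF v] by (auto simp: fun_eq_iff)
  with t assms(3) show False by simp
qed

text \<open>With \<open>x\<close> the smaller part, \<open>x + y \<ge> 2 x\<close> gains
  \<open>3 x ln 2\<close>, and \<open>ln 2 \<ge> 2 / 3\<close> turns this into the
  \<open>2 x\<close> needed for the cross arcs in both directions. This is the origin of the factor
  3.\<close>

lemma x_ln_x_superadditive:
  fixes x y :: real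
  assumes "1 \<le> x" "x \<le> y"
  shows "3 * x * ln x + 3 * y * ln y + 2 * x \<le> 3 * (x + y) * ln (x + y)"
proof -
  have "ln 2 + ln x = ln (2 * x)" using assms by (simp add: ln_mult)
  also have "\<dots> \<le> ln (x + y)" using assms by simp
  finally have 1: "ln 2 + ln x \<le> ln (x + y)" .
  have "2 / 3 \<le> (ln 2 :: real)" by (rule ln2_ge_two_thirds)
  with 1 have "2 / 3 + ln x \<le> ln (x + y)" by simp
  then have "3 * x * (2 / 3 + ln x) \<le> 3 * x * ln (x + y)" using assms by (intro mult_left_mono) auto
  moreover have "3 * y * ln y \<le> 3 * y * ln (x + y)" using assms by (intro mult_left_mono) auto
  ultimately show ?thesis by (simp add: algebra_simps)
qed

text \<open>Two elements of \<open>S\<close> order the values at some positions \<open>a\<close> and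
  \<open>b\<close> differently. Splitting \<open>S\<close> by this order leaves only a matching
  between the two nonempty parts, and \<open>x_ln_x_superadditive\<close> absorbs it.\<close>

lemma card_arcs_le:
  assumes "S \<subseteq> perm_verts n"
  shows "real (card (arcs n S S)) \<le> 3 * real (card S) * ln (real (card S))"
  using assms
proof (induction "card S" arbitrary: S rule: less_induct)
  case less
  have fin: "finite S" using finite_subset[OF less.prems] by simp
  show ?case
  proof (cases "card S \<le> 1")
    case True
    then have S1: "\<And>u v. u \<in> S \<Longrightarrow> v \<in> S \<Longrightarrow> u = v" using fin by (simp add: card_le_Suc0_iff_eq)
    have "arcs n S S = {}"
    proof (rule equals0I, clarify)
      fix v i assume "(v, i) \<in> arcs n S S"
      then have v: "v \<in> S" "adj_swap i \<circ> v \<in> S" by (auto simp: arcs_def)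
      then have "adj_swap i \<circ> v = v" by (rule S1[rotated])
      then show False using adj_swap_comp_neq[of v n i] v less.prems by auto
    qed
    moreover have "0 \<le> ln (real (card S))"
      using True by (cases "card S") auto
    ultimately show ?thesis by simp
  next
    case False
    then obtain v w where vw: "v \<in> S" "w \<in> S" "v \<noteq> w" using fin by (auto simp: card_le_Suc0_iff_eq)
    then obtain a b where ab: "v a < v b" "w b < w a"
      using perm_verts_separated[of v n w] less.prems by auto
    define A B where "A = {u \<in> S. u a < u b}" and "B = {u \<in> S. u b < u a}"
    have AB: "S = A \<union> B" "A \<inter> B = {}" "finite A" "finite B"
    proof -
      have "a \<noteq> b" using ab by auto
      then have "u a \<noteq> u b" if "u \<in> S" for u
        using perm_verts_inj[of u n] that less.prems by (auto simp: inj_def)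
      then show "S = A \<union> B" unfolding A_def B_def by (auto simp: nat_neq_iff)
    qed (use fin in \<open>auto simp: A_def B_def\<close>)
    have c: "card S = card A + card B" using AB by (simp add: card_Un_disjoint)
    have "v \<in> A" "w \<in> B" using vw ab by (auto simp: A_def B_def)
    then have pos: "0 < card A" "0 < card B" using AB by (auto simp: card_gt_0_iff)
    have sub: "A \<subseteq> perm_verts n" "B \<subseteq> perm_verts n" using less.prems AB by auto
    have IA: "real (card (arcs n A A)) \<le> 3 * real (card A) * ln (real (card A))"
      using less.hyps[OF _ sub(1)] c pos by simp
    have IB: "real (card (arcs n B B)) \<le> 3 * real (card B) * ln (real (card B))"
      using less.hyps[OF _ sub(2)] c pos by simp
    have x: "card (arcs n A B) \<le> min (card A) (card B)"
      using AB by (intro card_cross_arcs[of _ _ a b]) (auto simp: A_def B_def)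
    have y: "card (arcs n B A) \<le> min (card B) (card A)"
      using AB by (intro card_cross_arcs[of _ _ b a]) (auto simp: A_def B_def)
    have "arcs n S S = (arcs n A A \<union> arcs n B B) \<union> (arcs n A B \<union> arcs n B A)"
      unfolding AB(1) by (auto simp: arcs_def)
    then have "card (arcs n S S) \<le> card (arcs n A A \<union> arcs n B B) + card (arcs n A B \<union> arcs n B A)"
      by (simp only: card_Un_le)
    also have "\<dots> \<le> (card (arcs n A A) + card (arcs n B B)) + (card (arcs n A B) + card (arcs n B A))"
      by (intro add_mono card_Un_le)
    finally have "card (arcs n S S) \<le> card (arcs n A A) + card (arcs n B B) + 2 * min (card A) (card B)"
      using x y min.commute[of "card B" "card A"] by linarith
    then have "real (card (arcs n S S)) \<le> real (card (arcs n A A) + card (arcs n B B) + 2 * min (card A) (card B))"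
      by (simp only: of_nat_le_iff)
    also have "\<dots> \<le> 3 * real (card A) * ln (real (card A)) + 3 * real (card B) * ln (real (card B))
       + 2 * min (real (card A)) (real (card B))"
      using IA IB by simp
    also have "\<dots> \<le> 3 * (real (card A) + real (card B)) * ln (real (card A) + real (card B))"
    proof (cases "card A \<le> card B")
      case True
      then show ?thesis using x_ln_x_superadditive[of "real (card A)" "real (card B)"] pos by simp
    next
      case False
      then show ?thesis using x_ln_x_superadditive[of "real (card B)" "real (card A)"] pos
        by (simp add: add.commute)
    qed
    finally show ?thesis using c by simp
  qed
qed

lemma card_out_arcs_le_bnd:
  assumes "I \<subseteq> {1..n}" "S \<subseteq> perm_verts n"
  shows "card {(v, i). v \<in> S \<and> i \<in> I \<and> adj_swap i \<circ> v \<notin> S} \<le> card (bnd (\<lambda>x. x) (swap_edges n I) S)"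
proof (rule card_inj_on_le)
  let ?O = "{(v, i). v \<in> S \<and> i \<in> I \<and> adj_swap i \<circ> v \<notin> S}"
  show "inj_on (\<lambda>(v, i). {v, adj_swap i \<circ> v}) ?O"
  proof (rule inj_onI, clarify)
    fix v i w j assume *: "v \<in> S" "w \<in> S" "adj_swap i \<circ> v \<notin> S" "adj_swap j \<circ> w \<notin> S"
      "{v, adj_swap i \<circ> v} = {w, adj_swap j \<circ> w}"
    then have "v = w" "adj_swap i \<circ> v = adj_swap j \<circ> w" by (metis doubleton_eq_iff)+
    then show "v = w \<and> i = j" using adj_swap_comp_inj[of v n i j] * assms(2) by auto
  qed
  show "(\<lambda>(v, i). {v, adj_swap i \<circ> v}) ` ?O \<subseteq> bnd (\<lambda>x. x) (swap_edges n I) S"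
    using assms(2) by (auto simp: bnd_def swap_edges_def)
  show "finite (bnd (\<lambda>x. x) (swap_edges n I) S)"
    using assms(1) by (intro finite_bnd swap_edges_finite) (auto intro: finite_subset)
qed

text \<open>From each vertex of \<open>S\<close> start \<open>card I\<close> swaps; those that stay
  in \<open>S\<close> are inner arcs, few by \<open>card_arcs_le\<close>, and the others give
  distinct boundary edges.\<close>

lemma local_isoperimetry:
  assumes "I \<subseteq> {1..n}" "S \<subseteq> perm_verts n"
  shows "real (card S) * (real (card I) - 3 * ln (real (card S))) \<le> real (card (bnd (\<lambda>x. x) (swap_edges n I) S))"
proof -
  let ?O = "{(v, i). v \<in> S \<and> i \<in> I \<and> adj_swap i \<circ> v \<notin> S}"
  have fin: "finite S" "finite I" using assms finite_subset[of S] finite_subset[of I] by auto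
  have "?O \<subseteq> S \<times> I" by auto
  then have finO: "finite ?O" using fin finite_subset by blast
  have "S \<times> I \<subseteq> ?O \<union> arcs n S S" using assms(1) by (auto simp: arcs_def)
  then have "card (S \<times> I) \<le> card (?O \<union> arcs n S S)"
    using finO finite_arcs[OF fin(1)] by (intro card_mono) auto
  also have "\<dots> \<le> card ?O + card (arcs n S S)" by (rule card_Un_le)
  finally have "card S * card I \<le> card ?O + card (arcs n S S)" by (simp add: card_cartesian_product)
  then have "card S * card I \<le> card (bnd (\<lambda>x. x) (swap_edges n I) S) + card (arcs n S S)"
    using card_out_arcs_le_bnd[OF assms] by simp
  then have "real (card S * card I) \<le> real (card (bnd (\<lambda>x. x) (swap_edges n I) S) + card (arcs n S S))"
    by (simp only: of_nat_le_iff)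
  with card_arcs_le[OF assms(2)] show ?thesis by (simp add: algebra_simps)
qed

section \<open>Global edge expansion\<close>

text \<open>Subadditive under composition, so a bound for adjacent swaps extends to every
  permutation with a loss equal to the word length. This replaces the usual counting of canonical
  paths.\<close>

definition escape :: "(nat \<Rightarrow> nat) set \<Rightarrow> (nat \<Rightarrow> nat) \<Rightarrow> nat" where
  "escape A g = card {v \<in> A. g \<circ> v \<notin> A}"

lemma escape_comp:
  assumes "finite A" "inj h"
  shows "escape A (g \<circ> h) \<le> escape A g + escape A h"
proof -
  let ?X = "{v \<in> A. h \<circ> v \<in> A \<and> g \<circ> (h \<circ> v) \<notin> A}"
  have "{v \<in> A. g \<circ> h \<circ> v \<notin> A} \<subseteq> ?X \<union> {v \<in> A. h \<circ> v \<notin> A}" by (auto simp: comp_assoc)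
  then have "escape A (g \<circ> h) \<le> card (?X \<union> {v \<in> A. h \<circ> v \<notin> A})"
    unfolding escape_def using assms by (intro card_mono) auto
  also have "\<dots> \<le> card ?X + escape A h" unfolding escape_def by (rule card_Un_le)
  also have "card ?X \<le> escape A g" unfolding escape_def
  proof (rule card_inj_on_le)
    show "inj_on (\<lambda>v. h \<circ> v) ?X" using assms(2) by (auto simp: inj_on_def fun.inj_map_strong inj_def fun_eq_iff)
  qed (use assms in auto)
  finally show ?thesis by simp
qed

lemma escape_id: "escape A id = 0"
  by (simp add: escape_def)

lemma escape_adj_swap:
  assumes "A \<subseteq> perm_verts n" "i \<in> {1..n}"
  shows "escape A (adj_swap i) \<le> card (bnd (\<lambda>x. x) (perm_edges n) A)"
proof -
  have "escape A (adj_swap i) = card ((\<lambda>v. (v, i)) ` {v \<in> A. adj_swap i \<circ> v \<notin> A})"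
    unfolding escape_def by (rule card_image[symmetric]) (auto simp: inj_on_def)
  also have "\<dots> \<le> card {(v, i). v \<in> A \<and> i \<in> {1..n} \<and> adj_swap i \<circ> v \<notin> A}"
  proof (rule card_mono)
    have "{(v, i). v \<in> A \<and> i \<in> {1..n} \<and> adj_swap i \<circ> v \<notin> A} \<subseteq> A \<times> {1..n}" by auto
    moreover have "finite (A \<times> {1..n})" using assms finite_subset[of A] by auto
    ultimately show "finite {(v, i). v \<in> A \<and> i \<in> {1..n} \<and> adj_swap i \<circ> v \<notin> A}" by (rule finite_subset)
  qed (use assms in auto)
  also have "\<dots> \<le> card (bnd (\<lambda>x. x) (perm_edges n) A)"
    unfolding perm_edges_eq by (rule card_out_arcs_le_bnd) (use assms in auto)
  finally show ?thesis .
qed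

text \<open>Repeated conjugation writes a transposition at distance \<open>d + 1\<close> as a
  product of \<open>2 d + 1\<close> adjacent swaps.\<close>

lemma escape_transpose:
  assumes "A \<subseteq> perm_verts n" "1 \<le> a" "a + d < n + 1"
  shows "escape A (Transposition.transpose a (a + 1 + d)) \<le> (2 * d + 1) * card (bnd (\<lambda>x. x) (perm_edges n) A)"
  using assms(3)
proof (induction d)
  case 0
  then show ?case using escape_adj_swap[OF assms(1), of a] assms(2) by simp
next
  case (Suc d)
  let ?b = "a + 1 + d" and ?B = "card (bnd (\<lambda>x. x) (perm_edges n) A)"
  have fin: "finite A" using finite_subset[OF assms(1)] by simp
  have e: "escape A (adj_swap ?b) \<le> ?B" using Suc.prems assms(2) by (intro escape_adj_swap assms) auto
  have "Transposition.transpose a (a + 1 + Suc d) =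
      adj_swap ?b \<circ> (Transposition.transpose a ?b \<circ> adj_swap ?b)"
    by (auto simp: fun_eq_iff Transposition.transpose_def)
  then have "escape A (Transposition.transpose a (a + 1 + Suc d)) \<le>
      escape A (adj_swap ?b) + escape A (Transposition.transpose a ?b \<circ> adj_swap ?b)"
    using escape_comp[OF fin, of "Transposition.transpose a ?b \<circ> adj_swap ?b" "adj_swap ?b"]
    by (simp add: inj_compose)
  also have "\<dots> \<le> escape A (adj_swap ?b) + (escape A (Transposition.transpose a ?b) + escape A (adj_swap ?b))"
    by (intro add_left_mono escape_comp fin) simp
  also have "\<dots> \<le> ?B + ((2 * d + 1) * ?B + ?B)"
    using e Suc by (intro add_mono) auto
  finally show ?case by simp
qed

text \<open>Peeling off one point at a time: composing with the transposition of \<open>x\<close>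
  and \<open>g x\<close> makes \<open>x\<close> a fixed point. Each of the at most
  \<open>card F\<close> transpositions needs at most \<open>2 n\<close> adjacent swaps.\<close>

lemma escape_permutes:
  assumes "A \<subseteq> perm_verts n" "finite F" "F \<subseteq> {1..n+1}" "g permutes F"
  shows "escape A g \<le> card F * (2 * n * card (bnd (\<lambda>x. x) (perm_edges n) A))"
  using assms(2-4)
proof (induction F arbitrary: g)
  case empty
  then have "g = id" by simp
  then show ?case by (simp only: escape_id le0)
next
  case (insert x F)
  let ?B = "card (bnd (\<lambda>x. x) (perm_edges n) A)"
  let ?t = "Transposition.transpose x (g x)"
  have fin: "finite A" using finite_subset[OF assms(1)] by simp
  have q: "?t \<circ> g permutes F" using insert.prems(2) by (rule permutes_insert_lemma)
  have g: "g = ?t \<circ> (?t \<circ> g)" by (auto simp: fun_eq_iff)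
  have gx: "g x \<in> {1..n+1}" using permutes_in_image[OF insert.prems(2), of x] insert.prems(1) by auto
  have x: "x \<in> {1..n+1}" and FF: "F \<subseteq> {1..n+1}" using insert.prems(1) by auto
  have t: "escape A ?t \<le> 2 * n * ?B"
  proof -
    consider "x = g x" | "x < g x" | "g x < x" by linarith
    then show ?thesis
    proof cases
      case 1
      then show ?thesis by (metis escape_id transpose_same zero_le)
    next
      case 2
      then obtain d where d: "g x = x + 1 + d" by (metis Suc_eq_plus1 add.assoc add.commute less_iff_Suc_add add_Suc_right)
      have "escape A ?t \<le> (2 * d + 1) * ?B"
        unfolding d using x gx d by (intro escape_transpose assms) auto
      also have "\<dots> \<le> 2 * n * ?B" using x gx d by (intro mult_right_mono) auto
      finally show ?thesis .
    next
      case 3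
      then obtain d where d: "x = g x + 1 + d" by (metis Suc_eq_plus1 add.assoc add.commute less_iff_Suc_add add_Suc_right)
      have "escape A (Transposition.transpose (g x) (g x + 1 + d)) \<le> (2 * d + 1) * ?B"
        using x gx d by (intro escape_transpose assms) auto
      also have "\<dots> \<le> 2 * n * ?B" using x gx d by (intro mult_right_mono) auto
      finally show ?thesis using d transpose_commute[of x "g x"] by metis
    qed
  qed
  have "escape A g \<le> escape A ?t + escape A (?t \<circ> g)"
    using escape_comp[OF fin permutes_inj[OF q], of ?t] g by metis
  also have "\<dots> \<le> 2 * n * ?B + card F * (2 * n * ?B)"
    by (rule add_mono[OF t insert.IH[OF FF q]])
  finally show ?case using insert.hyps by simp
qed

text \<open>Double counting of the pairs \<open>v \<in> A\<close>, \<open>g\<close> with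
  \<open>g \<circ> v \<notin> A\<close>. Right multiplication by \<open>v\<close> is a bijection, so
  each \<open>v\<close> has exactly \<open>card (V - A)\<close> partners; each \<open>g\<close> has
  \<open>escape A g\<close>, at most \<open>2 n (n + 1)\<close> times the boundary.\<close>

lemma global_isoperimetry:
  assumes "A \<subseteq> perm_verts n"
  shows "card A * card (perm_verts n - A) \<le>
    card (perm_verts n) * (2 * n * (n + 1) * card (bnd (\<lambda>x. x) (perm_edges n) A))"
proof -
  let ?V = "perm_verts n"
  have fin: "finite A" using finite_subset[OF assms] by simp
  have "card {g \<in> ?V. g \<circ> v \<notin> A} = card (?V - A)" if "v \<in> A" for v
  proof (rule bij_betw_same_card[of "\<lambda>g. g \<circ> v"])
    have v: "v permutes {1..n+1}" using that assms by (auto simp: perm_verts_def)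
    show "bij_betw (\<lambda>g. g \<circ> v) {g \<in> ?V. g \<circ> v \<notin> A} (?V - A)"
    proof (rule bij_betw_byWitness[where f' = "\<lambda>g. g \<circ> inv v"])
      show "\<forall>g\<in>{g \<in> ?V. g \<circ> v \<notin> A}. g \<circ> v \<circ> inv v = g"
        using permutes_inverses(1)[OF v] by (auto simp: fun_eq_iff)
      show "\<forall>g\<in>?V - A. g \<circ> inv v \<circ> v = g"
        using permutes_inverses(2)[OF v] by (auto simp: fun_eq_iff)
      show "(\<lambda>g. g \<circ> v) ` {g \<in> ?V. g \<circ> v \<notin> A} \<subseteq> ?V - A"
        using v by (auto simp: perm_verts_def intro: permutes_compose)
      show "(\<lambda>g. g \<circ> inv v) ` (?V - A) \<subseteq> {g \<in> ?V. g \<circ> v \<notin> A}"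
      proof (rule image_subsetI)
        fix g assume g: "g \<in> ?V - A"
        have "g \<circ> inv v \<circ> v = g" using permutes_inverses(2)[OF v] by (auto simp: fun_eq_iff)
        then show "g \<circ> inv v \<in> {g \<in> ?V. g \<circ> v \<notin> A}"
          using g permutes_compose[OF permutes_inv[OF v], of g] by (simp add: perm_verts_def)
      qed
    qed
  qed
  then have "card A * card (?V - A) = (\<Sum>v\<in>A. card {g \<in> ?V. g \<circ> v \<notin> A})" by simp
  also have "\<dots> = (\<Sum>v\<in>A. \<Sum>g\<in>?V. if g \<circ> v \<notin> A then 1 else 0)"
    by (simp add: sum.If_cases Int_def)
  also have "\<dots> = (\<Sum>g\<in>?V. \<Sum>v\<in>A. if g \<circ> v \<notin> A then 1 else 0)" by (rule sum.swap)
  also have "\<dots> = (\<Sum>g\<in>?V. escape A g)"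
    using fin by (simp add: sum.If_cases Int_def escape_def)
  also have "\<dots> \<le> (\<Sum>g\<in>?V. card {1..n+1} * (2 * n * card (bnd (\<lambda>x. x) (perm_edges n) A)))"
    by (intro sum_mono escape_permutes assms) (auto simp: perm_verts_def)
  finally show ?thesis by (simp add: algebra_simps)
qed

section \<open>Clusters in the permutahedron\<close>

lemma graph_perm_edges: "graph_edges (perm_edges n)"
  by (simp add: perm_edges_eq graph_edges_swap)

lemma finite_perm_edges [simp]: "finite (perm_edges n)"
  using graph_perm_edges graph_edges_finite by blast

lemma perm_edges_verts: "R \<subseteq> perm_edges n \<Longrightarrow> \<Union>R \<subseteq> perm_verts n"
  using swap_edges_verts[of "{1..n}" n] by (auto simp: perm_edges_eq)

lemma perm_cluster_verts: "R \<subseteq> perm_edges n \<Longrightarrow> v \<in> perm_verts n \<Longrightarrow> cluster R v \<subseteq> perm_verts n"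
  by (intro cluster_in_verts perm_edges_verts)

lemma perm_cluster_finite: "R \<subseteq> perm_edges n \<Longrightarrow> finite (cluster R v)"
  by (rule finite_reach[OF graph_perm_edges]) auto

lemma cluster_nonempty [simp]: "cluster R v \<noteq> {}"
  by (metis self_in_cluster empty_iff)

lemma perm_cluster_pos: "R \<subseteq> perm_edges n \<Longrightarrow> 0 < card (cluster R v)"
  using perm_cluster_finite[of R n v] by (simp add: card_gt_0_iff)

text \<open>Up to order \<open>M\<close> at most \<open>3 ln M\<close> directions per vertex are
  lost on average, which leaves \<open>d\<close>.\<close>

lemma bnd_ge_of_small:
  assumes "I \<subseteq> {1..n}" "S \<subseteq> perm_verts n" "0 < card S" "card S < M"
    "real d + 3 * ln (real M) \<le> real (card I)"
  shows "d * card S \<le> card (bnd (\<lambda>x. x) (swap_edges n I) S)"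
proof -
  have "ln (real (card S)) \<le> ln (real M)" using assms by simp
  then have "real d \<le> real (card I) - 3 * ln (real (card S))" using assms(5) by linarith
  then have "real (card S) * real d \<le> real (card S) * (real (card I) - 3 * ln (real (card S)))"
    by (intro mult_left_mono) auto
  also have "\<dots> \<le> real (card (bnd (\<lambda>x. x) (swap_edges n I) S))"
    by (rule local_isoperimetry[OF assms(1,2)])
  finally have "real (d * card S) \<le> real (card (bnd (\<lambda>x. x) (swap_edges n I) S))"
    by (simp add: mult.commute)
  then show ?thesis by (simp only: of_nat_le_iff)
qed

lemma perm_cluster_gap:
  assumes "v \<in> perm_verts n" "0 \<le> p" "p < 1" "0 \<le> lam" "lam \<le> 1"
    "real d + 3 * ln (real M) \<le> real n" "1 \<le> rho" "rho * (1 - p * (1 - lam)) ^ d \<le> lam"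
  shows "rho ^ m * pprob (perm_edges n) p (\<lambda>R. m \<le> card (cluster R v) \<and> card (cluster R v) < M) \<le> lam"
proof (rule cluster_gap_upper[OF graph_perm_edges assms(2-5) _ assms(7,8)])
  fix R assume R: "R \<subseteq> perm_edges n" "card (cluster R v) < M"
  show "d * card (cluster R v) \<le> card (bnd (\<lambda>x. x) (perm_edges n) (cluster R v))"
    unfolding perm_edges_eq
    by (rule bnd_ge_of_small) (use R assms perm_cluster_verts perm_cluster_pos in auto)
qed

section \<open>Independent chances in cosets\<close>

text \<open>Left multiplication acts on values, so swaps among the values up to \<open>m\<close>
  leave the positions of the higher values alone; the other positions are masked by 0.\<close>

definition high_pos :: "nat \<Rightarrow> (nat \<Rightarrow> nat) \<Rightarrow> nat \<Rightarrow> nat" where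
  "high_pos m v = (\<lambda>j. if m < j then inv v j else 0)"

lemma inv_adj_swap_comp:
  assumes "v \<in> perm_verts n"
  shows "inv (adj_swap i \<circ> v) = inv v \<circ> adj_swap i"
proof -
  have "bij v" using assms by (auto simp: perm_verts_def permutes_bij)
  then show ?thesis by (simp add: o_inv_distrib)
qed

lemma high_pos_adj_swap:
  assumes "v \<in> perm_verts n" "i < m"
  shows "high_pos m (adj_swap i \<circ> v) = high_pos m v"
  unfolding high_pos_def inv_adj_swap_comp[OF assms(1)] using assms(2)
  by (auto simp: fun_eq_iff Transposition.transpose_def)

text \<open>The edges of the coset of \<open>v\<close> under the permutations of the values \<open>1..m\<close>. The coset is
  determined by the positions of the values above \<open>m\<close>.\<close>

definition block_edges :: "nat \<Rightarrow> nat \<Rightarrow> (nat \<Rightarrow> nat) \<Rightarrow> (nat \<Rightarrow> nat) set set" where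
  "block_edges n m v = {e \<in> swap_edges n {1..<m}. \<forall>w\<in>e. high_pos m w = high_pos m v}"

lemma block_cluster_subset:
  assumes "R \<subseteq> block_edges n m v" "v \<in> perm_verts n" "m \<le> n + 1"
  shows "cluster R v \<subseteq> {w \<in> perm_verts n. high_pos m w = high_pos m v}"
proof (rule reach_minimal)
  fix e assume e: "e \<in> R"
  then have "e \<in> swap_edges n {1..<m}" "\<forall>w\<in>e. high_pos m w = high_pos m v"
    using assms(1) by (auto simp: block_edges_def)
  moreover have "\<Union>(swap_edges n {1..<m}) \<subseteq> perm_verts n"
    using assms(3) by (intro swap_edges_verts) auto
  ultimately show "(\<lambda>x. x) ` e \<subseteq> {w \<in> perm_verts n. high_pos m w = high_pos m v}" by auto
qed (use assms in auto)

text \<open>Swaps below \<open>m\<close> never leave the coset, so inside it the isoperimetric bound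
  with all \<open>m - 1\<close> directions is available.\<close>

lemma bnd_block_edges:
  assumes "S \<subseteq> {w \<in> perm_verts n. high_pos m w = high_pos m v}" "m \<le> n + 1"
  shows "bnd (\<lambda>x. x) (block_edges n m v) S = bnd (\<lambda>x. x) (swap_edges n {1..<m}) S"
proof (intro antisym subsetI)
  fix e assume e: "e \<in> bnd (\<lambda>x. x) (swap_edges n {1..<m}) S"
  then obtain x where x: "x \<in> e" "x \<in> S" "e \<in> swap_edges n {1..<m}" by (auto simp: bnd_def)
  have "{1..<m} \<subseteq> {1..n}" using assms(2) by auto
  then obtain i where i: "i \<in> {1..<m}" "e = {x, adj_swap i \<circ> x}"
    using swap_edges_at[of "{1..<m}" n e x] x by auto
  have "high_pos m x = high_pos m v" "x \<in> perm_verts n" using x assms(1) by auto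
  then have "\<forall>w\<in>e. high_pos m w = high_pos m v" using i high_pos_adj_swap[of x n i m] by auto
  then show "e \<in> bnd (\<lambda>x. x) (block_edges n m v) S" using e by (auto simp: bnd_def block_edges_def)
qed (auto simp: bnd_def block_edges_def)

lemma block_cluster_small:
  assumes "v \<in> perm_verts n" "1 \<le> m" "m \<le> n + 1" "0 \<le> p" "p < 1" "0 \<le> lam" "lam \<le> 1"
    "real d + 3 * ln (real M) \<le> real (m - 1)" "(1 - p * (1 - lam)) ^ d \<le> lam"
  shows "pprob (block_edges n m v) p (\<lambda>R. card (cluster R v) < M) \<le> lam"
proof -
  have sub: "{1..<m} \<subseteq> {1..n}" using assms by auto
  have g: "graph_edges (block_edges n m v)"
    by (rule graph_edges_subset[OF graph_edges_swap[of "{1..<m}" n]]) (auto simp: block_edges_def)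
  \<comment> \<open>Exponent 0: no lower cutoff on the order of the cluster.\<close>
  have "1 ^ 0 * pprob (block_edges n m v) p (\<lambda>R. 0 \<le> card (cluster R v) \<and> card (cluster R v) < M) \<le> lam"
  proof (rule cluster_gap_upper[OF g assms(4-7), where d = d])
    fix R assume R: "R \<subseteq> block_edges n m v" "card (cluster R v) < M"
    have C: "cluster R v \<subseteq> {w \<in> perm_verts n. high_pos m w = high_pos m v}"
      by (rule block_cluster_subset[OF R(1) assms(1,3)])
    have "0 < card (cluster R v)"
      using finite_reach[OF g R(1), of "{v}"] by (simp add: card_gt_0_iff)
    then show "d * card (cluster R v) \<le> card (bnd (\<lambda>x. x) (block_edges n m v) (cluster R v))"
      unfolding bnd_block_edges[OF C assms(3)] using C R(2) assms(8) sub
      by (intro bnd_ge_of_small[where M = M]) auto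
  qed (use assms in auto)
  then show ?thesis by simp
qed

text \<open>The gap between the two ranges gives \<open>a + 1 < b\<close>: the swaps have disjoint
  supports, both above \<open>m\<close>, and can be recovered from the images of the four
  indices.\<close>

lemma double_swap_inj:
  assumes "\<And>j. m < j \<Longrightarrow> adj_swap b (adj_swap a j) = adj_swap b' (adj_swap a' j)"
    "a \<in> {m+1..m+l}" "a' \<in> {m+1..m+l}" "b \<in> {m+l+2..m+2*l+1}" "b' \<in> {m+l+2..m+2*l+1}"
  shows "a = a' \<and> b = b'"
proof -
  have "a = a'"
    using assms(1)[of a] assms(1)[of a'] assms(2-5)
    by (auto simp: Transposition.transpose_def split: if_splits)
  moreover have "b = b'"
    using assms(1)[of b] assms(1)[of b'] assms(2-5)
    by (auto simp: Transposition.transpose_def split: if_splits)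
  ultimately show ?thesis by simp
qed

definition near_large :: "nat \<Rightarrow> nat \<Rightarrow> (nat \<Rightarrow> nat) set set \<Rightarrow> (nat \<Rightarrow> nat) \<Rightarrow> bool" where
  "near_large n M X v \<longleftrightarrow> (\<exists>z u. {v, z} \<in> perm_edges n \<and> {z, u} \<in> perm_edges n \<and> M \<le> card (cluster X u))"

text \<open>The vertices \<open>\<tau>\<^sub>a \<tau>\<^sub>b v\<close> lie in different cosets, so their clusters inside these cosets are independent;
  there are \<open>l\<^sup>2\<close> of them, which beats the \<open>exp (O(n log n))\<close> vertices in a union bound.\<close>

lemma not_near_large_prob:
  assumes "v \<in> perm_verts n" "1 \<le> m" "m + 2 * l + 1 \<le> n" "0 \<le> p" "p < 1" "0 \<le> lam" "lam \<le> 1"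
    "real d + 3 * ln (real M) \<le> real (m - 1)" "(1 - p * (1 - lam)) ^ d \<le> lam"
  shows "pprob (perm_edges n) p (\<lambda>X. \<not> near_large n M X v) \<le> lam ^ (l * l)"
proof -
  define J where "J = {m+1..m+l} \<times> {m+l+2..m+2*l+1}"
  define u where "u = (\<lambda>(a, b). adj_swap a \<circ> (adj_swap b \<circ> v))"
  have J: "finite J" "card J = l * l" by (auto simp: J_def card_cartesian_product)
  have uV: "adj_swap (snd j) \<circ> v \<in> perm_verts n" "u j \<in> perm_verts n" if "j \<in> J" for j
  proof -
    show 1: "adj_swap (snd j) \<circ> v \<in> perm_verts n"
      using that assms(1,3) by (intro adj_swap_in_verts) (auto simp: J_def)
    then show "u j \<in> perm_verts n"
      unfolding u_def case_prod_beta using that assms(3)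
      by (intro adj_swap_in_verts[OF 1]) (auto simp: J_def)
  qed
  have path: "{v, adj_swap (snd j) \<circ> v} \<in> perm_edges n" "{adj_swap (snd j) \<circ> v, u j} \<in> perm_edges n"
    if "j \<in> J" for j
  proof -
    have "fst j \<in> {1..n}" "snd j \<in> {1..n}" using that assms(3) by (auto simp: J_def)
    then show "{v, adj_swap (snd j) \<circ> v} \<in> perm_edges n" "{adj_swap (snd j) \<circ> v, u j} \<in> perm_edges n"
      using uV(1)[OF that] assms(1) unfolding perm_edges_eq swap_edges_def u_def case_prod_beta by blast+
  qed
  have inj: "j = j'" if "j \<in> J" "j' \<in> J" "high_pos m (u j) = high_pos m (u j')" for j j'
  proof -
    obtain a b a' b' where ab: "j = (a, b)" "j' = (a', b')" by (cases j, cases j') auto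
    have v: "v \<in> perm_verts n" by (rule assms)
    have i: "inv (u j) = inv v \<circ> adj_swap b \<circ> adj_swap a" "inv (u j') = inv v \<circ> adj_swap b' \<circ> adj_swap a'"
      using inv_adj_swap_comp[OF uV(1)[OF that(1)]] inv_adj_swap_comp[OF uV(1)[OF that(2)]]
      by (simp_all add: u_def ab inv_adj_swap_comp[OF v])
    have "v permutes {1..n+1}" using v by (simp add: perm_verts_def)
    then have "inj (inv v)" by (rule permutes_inj[OF permutes_inv])
    then have "adj_swap b (adj_swap a k) = adj_swap b' (adj_swap a' k)" if "m < k" for k
      using fun_cong[OF \<open>high_pos m (u j) = high_pos m (u j')\<close>, of k] that
      by (simp add: high_pos_def i inj_eq)
    then have "a = a' \<and> b = b'" by (rule double_swap_inj[where l = l and m = m]) (use that ab J_def in auto)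
    then show ?thesis using ab by simp
  qed
  have sub: "block_edges n m w \<subseteq> perm_edges n" for w
  proof -
    have "{1..<m} \<subseteq> {1..n}" using assms(3) by auto
    then show ?thesis unfolding perm_edges_eq using swap_edges_mono[of "{1..<m}" "{1..n}" n]
      by (auto simp: block_edges_def)
  qed
  have disj: "disjoint_family_on (\<lambda>j. block_edges n m (u j)) J"
    unfolding disjoint_family_on_def
  proof (intro ballI impI, rule ccontr)
    fix j j' assume j: "j \<in> J" "j' \<in> J" "j \<noteq> j'" "block_edges n m (u j) \<inter> block_edges n m (u j') \<noteq> {}"
    then obtain e where e: "e \<in> block_edges n m (u j)" "e \<in> block_edges n m (u j')" by auto
    then obtain w where "w \<in> e" by (auto simp: block_edges_def swap_edges_def)
    then have "high_pos m (u j) = high_pos m (u j')" using e by (auto simp: block_edges_def)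
    then show False using inj j by auto
  qed
  \<comment> \<open>Restricting to the coset of \<open>u j\<close> only shrinks the cluster, and the
    restricted events depend on disjoint edge sets.\<close>
  have "pprob (perm_edges n) p (\<lambda>X. \<not> near_large n M X v) \<le>
    pprob (perm_edges n) p (\<lambda>X. \<forall>j\<in>J. card (cluster (X \<inter> block_edges n m (u j)) (u j)) < M)"
  proof (intro pprob_mono ballI)
    fix X j assume X: "X \<subseteq> perm_edges n" "\<not> near_large n M X v" "j \<in> J"
    have "card (cluster (X \<inter> block_edges n m (u j)) (u j)) \<le> card (cluster X (u j))"
      using X by (intro card_mono cluster_mono perm_cluster_finite) auto
    moreover have "card (cluster X (u j)) < M"
      using X(2) path[OF X(3)] unfolding near_large_def by (meson not_le)
    ultimately show "card (cluster (X \<inter> block_edges n m (u j)) (u j)) < M" by simp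
  qed (use assms in auto)
  also have "\<dots> = (\<Prod>j\<in>J. pprob (block_edges n m (u j)) p (\<lambda>R. card (cluster R (u j)) < M))"
    using sub disj J(1) by (intro pprob_all_disjoint) auto
  also have "\<dots> \<le> (\<Prod>j\<in>J. lam)"
  proof (intro prod_mono conjI)
    fix j assume "j \<in> J"
    show "0 \<le> pprob (block_edges n m (u j)) p (\<lambda>R. card (cluster R (u j)) < M)"
      using assms by (intro pexp_nonneg) auto
    show "pprob (block_edges n m (u j)) p (\<lambda>R. card (cluster R (u j)) < M) \<le> lam"
      using uV(2)[OF \<open>j \<in> J\<close>] assms by (intro block_cluster_small[where d = d]) auto
  qed
  finally show ?thesis using J by simp
qed

section \<open>Edge-disjoint families\<close>

text \<open>Choosing \<open>f\<close> and discarding all members that meet \<open>P f\<close> costs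
  at most \<open>s * D\<close> of them: each of the at most \<open>s\<close> elements of
  \<open>P f\<close> lies in at most \<open>D\<close> sets. Nonemptiness makes \<open>f\<close> one
  of the discarded, so the family shrinks.\<close>

lemma greedy_disjoint:
  assumes "finite F" "\<And>f. f \<in> F \<Longrightarrow> finite (P f) \<and> P f \<noteq> {} \<and> card (P f) \<le> s"
    "\<And>g. card {f \<in> F. g \<in> P f} \<le> D"
  shows "\<exists>F'\<subseteq>F. disjoint_family_on P F' \<and> card F \<le> s * D * card F'"
  using assms
proof (induction "card F" arbitrary: F rule: less_induct)
  case less
  show ?case
  proof (cases "F = {}")
    case True
    then show ?thesis by (auto simp: disjoint_family_on_def)
  next
    case False
    then obtain f where f: "f \<in> F" by auto
    define K where "K = {f' \<in> F. P f' \<inter> P f \<noteq> {}}"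
    have fK: "f \<in> K" "K \<subseteq> F" using f less.prems(2)[OF f] by (auto simp: K_def)
    have "K \<subseteq> (\<Union>g\<in>P f. {f' \<in> F. g \<in> P f'})" by (auto simp: K_def)
    then have "card K \<le> card (\<Union>g\<in>P f. {f' \<in> F. g \<in> P f'})"
      using less.prems(1) less.prems(2)[OF f] by (intro card_mono) auto
    also have "\<dots> \<le> (\<Sum>g\<in>P f. card {f' \<in> F. g \<in> P f'})"
      using less.prems(2)[OF f] by (intro card_UN_le) auto
    also have "\<dots> \<le> (\<Sum>g\<in>P f. D)" using less.prems(3) by (intro sum_mono) auto
    also have "\<dots> \<le> s * D" using less.prems(2)[OF f] by simp
    finally have cK: "card K \<le> s * D" .
    have "card (F - K) < card F"
      using fK f less.prems(1) by (intro psubset_card_mono) auto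
    moreover have "card {f \<in> F - K. g \<in> P f} \<le> D" for g
    proof -
      have "card {f \<in> F - K. g \<in> P f} \<le> card {f \<in> F. g \<in> P f}"
        using less.prems(1) by (intro card_mono) auto
      with less.prems(3)[of g] show ?thesis by simp
    qed
    ultimately obtain F' where F': "F' \<subseteq> F - K" "disjoint_family_on P F'" "card (F - K) \<le> s * D * card F'"
      using less.hyps[of "F - K"] less.prems(1,2) by auto
    have finF': "finite F'" using F'(1) less.prems(1) by (meson finite_Diff finite_subset)
    have "disjoint_family_on P (insert f F')"
      using F'(1,2) by (auto simp: disjoint_family_on_def K_def)
    moreover have "card F \<le> s * D * card (insert f F')"
    proof -
      have "f \<notin> F'" using F'(1) fK by auto
      then have "card (insert f F') = Suc (card F')" using finF' by simp
      moreover have "card F = card K + card (F - K)"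
        using fK less.prems(1) by (metis card_Diff_subset card_mono finite_subset le_add_diff_inverse)
      ultimately show ?thesis using cK F'(3) by simp
    qed
    ultimately show ?thesis using f F'(1) by (intro exI[of _ "insert f F'"]) auto
  qed
qed

lemma pprob_full:
  assumes "finite U" shows "pprob U p (\<lambda>R. R = U) = p ^ card U"
proof -
  have "pprob U p (\<lambda>R. R = U) = (\<Sum>R\<in>Pow U. if R = U then p ^ card U else 0)"
    unfolding pexp_def by (rule sum.cong) auto
  then show ?thesis using assms by simp
qed

text \<open>Disjointness makes the events independent, and each set is fully open with probability
  at least \<open>p ^ s\<close>.\<close>

lemma pprob_no_disjoint_subset:
  assumes "finite U" "finite F" "\<And>f. f \<in> F \<Longrightarrow> P f \<subseteq> U \<and> card (P f) \<le> s" "disjoint_family_on P F"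
    "0 \<le> p" "p \<le> 1"
  shows "pprob U p (\<lambda>Y. \<forall>f\<in>F. \<not> P f \<subseteq> Y) \<le> exp (- (p ^ s * card F))"
proof -
  have "(\<lambda>Y. of_bool (\<forall>f\<in>F. \<not> P f \<subseteq> Y) :: real) = (\<lambda>Y. of_bool (\<forall>f\<in>F. Y \<inter> P f \<noteq> P f))"
    by (auto simp: fun_eq_iff of_bool_def)
  then have "pprob U p (\<lambda>Y. \<forall>f\<in>F. \<not> P f \<subseteq> Y) = (\<Prod>f\<in>F. pprob (P f) p (\<lambda>R. R \<noteq> P f))"
    using pprob_all_disjoint[OF assms(2,1) _ assms(4), of p "\<lambda>f R. R \<noteq> P f"] assms(3) by simp
  also have "\<dots> \<le> (\<Prod>f\<in>F. exp (- (p ^ s)))"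
  proof (intro prod_mono conjI)
    fix f assume f: "f \<in> F"
    have fin: "finite (P f)" using assms(1,3) f finite_subset by blast
    show "0 \<le> pprob (P f) p (\<lambda>R. R \<noteq> P f)" using assms by (intro pexp_nonneg) auto
    have "pprob (P f) p (\<lambda>R. R \<noteq> P f) = 1 - p ^ card (P f)"
      unfolding pprob_not[OF fin] pprob_full[OF fin] ..
    also have "\<dots> \<le> 1 - p ^ s" using assms(3)[OF f] assms(5,6) by (simp add: power_decreasing)
    also have "\<dots> \<le> exp (- (p ^ s))" using exp_ge_add_one_self[of "- (p ^ s)"] by simp
    finally show "pprob (P f) p (\<lambda>R. R \<noteq> P f) \<le> exp (- (p ^ s))" .
  qed
  also have "\<dots> = exp (- (p ^ s * card F))" by (simp add: exp_of_nat_mult[symmetric] mult.commute)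
  finally show ?thesis .
qed

section \<open>Merging the large clusters by sprinkling\<close>

text \<open>Distance at most one from \<open>f\<close>. Every edge of a connecting path built around
  \<open>f\<close> has an end of this kind, so a given edge lies on the paths of only
  \<open>O(n^2)\<close> edges \<open>f\<close>.\<close>

definition near_edge :: "nat \<Rightarrow> (nat \<Rightarrow> nat) \<Rightarrow> (nat \<Rightarrow> nat) set \<Rightarrow> bool" where
  "near_edge n z f \<longleftrightarrow> z \<in> f \<or> (\<exists>z'\<in>f. {z, z'} \<in> perm_edges n)"

lemma card_near_edge_le: "card {f \<in> perm_edges n. near_edge n z f} \<le> n + n * n"
proof -
  let ?at = "\<lambda>z. {f \<in> perm_edges n. z \<in> f}"
  have at: "card (?at z) \<le> n" "finite (?at z)" for z
    using card_edges_at_le[of "{1..n}" n z] by (auto simp: perm_edges_eq)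
  have "{f \<in> perm_edges n. near_edge n z f} \<subseteq> ?at z \<union> (\<Union>i\<in>{1..n}. ?at (adj_swap i \<circ> z))"
  proof
    fix f assume f: "f \<in> {f \<in> perm_edges n. near_edge n z f}"
    show "f \<in> ?at z \<union> (\<Union>i\<in>{1..n}. ?at (adj_swap i \<circ> z))"
    proof (cases "z \<in> f")
      case False
      then obtain z' where z': "z' \<in> f" "{z, z'} \<in> perm_edges n" using f by (auto simp: near_edge_def)
      then obtain i where i: "i \<in> {1..n}" "{z, z'} = {z, adj_swap i \<circ> z}"
        using swap_edges_at[of "{1..n}" n "{z, z'}" z] by (auto simp: perm_edges_eq)
      then have "z' = adj_swap i \<circ> z" using False z' by (metis doubleton_eq_iff)
      then show ?thesis using f i z' by auto
    qed (use f in auto)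
  qed
  then have "card {f \<in> perm_edges n. near_edge n z f} \<le> card (?at z \<union> (\<Union>i\<in>{1..n}. ?at (adj_swap i \<circ> z)))"
    using at by (intro card_mono) auto
  also have "\<dots> \<le> card (?at z) + card (\<Union>i\<in>{1..n}. ?at (adj_swap i \<circ> z))" by (rule card_Un_le)
  also have "card (\<Union>i\<in>{1..n}. ?at (adj_swap i \<circ> z)) \<le> (\<Sum>i\<in>{1..n}. card (?at (adj_swap i \<circ> z)))"
    by (rule card_UN_le) simp
  also have "\<dots> \<le> (\<Sum>i\<in>{1..n}. n)" by (intro sum_mono at)
  finally show ?thesis using at(1)[of z] by simp
qed

lemma short_path:
  assumes "x \<in> A \<or> (\<exists>z u. {x, z} \<in> perm_edges n \<and> {z, u} \<in> perm_edges n \<and> u \<in> A)" "x \<in> f"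
  shows "\<exists>Q\<subseteq>perm_edges n. finite Q \<and> card Q \<le> 2 \<and> (\<forall>g\<in>Q. \<exists>z\<in>g. near_edge n z f) \<and>
    (\<forall>Y. Q \<subseteq> Y \<longrightarrow> (\<exists>a\<in>A. a \<in> cluster Y x))"
  using assms(1)
proof
  assume "x \<in> A"
  then show ?thesis by (intro exI[of _ "{}"]) (auto intro!: bexI[of _ x])
next
  assume "\<exists>z u. {x, z} \<in> perm_edges n \<and> {z, u} \<in> perm_edges n \<and> u \<in> A"
  then obtain z u where zu: "{x, z} \<in> perm_edges n" "{z, u} \<in> perm_edges n" "u \<in> A" by auto
  have "u \<in> cluster Y x" if "{{x, z}, {z, u}} \<subseteq> Y" for Y
  proof -
    have "z \<in> cluster Y x" "u \<in> cluster Y z" using that by (auto intro: cluster_edge)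
    then show ?thesis using cluster_subset[of z Y x] by auto
  qed
  moreover have "near_edge n x f" "near_edge n z f"
    using assms(2) zu(1) by (auto simp: near_edge_def insert_commute)
  moreover have "card {{x, z}, {z, u}} \<le> 2" by (simp add: card_insert_if)
  ultimately show ?thesis using zu by (intro exI[of _ "{{x, z}, {z, u}}"]) auto
qed

text \<open>\<open>A\<close> is enlarged to \<open>A'\<close> such that each boundary edge of
  \<open>A'\<close> has \<open>A\<close> within distance 2 of one end and \<open>B\<close> within
  distance 2 of the other. Expansion yields at least \<open>card A / (4 n (n + 1))\<close> such
  edges, and thinning to disjoint paths divides by \<open>5 * 4 n^2\<close>; together this is the
  denominator \<open>80 n^3 (n + 1)\<close>.\<close>

lemma separation_prob:
  assumes W: "W \<subseteq> perm_verts n" "W = A \<union> B" "A \<inter> B = {}" "card A \<le> card B"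
    and dense: "\<And>v. v \<in> perm_verts n \<Longrightarrow> \<exists>z u. {v, z} \<in> perm_edges n \<and> {z, u} \<in> perm_edges n \<and> u \<in> W"
    and p: "0 \<le> p" "p \<le> 1" and n: "1 \<le> n"
  shows "pprob (perm_edges n) p (\<lambda>Y. \<forall>a\<in>A. cluster Y a \<inter> B = {})
    \<le> exp (- (p ^ 5 * (real (card A) / (80 * real n ^ 3 * (real n + 1)))))"
proof -
  let ?E = "perm_edges n" and ?V = "perm_verts n"
  \<comment> \<open>Vertices close to both sides are put on the side of \<open>A\<close>, unless
    they belong to \<open>B\<close>.\<close>
  define A' where "A' = {v \<in> ?V. v \<in> A \<or> (v \<notin> B \<and> (\<exists>z u. {v, z} \<in> ?E \<and> {z, u} \<in> ?E \<and> u \<in> A))}"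
  have A': "A' \<subseteq> ?V" "A \<subseteq> A'" "B \<subseteq> ?V - A'" using W by (auto simp: A'_def)
  define F where "F = bnd (\<lambda>x. x) ?E A'"
  have finF: "finite F" by (auto simp: F_def)
  have cF: "card A \<le> 4 * n * (n + 1) * card F"
  proof -
    have a: "card A \<le> card A'" "card A \<le> card (?V - A')"
      using A' W(4) card_mono[of A' A] card_mono[of "?V - A'" B] finite_subset[OF A'(1)] by auto
    have N: "card ?V = card A' + card (?V - A')"
      using A'(1) by (metis card_Diff_subset card_mono finite_perm_verts finite_subset le_add_diff_inverse)
    \<comment> \<open>\<open>card A\<close> is a lower bound for both parts, so the product of the
      parts is at least half of \<open>card A * card V\<close>.\<close>
    have "card A * card ?V \<le> 2 * (card A' * card (?V - A'))"
    proof -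
      have "card A * card ?V = card A * card A' + card A * card (?V - A')"
        by (simp only: N distrib_left)
      also have "\<dots> \<le> card (?V - A') * card A' + card A' * card (?V - A')"
        by (intro add_mono mult_le_mono1 a)
      also have "\<dots> = 2 * (card A' * card (?V - A'))" by simp
      finally show ?thesis .
    qed
    also have "\<dots> \<le> 2 * (card ?V * (2 * n * (n + 1) * card F))"
      unfolding F_def by (intro mult_left_mono global_isoperimetry A') auto
    finally have "card ?V * card A \<le> card ?V * (4 * n * (n + 1) * card F)" by (simp add: algebra_simps)
    moreover have "0 < card ?V" by (simp add: card_perm_verts)
    ultimately show ?thesis by simp
  qed
  have "\<exists>P. P \<subseteq> ?E \<and> f \<in> P \<and> finite P \<and> card P \<le> 5 \<and> (\<forall>g\<in>P. \<exists>z\<in>g. near_edge n z f) \<and>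
      (\<forall>Y. P \<subseteq> Y \<longrightarrow> \<not> (\<forall>a\<in>A. cluster Y a \<inter> B = {}))" if f: "f \<in> F" for f
  proof -
    obtain x y where xy: "f \<in> ?E" "x \<in> f" "y \<in> f" "x \<in> A'" "y \<notin> A'" using f by (auto simp: F_def bnd_def)
    have yV: "y \<in> ?V" using perm_edges_verts[of ?E n] xy by auto
    obtain Q where Q: "Q \<subseteq> ?E" "finite Q" "card Q \<le> 2" "\<forall>g\<in>Q. \<exists>z\<in>g. near_edge n z f"
      "\<And>Y. Q \<subseteq> Y \<Longrightarrow> \<exists>a\<in>A. a \<in> cluster Y x"
      using short_path[of x A n f] xy by (auto simp: A'_def)
    \<comment> \<open>Otherwise the vertex of \<open>W\<close> found near \<open>y\<close> would lie
      in \<open>A\<close> and force \<open>y\<close> into \<open>A'\<close>.\<close>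
    have "y \<in> B \<or> (\<exists>z u. {y, z} \<in> ?E \<and> {z, u} \<in> ?E \<and> u \<in> B)"
      using dense[OF yV] xy(5) yV W(2) by (auto simp: A'_def)
    then obtain Q' where Q': "Q' \<subseteq> ?E" "finite Q'" "card Q' \<le> 2" "\<forall>g\<in>Q'. \<exists>z\<in>g. near_edge n z f"
      "\<And>Y. Q' \<subseteq> Y \<Longrightarrow> \<exists>b\<in>B. b \<in> cluster Y y"
      using short_path[of y B n f] xy by auto
    let ?P = "insert f (Q \<union> Q')"
    have "card ?P \<le> Suc (card (Q \<union> Q'))" using Q(2) Q'(2) by (simp add: card_insert_if)
    moreover have "card (Q \<union> Q') \<le> card Q + card Q'" by (rule card_Un_le)
    ultimately have c5: "card ?P \<le> 5" using Q(3) Q'(3) by simp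
    have "\<not> (\<forall>a\<in>A. cluster Y a \<inter> B = {})" if Y: "?P \<subseteq> Y" for Y
    proof -
      obtain a where a: "a \<in> A" "a \<in> cluster Y x" using Q(5)[of Y] Y by auto
      obtain b where b: "b \<in> B" "b \<in> cluster Y y" using Q'(5)[of Y] Y by auto
      have "y \<in> cluster Y x" using Y xy by (intro cluster_edge[of f]) auto
      then have "b \<in> cluster Y a" using cluster_eq[of y Y x] cluster_eq[OF a(2)] b(2) by simp
      then show ?thesis using a b by auto
    qed
    moreover have "\<exists>z\<in>f. near_edge n z f" using xy(2) by (auto simp: near_edge_def)
    ultimately show ?thesis using Q Q' c5 xy(1) by (intro exI[of _ ?P]) auto
  qed
  then obtain P where P: "\<And>f. f \<in> F \<Longrightarrow> P f \<subseteq> ?E \<and> f \<in> P f \<and> finite (P f) \<and> card (P f) \<le> 5 \<and>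
      (\<forall>g\<in>P f. \<exists>z\<in>g. near_edge n z f) \<and> (\<forall>Y. P f \<subseteq> Y \<longrightarrow> \<not> (\<forall>a\<in>A. cluster Y a \<inter> B = {}))"
    by metis
  \<comment> \<open>If \<open>P f\<close> uses \<open>g\<close>, then \<open>f\<close> is near one
    of the two ends of \<open>g\<close>.\<close>
  have "card {f \<in> F. g \<in> P f} \<le> 4 * n * n" for g
  proof (cases "g \<in> ?E")
    case False
    then have "{f \<in> F. g \<in> P f} = {}" using P by auto
    then show ?thesis by (simp only: card.empty)
  next
    case True
    then obtain z1 z2 where g: "g = {z1, z2}" using graph_perm_edges unfolding graph_edges_def by meson
    have "{f \<in> F. g \<in> P f} \<subseteq> {f \<in> ?E. near_edge n z1 f} \<union> {f \<in> ?E. near_edge n z2 f}"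
      using P g by (fastforce simp: F_def bnd_def)
    then have "card {f \<in> F. g \<in> P f} \<le> card ({f \<in> ?E. near_edge n z1 f} \<union> {f \<in> ?E. near_edge n z2 f})"
      by (intro card_mono) auto
    also have "\<dots> \<le> card {f \<in> ?E. near_edge n z1 f} + card {f \<in> ?E. near_edge n z2 f}" by (rule card_Un_le)
    also have "\<dots> \<le> (n + n * n) + (n + n * n)" by (intro add_mono card_near_edge_le)
    also have "\<dots> \<le> (n * n + n * n) + (n * n + n * n)" by (intro add_mono le_square order_refl)
    also have "\<dots> = 4 * n * n" by simp
    finally show ?thesis .
  qed
  then obtain F' where F': "F' \<subseteq> F" "disjoint_family_on P F'" "card F \<le> 5 * (4 * n * n) * card F'"
    using greedy_disjoint[OF finF, of P 5 "4 * n * n"] P by blast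
  have "card A \<le> 4 * n * (n + 1) * (5 * (4 * n * n) * card F')"
    using cF F'(3) by (meson mult_le_mono2 order_trans)
  then have "real (card A) \<le> real (4 * n * (n + 1) * (5 * (4 * n * n) * card F'))" by (simp only: of_nat_le_iff)
  also have "\<dots> = real (card F') * (80 * real n ^ 3 * (real n + 1))"
    by (simp add: power3_eq_cube algebra_simps)
  finally have "real (card A) / (80 * real n ^ 3 * (real n + 1)) \<le> real (card F')"
    using n by (intro mult_imp_div_pos_le) (auto intro!: mult_pos_pos)
  then have le: "p ^ 5 * (real (card A) / (80 * real n ^ 3 * (real n + 1))) \<le> p ^ 5 * real (card F')"
    using p by (intro mult_left_mono) auto
  have "pprob ?E p (\<lambda>Y. \<forall>a\<in>A. cluster Y a \<inter> B = {}) \<le> pprob ?E p (\<lambda>Y. \<forall>f\<in>F'. \<not> P f \<subseteq> Y)"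
    using P F'(1) p by (intro pprob_mono) blast+
  also have "\<dots> \<le> exp (- (p ^ 5 * real (card F')))"
    using P F' finF p by (intro pprob_no_disjoint_subset) (auto intro: finite_subset)
  also have "\<dots> \<le> exp (- (p ^ 5 * (real (card A) / (80 * real n ^ 3 * (real n + 1)))))"
    using le by simp
  finally show ?thesis .
qed

lemma sum_Pow_power:
  assumes "finite L" shows "(\<Sum>S\<in>Pow L. x ^ card S) = (1 + x :: real) ^ card L"
  using assms
proof induction
  case (insert a L)
  have inj: "inj_on (insert a) (Pow L)" using insert.hyps by (auto simp: inj_on_def)
  have "(\<Sum>S\<in>Pow (insert a L). x ^ card S) = (\<Sum>S\<in>Pow L. x ^ card S) + (\<Sum>S\<in>insert a ` Pow L. x ^ card S)"
    unfolding Pow_insert using insert.hyps by (intro sum.union_disjoint) auto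
  also have "(\<Sum>S\<in>insert a ` Pow L. x ^ card S) = (\<Sum>S\<in>Pow L. x * x ^ card S)"
    unfolding sum.reindex[OF inj]
  proof (rule sum.cong[OF refl])
    fix S assume S: "S \<in> Pow L"
    then have "finite S" "a \<notin> S" using insert.hyps by (auto intro: finite_subset)
    then show "((\<lambda>S. x ^ card S) \<circ> insert a) S = x * x ^ card S" by simp
  qed
  also have "\<dots> = x * (\<Sum>S\<in>Pow L. x ^ card S)" by (simp add: sum_distrib_left)
  finally show ?case using insert by (simp add: algebra_simps)
qed simp

text \<open>If merging fails, the old large clusters split into two groups between which
  \<open>Y\<close> alone has no connection. A group of \<open>card S\<close> clusters has at least
  \<open>M * card S\<close> vertices and is cut off with probability at most
  \<open>x ^ card S\<close>; the binomial sum over nonempty \<open>S\<close> gives the bound, with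
  the number of clusters estimated by the number of vertices.\<close>

lemma merge_prob:
  assumes X: "X \<subseteq> perm_edges n" and W: "W = {v \<in> perm_verts n. M \<le> card (cluster X v)}"
    and dense: "\<And>v. v \<in> perm_verts n \<Longrightarrow> near_large n M X v"
    and p: "0 \<le> p" "p \<le> 1" and n: "1 \<le> n"
    and x: "x = exp (- (p ^ 5 * (real M / (80 * real n ^ 3 * (real n + 1)))))"
  shows "pprob (perm_edges n) p (\<lambda>Y. \<exists>u\<in>W. \<exists>w\<in>W. cluster (X \<union> Y) u \<noteq> cluster (X \<union> Y) w)
    \<le> (1 + x) ^ fact (n + 1) - 1"
proof -
  let ?E = "perm_edges n" and ?V = "perm_verts n"
  define L where "L = cluster X ` W"
  have finW: "finite W" by (simp add: W)
  then have finL: "finite L" by (simp add: L_def)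
  have WL: "W = \<Union>L"
  proof (intro antisym subsetI)
    fix v assume "v \<in> \<Union>L"
    then obtain u where u: "u \<in> W" "v \<in> cluster X u" by (auto simp: L_def)
    then have "v \<in> ?V" using perm_cluster_verts[OF X] W by auto
    then show "v \<in> W" using u cluster_eq[OF u(2)] W by simp
  qed (auto simp: L_def intro!: bexI)
  have L: "K \<in> L \<Longrightarrow> v \<in> K \<Longrightarrow> K = cluster X v" for K v
  proof -
    assume "K \<in> L" "v \<in> K"
    then obtain u where "K = cluster X u" "v \<in> cluster X u" by (auto simp: L_def)
    then show "K = cluster X v" using cluster_eq[of v X u] by simp
  qed
  have ne: "K \<in> L \<Longrightarrow> K \<noteq> {}" for K by (auto simp: L_def)
  have disj: "\<Union>S \<inter> \<Union>(L - S) = {}" if "S \<subseteq> L" for S using that L by blast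
  have cU: "M * card S \<le> card (\<Union>S)" if S: "S \<subseteq> L" for S
  proof -
    have "card (\<Union>S) = sum card S"
    proof (rule card_Union_disjoint)
      show "pairwise disjnt S"
      proof (rule pairwiseI)
        fix K K' assume K: "K \<in> S" "K' \<in> S" "K \<noteq> K'"
        have False if "v \<in> K" "v \<in> K'" for v
          using L[of K v] L[of K' v] K S that by auto
        then show "disjnt K K'" by (auto simp: disjnt_def)
      qed
      show "finite K" if "K \<in> S" for K using that S perm_cluster_finite[OF X] by (auto simp: L_def)
    qed
    also have "sum card S \<ge> (\<Sum>K\<in>S. M)" using S by (intro sum_mono) (auto simp: L_def W)
    finally show ?thesis by (simp add: mult.commute)
  qed
  \<comment> \<open>Only the lighter of the two groups is recorded, since
    \<open>separation_prob\<close> measures the smaller side.\<close>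
  define I where "I = {S \<in> Pow L - {{}}. card (\<Union>S) \<le> card (\<Union>(L - S))}"
  have finI: "finite I" using finL by (simp add: I_def)
  have "pprob ?E p (\<lambda>Y. \<exists>u\<in>W. \<exists>w\<in>W. cluster (X \<union> Y) u \<noteq> cluster (X \<union> Y) w)
    \<le> pprob ?E p (\<lambda>Y. \<exists>S\<in>I. \<forall>a\<in>\<Union>S. cluster Y a \<inter> \<Union>(L - S) = {})"
  proof (intro pprob_mono p)
    fix Y assume Y: "Y \<subseteq> ?E" "\<exists>u\<in>W. \<exists>w\<in>W. cluster (X \<union> Y) u \<noteq> cluster (X \<union> Y) w"
    then obtain u w where uw: "u \<in> W" "w \<in> W" "cluster (X \<union> Y) u \<noteq> cluster (X \<union> Y) w" by auto
    \<comment> \<open>The old clusters swallowed by the new cluster of \<open>u\<close>; that of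
      \<open>w\<close> is not among them.\<close>
    define S where "S = {K \<in> L. K \<subseteq> cluster (X \<union> Y) u}"
    have S: "S \<subseteq> L" by (auto simp: S_def)
    have sep: "b \<notin> cluster Y a" if ab: "a \<in> \<Union>S" "b \<in> \<Union>(L - S)" for a b
    proof
      assume "b \<in> cluster Y a"
      then have "b \<in> cluster (X \<union> Y) a" using cluster_mono[of Y "X \<union> Y" a] by auto
      moreover have "a \<in> cluster (X \<union> Y) u" using ab(1) by (auto simp: S_def)
      ultimately have b: "cluster (X \<union> Y) b = cluster (X \<union> Y) u"
        using cluster_eq[of b "X \<union> Y" a] cluster_eq[of a "X \<union> Y" u] by simp
      obtain K where K: "K \<in> L" "b \<in> K" "K \<notin> S" using ab(2) by auto
      have "K = cluster X b" using L K by auto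
      then have "K \<subseteq> cluster (X \<union> Y) u" using b cluster_mono[of X "X \<union> Y" b] by auto
      then show False using K by (auto simp: S_def)
    qed
    have "cluster X u \<in> S" using uw cluster_mono[of X "X \<union> Y" u] by (auto simp: S_def L_def)
    moreover have "cluster X w \<in> L - S"
    proof -
      have "\<not> cluster X w \<subseteq> cluster (X \<union> Y) u"
      proof
        assume "cluster X w \<subseteq> cluster (X \<union> Y) u"
        then have "w \<in> cluster (X \<union> Y) u" using self_in_cluster[of w X] by (rule subsetD)
        then show False using cluster_eq uw(3) by metis
      qed
      then show ?thesis using uw by (auto simp: S_def L_def)
    qed
    ultimately have nonempty: "S \<noteq> {}" "L - S \<noteq> {}" by auto
    show "\<exists>S\<in>I. \<forall>a\<in>\<Union>S. cluster Y a \<inter> \<Union>(L - S) = {}"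
    proof (cases "card (\<Union>S) \<le> card (\<Union>(L - S))")
      case True
      then have "S \<in> I" using S nonempty by (auto simp: I_def)
      then show ?thesis using sep by (intro bexI[of _ S]) auto
    next
      case False
      have "L - (L - S) = S" using S by auto
      then have "L - S \<in> I" using False nonempty by (auto simp: I_def)
      moreover have "a \<notin> cluster Y b" if "a \<in> \<Union>S" "b \<in> \<Union>(L - S)" for a b
        using sep[OF that] cluster_sym by metis
      ultimately show ?thesis using \<open>L - (L - S) = S\<close> by (intro bexI[of _ "L - S"]) auto
    qed
  qed
  also have "\<dots> \<le> (\<Sum>S\<in>I. pprob ?E p (\<lambda>Y. \<forall>a\<in>\<Union>S. cluster Y a \<inter> \<Union>(L - S) = {}))"
    by (intro pprob_ex p finI)
  also have "\<dots> \<le> (\<Sum>S\<in>I. x ^ card S)"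
  proof (rule sum_mono)
    fix S assume S: "S \<in> I"
    have SL: "S \<subseteq> L" using S by (auto simp: I_def)
    let ?d = "80 * real n ^ 3 * (real n + 1)"
    have d: "0 < ?d" using n by (intro mult_pos_pos) auto
    have "pprob ?E p (\<lambda>Y. \<forall>a\<in>\<Union>S. cluster Y a \<inter> \<Union>(L - S) = {})
      \<le> exp (- (p ^ 5 * (real (card (\<Union>S)) / ?d)))"
    proof (rule separation_prob[OF _ _ disj[OF SL] _ _ p n, where W = W])
      show "W \<subseteq> ?V" by (auto simp: W)
      show "W = \<Union>S \<union> \<Union>(L - S)" unfolding WL using SL by auto
      show "card (\<Union>S) \<le> card (\<Union>(L - S))" using S by (auto simp: I_def)
      fix v assume "v \<in> ?V"
      then obtain z u where zu: "{v, z} \<in> ?E" "{z, u} \<in> ?E" "M \<le> card (cluster X u)"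
        using dense[of v] unfolding near_large_def by blast
      then have "u \<in> W" using perm_edges_verts[of ?E n] W by auto
      then show "\<exists>z u. {v, z} \<in> ?E \<and> {z, u} \<in> ?E \<and> u \<in> W" using zu by auto
    qed
    also have "\<dots> \<le> exp (real (card S) * - (p ^ 5 * (real M / ?d)))"
    proof -
      have "real (M * card S) \<le> real (card (\<Union>S))" using cU[OF SL] by (simp only: of_nat_le_iff)
      then have "real (M * card S) / ?d \<le> real (card (\<Union>S)) / ?d" using d by (intro divide_right_mono) auto
      then have "p ^ 5 * (real (M * card S) / ?d) \<le> p ^ 5 * (real (card (\<Union>S)) / ?d)"
        using p by (intro mult_left_mono) auto
      then show ?thesis by (simp add: mult_ac)
    qed
    also have "\<dots> = x ^ card S" unfolding x by (rule exp_of_nat_mult)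
    finally show "pprob ?E p (\<lambda>Y. \<forall>a\<in>\<Union>S. cluster Y a \<inter> \<Union>(L - S) = {}) \<le> x ^ card S" .
  qed
  also have "\<dots> \<le> (\<Sum>S\<in>Pow L - {{}}. x ^ card S)"
    using finL by (intro sum_mono2) (auto simp: I_def x)
  also have "\<dots> = (1 + x) ^ card L - 1"
    using finL by (subst sum_diff1) (auto simp: sum_Pow_power)
  also have "\<dots> \<le> (1 + x) ^ fact (n + 1) - 1"
  proof -
    have "card L \<le> card W" unfolding L_def by (rule card_image_le[OF finW])
    also have "\<dots> \<le> card ?V" by (rule card_mono) (auto simp: W)
    finally have "card L \<le> fact (n + 1)" by (simp only: card_perm_verts)
    then show ?thesis by (intro diff_right_mono power_increasing) (auto simp: x)
  qed
  finally show ?thesis .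
qed

text \<open>Contracting the clusters of \<open>X\<close> outside \<open>W\<close>, which have at most \<open>s\<close> vertices, leaves a graph of
  degree at most \<open>n s\<close>, on which the second percolation is subcritical.\<close>

lemma stray_cluster_prob:
  assumes X: "X \<subseteq> perm_edges n" and W: "W \<subseteq> perm_verts n"
    and small: "\<And>v. v \<in> perm_verts n - W \<Longrightarrow> card (cluster X v) \<le> s" and s: "0 < s"
    and p: "0 \<le> p" "p \<le> 1" "(1 + p) ^ (n * s) \<le> 4 / 3" and v: "v \<in> perm_verts n"
  shows "pprob (perm_edges n) p (\<lambda>Y. s * m \<le> card (cluster (X \<union> Y) v) \<and> cluster (X \<union> Y) v \<inter> W = {})
    \<le> 2 * (2 / 3) ^ m"
proof (cases "v \<in> W")
  case True
  then have "\<not> cluster (X \<union> Y) v \<inter> W = {}" for Y using self_in_cluster[of v "X \<union> Y"] by (metis IntI empty_iff)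
  then show ?thesis by (simp add: pexp_const)
next
  case False
  let ?E = "perm_edges n" and ?V = "perm_verts n" and ?f = "cluster X"
  \<comment> \<open>Edges meeting \<open>W\<close> are dropped: a cluster avoiding \<open>W\<close>
    does not use them.\<close>
  define E' where "E' = {e \<in> ?E. e \<inter> W = {}}"
  have E': "E' \<subseteq> ?E" "graph_edges E'" using graph_edges_subset[OF graph_perm_edges, of E' n] by (auto simp: E'_def)
  have C: "reach ?f R {?f v} \<subseteq> ?f ` (?V - W)" if "R \<subseteq> E'" for R
  proof (rule reach_minimal)
    fix e assume "e \<in> R"
    then have "e \<in> ?E" "e \<inter> W = {}" using that by (auto simp: E'_def)
    then show "?f ` e \<subseteq> ?f ` (?V - W)" using perm_edges_verts[of ?E n] by auto
  qed (use v False in auto)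
  have finC: "finite (reach ?f R {?f v})" if "R \<subseteq> E'" for R
    by (rule finite_reach[OF E'(2) that]) simp
  have Cs: "card K \<le> s" "finite K" if "R \<subseteq> E'" "K \<in> reach ?f R {?f v}" for R K
    using C[OF that(1)] that(2) small perm_cluster_finite[OF X] by auto
  \<comment> \<open>The parameters are \<open>lam = 2\<close>, \<open>rho = 3 / 2\<close> and
    \<open>D = n * s\<close>; then \<open>rho * (1 + p) ^ D \<le> 2\<close> is the assumption with
    the constant \<open>4 / 3\<close>.\<close>
  have "(3 / 2) ^ m * pprob E' p (\<lambda>R. m \<le> card (reach ?f R {?f v})) \<le> 2"
  proof (rule cluster_tail_subcritical[OF E'(2) p(1,2)])
    fix R assume R: "R \<subseteq> E'"
    let ?C = "reach ?f R {?f v}"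
    have "touch ?f E' ?C \<subseteq> (\<Union>K\<in>?C. touch (\<lambda>x. x) ?E K)"
    proof
      fix e assume "e \<in> touch ?f E' ?C"
      then obtain x where x: "x \<in> e" "?f x \<in> ?C" "e \<in> ?E" using E'(1) by (auto simp: touch_def)
      then have "e \<in> touch (\<lambda>x. x) ?E (?f x)" using self_in_cluster[of x X] by (auto simp: touch_def simp del: self_in_cluster)
      then show "e \<in> (\<Union>K\<in>?C. touch (\<lambda>x. x) ?E K)" using x by auto
    qed
    then have "card (touch ?f E' ?C) \<le> card (\<Union>K\<in>?C. touch (\<lambda>x. x) ?E K)"
      using finC[OF R] by (intro card_mono) auto
    also have "\<dots> \<le> (\<Sum>K\<in>?C. card (touch (\<lambda>x. x) ?E K))" using finC[OF R] by (rule card_UN_le)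
    also have "\<dots> \<le> (\<Sum>K\<in>?C. n * s)"
    proof (rule sum_mono)
      fix K assume K: "K \<in> ?C"
      have "card (touch (\<lambda>x. x) ?E K) \<le> n * card K"
        using card_touch_swap_le[of "{1..n}" n K] Cs(2)[OF R K] by (simp add: perm_edges_eq)
      also have "\<dots> \<le> n * s" using Cs(1)[OF R K] by simp
      finally show "card (touch (\<lambda>x. x) ?E K) \<le> n * s" .
    qed
    finally show "card (touch ?f E' ?C) \<le> (n * s) * card ?C" by (simp add: mult.commute)
  qed (use p in auto)
  then have b: "pprob E' p (\<lambda>R. m \<le> card (reach ?f R {?f v})) \<le> 2 * (2 / 3) ^ m"
    by (simp add: field_simps power_divide)
  have "pprob ?E p (\<lambda>Y. s * m \<le> card (cluster (X \<union> Y) v) \<and> cluster (X \<union> Y) v \<inter> W = {})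
    \<le> pprob ?E p (\<lambda>Y. m \<le> card (reach ?f (Y \<inter> E') {?f v}))"
  proof (intro pprob_mono p)
    fix Y assume Y: "Y \<subseteq> ?E" and K: "s * m \<le> card (cluster (X \<union> Y) v) \<and> cluster (X \<union> Y) v \<inter> W = {}"
    let ?C = "reach ?f (Y \<inter> E') {?f v}"
    \<comment> \<open>Along the cluster in \<open>X \<union> Y\<close> an edge of \<open>X\<close>
      stays within one contracted vertex, and any other edge is an open edge of
      \<open>E'\<close>.\<close>
    have in_C: "?f x \<in> ?C" if "x \<in> cluster (X \<union> Y) v" for x
      using that
    proof induction
      case (reach_base x)
      then show ?case by (auto intro: reach.reach_base)
    next
      case (reach_step x e y)
      show ?case
      proof (cases "e \<in> X")
        case True
        then have "?f y = ?f x" using reach_step by (intro cluster_eq cluster_edge) auto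
        then show ?thesis using reach_step by simp
      next
        case e: False
        have "e \<subseteq> cluster (X \<union> Y) v"
          using reach_closed[of e "X \<union> Y" "\<lambda>x. x" "{v}"] reach_step.hyps by auto
        then have "e \<inter> W = {}" using K by auto
        then have "e \<in> Y \<inter> E'" using e reach_step.hyps Y by (auto simp: E'_def)
        moreover have "?f x \<in> ?f ` e" "?f y \<in> ?f ` e" using reach_step.hyps by auto
        ultimately show ?thesis using reach_step.IH by (rule reach.reach_step[rotated])
      qed
    qed
    have "cluster (X \<union> Y) v \<subseteq> \<Union>?C"
    proof
      fix x assume "x \<in> cluster (X \<union> Y) v"
      then show "x \<in> \<Union>?C" using in_C self_in_cluster[of x X] by blast
    qed
    moreover have "finite (\<Union>?C)" using finC[of "Y \<inter> E'"] Cs(2)[of "Y \<inter> E'"] by auto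
    ultimately have "card (cluster (X \<union> Y) v) \<le> card (\<Union>?C)" by (intro card_mono)
    also have "\<dots> \<le> sum card ?C" using card_UN_le[OF finC[of "Y \<inter> E'"], of "\<lambda>K. K"] by simp
    also have "\<dots> \<le> (\<Sum>K\<in>?C. s)" using Cs(1)[of "Y \<inter> E'"] by (intro sum_mono) auto
    finally have "card (cluster (X \<union> Y) v) \<le> s * card ?C" by (simp add: mult.commute)
    then have "s * m \<le> s * card ?C" using conjunct1[OF K] by (rule order_trans[rotated])
    then show "m \<le> card ?C" using s by simp
  qed
  also have "\<dots> = pprob E' p (\<lambda>R. m \<le> card (reach ?f R {?f v}))"
    using E'(1) by (intro pexp_restrict[of ?E E' p "\<lambda>R. of_bool (m \<le> card (reach ?f R {?f v}))"]) auto
  finally show ?thesis using b by simp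
qed

text \<open>Freeze the first round \<open>X\<close>. If every vertex is near a large cluster and
  none lies in a cluster of intermediate order, then two different large clusters of
  \<open>X \<union> Y\<close> leave two options: both meet the union \<open>W\<close> of the old
  large clusters, which is then not merged, or one avoids \<open>W\<close> and is assembled from
  clusters of order at most \<open>s\<close>. The exceptional \<open>X\<close> account for the first
  two summands.\<close>

lemma two_large_clusters_prob:
  assumes n: "1 \<le> n" and s: "0 < s" "s * m \<le> M"
    and sprinkle: "1 - p = (1 - p1) * (1 - p2)" and p1: "0 \<le> p1" "p1 < 1" and p2: "0 \<le> p2" "p2 \<le> 1"
    and p2s: "(1 + p2) ^ (n * s) \<le> 4 / 3"
    and x: "x = exp (- (p2 ^ 5 * (real M / (80 * real n ^ 3 * (real n + 1)))))"
  shows "pprob (perm_edges n) p (\<lambda>G. \<exists>u\<in>perm_verts n. \<exists>w\<in>perm_verts n. M \<le> card (cluster G u) \<and>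
      M \<le> card (cluster G w) \<and> cluster G u \<noteq> cluster G w)
    \<le> pprob (perm_edges n) p1 (\<lambda>X. \<exists>v\<in>perm_verts n. \<not> near_large n M X v)
      + pprob (perm_edges n) p1 (\<lambda>X. \<exists>v\<in>perm_verts n. s \<le> card (cluster X v) \<and> card (cluster X v) < M)
      + ((1 + x) ^ fact (n + 1) - 1) + fact (n + 1) * (2 * (2 / 3) ^ m)"
proof -
  let ?E = "perm_edges n" and ?V = "perm_verts n"
  let ?bad = "\<lambda>G. \<exists>u\<in>?V. \<exists>w\<in>?V. M \<le> card (cluster G u) \<and> M \<le> card (cluster G w) \<and> cluster G u \<noteq> cluster G w"
  let ?D = "\<lambda>X. \<exists>v\<in>?V. \<not> near_large n M X v"
  let ?G = "\<lambda>X. \<exists>v\<in>?V. s \<le> card (cluster X v) \<and> card (cluster X v) < M"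
  define c where "c = ((1 + x) ^ fact (n + 1) - 1) + fact (n + 1) * (2 * (2 / 3) ^ m)"
  have c0: "0 \<le> c"
  proof -
    have "1 \<le> (1 + x) ^ fact (n + 1)" by (rule one_le_power) (simp add: x)
    then show ?thesis by (simp add: c_def)
  qed
  have "pprob ?E p ?bad = pexp ?E p1 (\<lambda>X. pprob ?E p2 (\<lambda>Y. ?bad (X \<union> Y)))"
    by (intro pexp_sprinkle sprinkle) simp
  also have "\<dots> \<le> pexp ?E p1 (\<lambda>X. of_bool (?D X) + of_bool (?G X) + c)"
  proof (intro pexp_mono)
    fix X assume X: "X \<subseteq> ?E"
    show "pprob ?E p2 (\<lambda>Y. ?bad (X \<union> Y)) \<le> of_bool (?D X) + of_bool (?G X) + c"
    proof (cases "?D X \<or> ?G X")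
      case True
      have "pprob ?E p2 (\<lambda>Y. ?bad (X \<union> Y)) \<le> 1" by (intro pprob_le_1 p2) simp
      moreover have "1 \<le> (of_bool (?D X) + of_bool (?G X) :: real)" using True by (auto simp: of_bool_def)
      ultimately show ?thesis using c0 by linarith
    next
      case False
      then have D: "\<And>v. v \<in> ?V \<Longrightarrow> near_large n M X v" by blast
      define W where "W = {v \<in> ?V. M \<le> card (cluster X v)}"
      have small: "card (cluster X v) \<le> s" if "v \<in> ?V - W" for v
        using False that by (fastforce simp: W_def)
      have "pprob ?E p2 (\<lambda>Y. ?bad (X \<union> Y)) \<le>
        pprob ?E p2 (\<lambda>Y. (\<exists>u\<in>W. \<exists>w\<in>W. cluster (X \<union> Y) u \<noteq> cluster (X \<union> Y) w) \<or>
          (\<exists>v\<in>?V. s * m \<le> card (cluster (X \<union> Y) v) \<and> cluster (X \<union> Y) v \<inter> W = {}))"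
      proof (intro pprob_mono p2)
        fix Y assume "?bad (X \<union> Y)"
        then obtain u w where uw: "u \<in> ?V" "w \<in> ?V" "M \<le> card (cluster (X \<union> Y) u)"
          "M \<le> card (cluster (X \<union> Y) w)" "cluster (X \<union> Y) u \<noteq> cluster (X \<union> Y) w" by blast
        show "(\<exists>u\<in>W. \<exists>w\<in>W. cluster (X \<union> Y) u \<noteq> cluster (X \<union> Y) w) \<or>
          (\<exists>v\<in>?V. s * m \<le> card (cluster (X \<union> Y) v) \<and> cluster (X \<union> Y) v \<inter> W = {})"
        proof (cases "cluster (X \<union> Y) u \<inter> W = {} \<or> cluster (X \<union> Y) w \<inter> W = {}")
          case True
          then show ?thesis using uw s(2) order_trans by blast
        next
          case False
          then obtain a b where ab: "a \<in> W" "b \<in> W" "a \<in> cluster (X \<union> Y) u" "b \<in> cluster (X \<union> Y) w" by auto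
          have "cluster (X \<union> Y) a \<noteq> cluster (X \<union> Y) b"
            unfolding cluster_eq[OF ab(3)] cluster_eq[OF ab(4)] by (rule uw(5))
          then show ?thesis using ab by blast
        qed
      qed
      also have "\<dots> \<le> pprob ?E p2 (\<lambda>Y. \<exists>u\<in>W. \<exists>w\<in>W. cluster (X \<union> Y) u \<noteq> cluster (X \<union> Y) w) +
          pprob ?E p2 (\<lambda>Y. \<exists>v\<in>?V. s * m \<le> card (cluster (X \<union> Y) v) \<and> cluster (X \<union> Y) v \<inter> W = {})"
        by (intro pprob_disj p2)
      also have "\<dots> \<le> ((1 + x) ^ fact (n + 1) - 1) + fact (n + 1) * (2 * (2 / 3) ^ m)"
      proof (rule add_mono)
        show "pprob ?E p2 (\<lambda>Y. \<exists>u\<in>W. \<exists>w\<in>W. cluster (X \<union> Y) u \<noteq> cluster (X \<union> Y) w) \<le> (1 + x) ^ fact (n + 1) - 1"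
          by (rule merge_prob[OF X W_def D p2 n x])
        have "pprob ?E p2 (\<lambda>Y. \<exists>v\<in>?V. s * m \<le> card (cluster (X \<union> Y) v) \<and> cluster (X \<union> Y) v \<inter> W = {}) \<le>
          (\<Sum>v\<in>?V. pprob ?E p2 (\<lambda>Y. s * m \<le> card (cluster (X \<union> Y) v) \<and> cluster (X \<union> Y) v \<inter> W = {}))"
          by (intro pprob_ex p2) simp
        also have "\<dots> \<le> (\<Sum>v\<in>?V. 2 * (2 / 3) ^ m)"
          by (intro sum_mono stray_cluster_prob[OF X _ small s(1) p2 p2s]) (auto simp: W_def)
        finally show "pprob ?E p2 (\<lambda>Y. \<exists>v\<in>?V. s * m \<le> card (cluster (X \<union> Y) v) \<and> cluster (X \<union> Y) v \<inter> W = {})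
          \<le> fact (n + 1) * (2 * (2 / 3) ^ m)" by (simp only: sum_constant card_perm_verts of_nat_fact)
      qed
      finally have "pprob ?E p2 (\<lambda>Y. ?bad (X \<union> Y)) \<le> c" by (simp only: c_def)
      moreover have "0 \<le> (of_bool (?D X) + of_bool (?G X) :: real)" by simp
      ultimately show ?thesis by linarith
    qed
  qed (use p1 in auto)
  also have "\<dots> = pprob ?E p1 ?D + pprob ?E p1 ?G + c"
    unfolding pexp_add pexp_const[OF finite_perm_edges] ..
  finally show ?thesis unfolding c_def by linarith
qed

section \<open>Asymptotics\<close>

lemma ln_less_minus_one:
  fixes x :: real assumes "0 < x" "x \<noteq> 1" shows "ln x < x - 1"
  using ln_le_minus_one[OF assms(1)] ln_eq_minus_one[OF assms(1)] assms(2) by linarith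

text \<open>Limit of \<open>ln (lam * th ^ n)\<close> at \<open>lam = x\<close> when
  \<open>n p\<close> tends to \<open>c\<close>; for positive \<open>x\<close>,
  \<open>surv c x = 0\<close> is the fixed point equation
  \<open>x = exp (- c (1 - x))\<close>.\<close>

definition surv :: "real \<Rightarrow> real \<Rightarrow> real" where
  "surv c x = ln x + c * (1 - x)"

lemma surv_increasing:
  assumes "0 < x" "x < y" "y \<le> 1 / c" "0 < c"
  shows "surv c x < surv c y"
proof -
  have "ln (x / y) < x / y - 1" using assms by (intro ln_less_minus_one) auto
  then have "1 - x / y < ln y - ln x" using assms by (simp add: ln_div)
  moreover have "1 - x / y = (y - x) * (1 / y)" using assms by (simp add: field_simps)
  moreover have "(y - x) * c \<le> (y - x) * (1 / y)"
    using assms by (intro mult_left_mono) (auto simp: field_simps)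
  ultimately show ?thesis by (simp add: surv_def algebra_simps)
qed

lemma surv_decreasing:
  assumes "1 / c \<le> x" "x < y" "0 < c"
  shows "surv c y < surv c x"
proof -
  have x: "0 < x" using assms by (meson less_le_trans zero_less_divide_1_iff)
  then have y: "0 < y" using assms by simp
  have "ln (y / x) < y / x - 1" using assms x y by (intro ln_less_minus_one) auto
  then have "ln y - ln x < y / x - 1" using x y by (simp add: ln_div)
  moreover have "y / x - 1 = (y - x) * (1 / x)" using x by (simp add: field_simps)
  moreover have "(y - x) * (1 / x) \<le> (y - x) * c"
    using assms x by (intro mult_left_mono) (auto simp: field_simps)
  ultimately show ?thesis by (simp add: surv_def algebra_simps)
qed

text \<open>\<open>surv c\<close> increases up to \<open>1 / c\<close> and then decreases to
  \<open>surv c 1 = 0\<close>, so it has exactly one zero strictly between 0 and 1. With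
  \<open>x = 1 - g\<close> the equation defining \<open>gamma_const\<close> becomes
  \<open>surv c x = 0\<close>.\<close>

lemma gamma_const_props:
  assumes "1 < c"
  shows "0 < gamma_const c" "gamma_const c < 1"
    "\<And>x. 0 < x \<Longrightarrow> x < 1 - gamma_const c \<Longrightarrow> surv c x < 0"
    "\<And>x. 1 - gamma_const c < x \<Longrightarrow> x < 1 \<Longrightarrow> 0 < surv c x"
proof -
  have c: "0 < c" "1 / c < 1" using assms by auto
  have s1: "surv c 1 = 0" by (simp add: surv_def)
  have pos: "0 < surv c x" if "1 / c \<le> x" "x < 1" for x
    using surv_decreasing[OF that c(1)] s1 by simp
  \<comment> \<open>The value is \<open>- c * exp (- c)\<close>.\<close>
  have neg: "surv c (exp (- c)) < 0" using c by (simp add: surv_def algebra_simps)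
  have le: "exp (- c) \<le> 1 / c"
  proof -
    have "c \<le> exp c" using exp_ge_add_one_self[of c] by linarith
    then show ?thesis using c by (simp add: exp_minus field_simps)
  qed
  have "\<exists>x. exp (- c) \<le> x \<and> x \<le> 1 / c \<and> surv c x = 0"
  proof (rule IVT')
    show "continuous_on {exp (- c)..1 / c} (surv c)"
      unfolding surv_def[abs_def]
      by (intro continuous_intros) (use exp_gt_zero[of "- c"] in \<open>auto simp del: exp_gt_zero\<close>)
  qed (use neg pos[of "1 / c"] c le in auto)
  then obtain x0 where x0: "exp (- c) \<le> x0" "x0 \<le> 1 / c" "surv c x0 = 0" by auto
  have x0_pos: "0 < x0" using x0(1) exp_gt_zero[of "- c"] by linarith
  have lt: "x0 < 1 / c" using x0 pos[of "1 / c"] c by (cases "x0 = 1 / c") auto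
  have lt1: "x0 < 1" using lt c(2) by (rule less_trans)
  have below: "surv c x < 0" if "0 < x" "x < x0" for x
    using surv_increasing[OF that x0(2) c(1)] x0(3) by simp
  have above: "0 < surv c x" if "x0 < x" "x < 1" for x
  proof (cases "x \<le> 1 / c")
    case True
    then show ?thesis using surv_increasing[OF x0_pos that(1) True c(1)] x0(3) by simp
  qed (use pos[of x] that in auto)
  have iff: "g = 1 - exp (- c * g) \<longleftrightarrow> surv c (1 - g) = 0" if "g < 1" for g
  proof -
    have "surv c (1 - g) = 0 \<longleftrightarrow> ln (1 - g) = - c * g" by (auto simp: surv_def)
    also have "\<dots> \<longleftrightarrow> 1 - g = exp (- c * g)" using that
      by (metis exp_ln diff_gt_0_iff_gt ln_exp)
    finally show ?thesis by auto
  qed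
  have "gamma_const c = 1 - x0"
    unfolding gamma_const_def
  proof (rule the_equality)
    show "0 < 1 - x0 \<and> 1 - x0 < 1 \<and> 1 - x0 = 1 - exp (- c * (1 - x0))"
      using iff[of "1 - x0"] x0(3) x0_pos lt1 by auto
    fix g assume g: "0 < g \<and> g < 1 \<and> g = 1 - exp (- c * g)"
    then have "surv c (1 - g) = 0" using iff[of g] by simp
    then show "g = 1 - x0" using below[of "1 - g"] above[of "1 - g"] g by linarith
  qed
  then have x0_eq: "x0 = 1 - gamma_const c" by simp
  show "0 < gamma_const c" "gamma_const c < 1" using x0_eq x0_pos lt1 by auto
  show "\<And>x. 0 < x \<Longrightarrow> x < 1 - gamma_const c \<Longrightarrow> surv c x < 0"
    "\<And>x. 1 - gamma_const c < x \<Longrightarrow> x < 1 \<Longrightarrow> 0 < surv c x"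
    using below above x0_eq by auto
qed

lemma power_le_exp:
  fixes y :: real assumes "0 \<le> 1 - y" shows "(1 - y) ^ d \<le> exp (- (real d * y))"
proof -
  have "(1 - y) ^ d \<le> exp (- y) ^ d"
    using assms exp_ge_add_one_self[of "- y"] by (intro power_mono) auto
  also have "\<dots> = exp (real d * - y)" by (rule exp_of_nat_mult[symmetric])
  finally show ?thesis by simp
qed

lemma eventually_supercritical:
  fixes p :: "nat \<Rightarrow> real" and d :: "nat \<Rightarrow> nat"
  assumes lim: "(\<lambda>n. p n * real (d n)) \<longlonglongrightarrow> k" and p: "\<forall>\<^sub>F n in sequentially. 0 \<le> p n \<and> p n < 1"
    and lam: "0 < lam" "lam < 1" "0 < surv k lam"
  shows "\<exists>rho>1. \<forall>\<^sub>F n in sequentially. rho * (1 - p n * (1 - lam)) ^ d n \<le> lam"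
proof -
  \<comment> \<open>Half of the exponent is kept as slack for the passage to the limit.\<close>
  define rho where "rho = exp (surv k lam / 2)"
  have "1 < rho" using lam by (simp add: rho_def)
  have "(\<lambda>n. rho * exp (- (p n * real (d n) * (1 - lam)))) \<longlonglongrightarrow> rho * exp (- (k * (1 - lam)))"
    by (intro tendsto_intros lim)
  moreover have "rho * exp (- (k * (1 - lam))) < lam"
  proof -
    have "rho * exp (- (k * (1 - lam))) = exp (surv k lam / 2 - k * (1 - lam))"
      unfolding rho_def mult_exp_exp by simp
    also have "\<dots> < exp (ln lam)"
      using lam(3) by (subst exp_less_cancel_iff) (simp add: surv_def field_simps)
    finally show ?thesis using lam by simp
  qed
  ultimately have "\<forall>\<^sub>F n in sequentially. rho * exp (- (p n * real (d n) * (1 - lam))) < lam"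
    by (rule order_tendstoD)
  then have "\<forall>\<^sub>F n in sequentially. rho * (1 - p n * (1 - lam)) ^ d n \<le> lam"
    using p
  proof eventually_elim
    case (elim n)
    have "p n * (1 - lam) \<le> 1 * 1" using elim lam by (intro mult_mono) auto
    then have "(1 - p n * (1 - lam)) ^ d n \<le> exp (- (real (d n) * (p n * (1 - lam))))"
      by (intro power_le_exp) auto
    then have "rho * (1 - p n * (1 - lam)) ^ d n \<le> rho * exp (- (real (d n) * (p n * (1 - lam))))"
      using \<open>1 < rho\<close> by (intro mult_left_mono) auto
    with elim show ?case by (simp add: mult_ac)
  qed
  with \<open>1 < rho\<close> show ?thesis by blast
qed

lemma exists_surv_pos:
  assumes "1 < k" shows "\<exists>lam. 0 < lam \<and> lam < 1 \<and> 0 < surv k lam"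
proof -
  \<comment> \<open>Midpoint of \<open>1 / k\<close> and 1: \<open>surv k\<close> is decreasing
    there and vanishes at 1.\<close>
  have "surv k 1 < surv k ((1 / k + 1) / 2)"
    using assms by (intro surv_decreasing) (auto simp: field_simps)
  then show ?thesis using assms by (intro exI[of _ "(1 / k + 1) / 2"]) (auto simp: surv_def field_simps)
qed

section \<open>Bounds on the factorial and on the number of edges\<close>

lemma fact_upper: "\<forall>\<^sub>F n in sequentially. fact (n + 1) \<le> exp (2 * (real n * ln (real n)))"
proof -
  have "\<forall>\<^sub>F n in sequentially. (real n + 1) * ln (real n + 1) \<le> 2 * (real n * ln (real n))" by real_asymp
  then show ?thesis
  proof eventually_elim
    case (elim n)
    have "fact (n + 1) \<le> (of_nat ((n + 1) ^ (n + 1)) :: real)" by (rule fact_le_power)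
    also have "\<dots> = (real n + 1) ^ (n + 1)" by (simp add: algebra_simps)
    also have "\<dots> = exp (ln (real n + 1)) ^ (n + 1)" by simp
    also have "\<dots> = exp (real (n + 1) * ln (real n + 1))" by (rule exp_of_nat_mult[symmetric])
    also have "\<dots> \<le> exp (2 * (real n * ln (real n)))" using elim by (simp add: add.commute)
    finally show ?case .
  qed
qed

lemma fact_lower: "\<forall>\<^sub>F n in sequentially. exp (real n * ln (real n) / 2) \<le> (fact (n + 1) :: real)"
proof -
  have "\<forall>\<^sub>F n in sequentially. real n * ln (real n) / 2 \<le> real n * ln (real n) - real n" by real_asymp
  then show ?thesis using eventually_gt_at_top[of 0]
  proof eventually_elim
    case (elim n)
    have s: "(\<lambda>k. real n ^ k / fact k) sums exp (real n)"
      using exp_converges[of "real n"] by (simp add: divide_inverse mult.commute)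
    \<comment> \<open>\<open>n^n / n!\<close> is a single term of the series of
      \<open>exp n\<close>.\<close>
    have "(\<Sum>k\<in>{n}. real n ^ k / fact k) \<le> (\<Sum>k. real n ^ k / fact k)"
      by (rule sum_le_suminf) (use s sums_summable in auto)
    then have "real n ^ n / fact n \<le> exp (real n)" using s sums_unique by force
    then have "real n ^ n / exp (real n) \<le> fact n" by (simp add: field_simps)
    moreover have "real n ^ n = exp (real n * ln (real n))"
      using elim by (simp add: exp_of_nat_mult)
    ultimately have "exp (real n * ln (real n) - real n) \<le> fact n" by (simp add: exp_diff)
    also have "\<dots> \<le> (fact (n + 1) :: real)" by (rule fact_mono) simp
    finally show ?case using elim by (meson exp_le_cancel_iff order_trans)
  qed
qed

lemma card_perm_edges_le: "card (perm_edges n) \<le> n * fact (n + 1)"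
proof -
  have "perm_edges n \<subseteq> touch (\<lambda>x. x) (perm_edges n) (perm_verts n)"
    by (auto simp: touch_def perm_edges_def)
  then have "card (perm_edges n) \<le> card (touch (\<lambda>x. x) (perm_edges n) (perm_verts n))"
    by (intro card_mono) auto
  also have "\<dots> \<le> card {1..n} * card (perm_verts n)"
    unfolding perm_edges_eq by (intro card_touch_swap_le) auto
  finally show ?thesis by (simp add: card_perm_verts del: fact_Suc)
qed

lemma power_ge_exp:
  fixes rho :: real assumes "1 < rho" "t \<le> real m" shows "exp (t * ln rho) \<le> rho ^ m"
proof -
  have "rho ^ m = exp (real m * ln rho)" using assms by (simp add: exp_of_nat_mult)
  then show ?thesis using assms by (simp add: mult_right_mono)
qed

lemma exp_mult_le_imp:
  fixes x y z :: real assumes "exp x * y \<le> z" shows "y \<le> z * exp (- x)"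
  using assms by (simp add: exp_minus pos_le_divide_eq mult.commute[of y] flip: divide_inverse)

lemma pprob_tendsto_0:
  assumes "\<forall>\<^sub>F n in sequentially. 0 \<le> p n \<and> p n < 1"
    "\<forall>\<^sub>F n in sequentially. pprob (U n) (p n) (Q n) \<le> f n" "f \<longlonglongrightarrow> 0"
  shows "(\<lambda>n. pprob (U n) (p n) (Q n)) \<longlonglongrightarrow> 0"
proof (rule tendsto_sandwich[OF _ assms(2) tendsto_const assms(3)])
  show "\<forall>\<^sub>F n in sequentially. 0 \<le> pprob (U n) (p n) (Q n)"
    using assms(1) by eventually_elim (auto intro: pexp_nonneg)
qed

lemma pprob_ex_vertex:
  assumes "0 \<le> p" "p \<le> 1" "\<And>v. v \<in> perm_verts n \<Longrightarrow> pprob (perm_edges n) p (Q v) \<le> a"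
  shows "pprob (perm_edges n) p (\<lambda>R. \<exists>v\<in>perm_verts n. Q v R) \<le> fact (n + 1) * a"
proof -
  have "pprob (perm_edges n) p (\<lambda>R. \<exists>v\<in>perm_verts n. Q v R) \<le>
      (\<Sum>v\<in>perm_verts n. pprob (perm_edges n) p (Q v))"
    by (intro pprob_ex assms) simp
  also have "\<dots> \<le> (\<Sum>v\<in>perm_verts n. a)" by (intro sum_mono assms)
  finally show ?thesis by (simp only: sum_constant card_perm_verts of_nat_fact)
qed

lemma eventually_edge_prob:
  assumes "0 < c" shows "\<forall>\<^sub>F n in sequentially. 0 \<le> c / real n \<and> c / real n < 1"
proof (rule eventually_conj)
  show "\<forall>\<^sub>F n in sequentially. c / real n < 1" using assms by real_asymp
qed (use assms in simp)

section \<open>Subcritical clusters\<close>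

lemma subcritical_clusters:
  assumes "0 < c" "c < 1"
  shows "\<exists>b>0. (\<lambda>n. pprob (perm_edges n) (c / real n)
    (\<lambda>R. \<exists>v\<in>perm_verts n. b * (real n * ln (real n)) < real (card (cluster R v)))) \<longlonglongrightarrow> 0"
proof -
  \<comment> \<open>\<open>lam = 1 / c\<close> maximises \<open>surv c\<close>, and
    \<open>rho\<close> is the exponential of the maximum.\<close>
  define rho where "rho = 1 / c * exp (c - 1)"
  have lnr: "ln rho = c - 1 - ln c" using assms by (simp add: rho_def ln_mult ln_div)
  then have "0 < ln rho" using ln_less_minus_one[of c] assms by simp
  then have rho: "1 < rho" using assms by (simp add: rho_def ln_gt_zero_iff)
  \<comment> \<open>Makes \<open>rho ^ m\<close> at least \<open>exp (3 n ln n)\<close>, against the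
    \<open>exp (2 n ln n)\<close> lost in the union bound over vertices.\<close>
  define b where "b = 3 / ln rho"
  have b: "0 < b" "b * ln rho = 3" using \<open>0 < ln rho\<close> by (auto simp: b_def)
  have "(\<lambda>n. pprob (perm_edges n) (c / real n)
    (\<lambda>R. \<exists>v\<in>perm_verts n. b * (real n * ln (real n)) < real (card (cluster R v)))) \<longlonglongrightarrow> 0"
  proof (rule pprob_tendsto_0[OF eventually_edge_prob[OF assms(1)]])
    show "(\<lambda>n. exp (2 * (real n * ln (real n))) * (1 / c * exp (- (3 * (real n * ln (real n)))))) \<longlonglongrightarrow> 0"
      using assms(1) by real_asymp
    show "\<forall>\<^sub>F n in sequentially. pprob (perm_edges n) (c / real n)
      (\<lambda>R. \<exists>v\<in>perm_verts n. b * (real n * ln (real n)) < real (card (cluster R v)))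
      \<le> exp (2 * (real n * ln (real n))) * (1 / c * exp (- (3 * (real n * ln (real n)))))"
      using eventually_edge_prob[OF assms(1)] fact_upper eventually_gt_at_top[of 0]
    proof eventually_elim
      case (elim n)
      let ?p = "c / real n" and ?t = "real n * ln (real n)"
      define m where "m = nat \<lceil>b * ?t\<rceil>"
      have tm: "b * ?t \<le> real m" by (simp add: m_def real_nat_ceiling_ge)
      have "pprob (perm_edges n) ?p (\<lambda>R. b * ?t < real (card (cluster R v))) \<le> 1 / c * exp (- (3 * ?t))" for v
      proof -
        have "rho ^ m * pprob (perm_edges n) ?p (\<lambda>R. m \<le> card (cluster R v)) \<le> 1 / c"
        proof (rule cluster_tail_subcritical[OF graph_perm_edges, where D = n])
          fix R assume "R \<subseteq> perm_edges n"
          then show "card (touch (\<lambda>x. x) (perm_edges n) (cluster R v)) \<le> n * card (cluster R v)"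
            using card_touch_swap_le[of "{1..n}" n "cluster R v"] perm_cluster_finite by (simp add: perm_edges_eq)
        next
          have "1 + ?p * (1 / c - 1) = 1 - - ((1 - c) / real n)" using assms elim by (simp add: field_simps)
          moreover have "(1 - - ((1 - c) / real n)) ^ n \<le> exp (- (real n * - ((1 - c) / real n)))"
            using assms by (intro power_le_exp) simp
          ultimately have "(1 + ?p * (1 / c - 1)) ^ n \<le> exp (1 - c)" using elim by simp
          then have "rho * (1 + ?p * (1 / c - 1)) ^ n \<le> rho * exp (1 - c)"
            using rho by (intro mult_left_mono) auto
          also have "\<dots> = 1 / c" by (simp add: rho_def mult_exp_exp)
          finally show "rho * (1 + ?p * (1 / c - 1)) ^ n \<le> 1 / c" .
        qed (use elim assms rho in auto)
        moreover have "exp (3 * ?t) \<le> rho ^ m"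
        proof -
          have "b * ?t * ln rho = 3 * ?t" unfolding b(2)[symmetric] by (simp only: mult_ac)
          then show ?thesis using power_ge_exp[OF rho tm] by (simp only:)
        qed
        moreover have "0 \<le> pprob (perm_edges n) ?p (\<lambda>R. m \<le> card (cluster R v))"
          using elim by (intro pexp_nonneg) auto
        ultimately have "exp (3 * ?t) * pprob (perm_edges n) ?p (\<lambda>R. m \<le> card (cluster R v)) \<le> 1 / c"
          by (meson mult_right_mono order_trans)
        then have "pprob (perm_edges n) ?p (\<lambda>R. m \<le> card (cluster R v)) \<le> 1 / c * exp (- (3 * ?t))"
          by (rule exp_mult_le_imp)
        moreover have "pprob (perm_edges n) ?p (\<lambda>R. b * ?t < real (card (cluster R v)))
            \<le> pprob (perm_edges n) ?p (\<lambda>R. m \<le> card (cluster R v))"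
          using elim by (intro pprob_mono) (auto simp: m_def intro: nat_ceiling_le_eq[THEN iffD2])
        ultimately show ?thesis by linarith
      qed
      then have "pprob (perm_edges n) ?p (\<lambda>R. \<exists>v\<in>perm_verts n. b * ?t < real (card (cluster R v)))
          \<le> fact (n + 1) * (1 / c * exp (- (3 * ?t)))"
        using elim by (intro pprob_ex_vertex) auto
      also have "\<dots> \<le> exp (2 * ?t) * (1 / c * exp (- (3 * ?t)))"
        using elim assms(1) by (intro mult_right_mono) auto
      finally show ?case .
    qed
  qed
  with b show ?thesis by blast
qed

section \<open>Counting vertices by the order of their cluster\<close>

definition cluster_count :: "nat \<Rightarrow> (nat \<Rightarrow> bool) \<Rightarrow> (nat \<Rightarrow> nat) set set \<Rightarrow> real" where
  "cluster_count n Q R = real (card {v \<in> perm_verts n. Q (card (cluster R v))})"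

lemma pexp_cluster_count:
  "pexp (perm_edges n) p (cluster_count n Q) = (\<Sum>v\<in>perm_verts n. pprob (perm_edges n) p (\<lambda>R. Q (card (cluster R v))))"
proof -
  have "cluster_count n Q = (\<lambda>R. \<Sum>v\<in>perm_verts n. of_bool (Q (card (cluster R v))))"
    by (auto simp: cluster_count_def fun_eq_iff of_bool_def sum.If_cases Int_def)
  then show ?thesis by (simp only: pexp_sum)
qed

lemma cluster_count_concentration:
  assumes "0 \<le> p" "p \<le> 1" "0 < t" "\<And>s. Q s \<Longrightarrow> s \<le> B"
  shows "pprob (perm_edges n) p (\<lambda>R. t \<le> \<bar>cluster_count n Q R - pexp (perm_edges n) p (cluster_count n Q)\<bar>)
    \<le> real n * fact (n + 1) * (p * (2 * real B)\<^sup>2) / t\<^sup>2"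
proof -
  have "pprob (perm_edges n) p (\<lambda>R. t \<le> \<bar>cluster_count n Q R - pexp (perm_edges n) p (cluster_count n Q)\<bar>)
    \<le> real (card (perm_edges n)) * (p * (2 * real B)\<^sup>2) / t\<^sup>2"
  proof (rule chebyshev_pexp[OF finite_perm_edges assms(1-3)])
    fix e R assume e: "e \<in> perm_edges n" "R \<subseteq> perm_edges n"
    then obtain x y where "e = {x, y}" using graph_perm_edges unfolding graph_edges_def by meson
    then show "\<bar>cluster_count n Q (insert e R) - cluster_count n Q R\<bar> \<le> 2 * real B"
      unfolding cluster_count_def using assms(4) perm_cluster_finite[OF e(2)]
      by (intro cluster_count_lipschitz) auto
  qed
  also have "\<dots> \<le> real n * fact (n + 1) * (p * (2 * real B)\<^sup>2) / t\<^sup>2"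
  proof -
    have "real (card (perm_edges n)) \<le> real (n * fact (n + 1))"
      using card_perm_edges_le by (simp only: of_nat_le_iff)
    then have "real (card (perm_edges n)) \<le> real n * fact (n + 1)" by (simp only: of_nat_mult of_nat_fact)
    then show ?thesis using assms by (intro divide_right_mono mult_right_mono) auto
  qed
  finally show ?thesis .
qed

text \<open>Staged exploration from one vertex: each of the sizes 1 to \<open>k - 1\<close> needs a
  successful stage of \<open>h\<close> candidates, and at most \<open>n * k\<close> edges have to be
  closed at the end.\<close>

lemma cluster_exact_size_lower:
  assumes v: "v \<in> perm_verts n" and p: "0 \<le> p" "p \<le> 1" and k: "2 \<le> k"
    and h: "real h + 3 * ln (real k) \<le> real n"
  shows "(1 - (1 - p) ^ h) ^ (k - 1) * (1 - p) ^ (n * k) \<le> pprob (perm_edges n) p (\<lambda>R. card (cluster R v) = k)"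
proof -
  let ?E = "perm_edges n"
  have iso: "h * card T \<le> card (bnd (\<lambda>x. x) ?E T)" if "T \<subseteq> perm_verts n" "0 < card T" "card T < k" for T
    unfolding perm_edges_eq using that h by (intro bnd_ge_of_small[where M = k]) auto
  have "h \<le> card (bnd (\<lambda>x. x) ?E {v})" using iso[of "{v}"] v k by simp
  then obtain F where F: "F \<subseteq> bnd (\<lambda>x. x) ?E {v}" "card F = h" by (meson obtain_subset_with_card_n)
  have "(1 - (1 - p) ^ card F) * ((1 - (1 - p) ^ h) ^ (k - card {v} - 1) * (1 - p) ^ (n * k))
    \<le> pprob ?E p (\<lambda>R. card (cluster R v) = k)"
  proof (rule staged_exploration[OF graph_perm_edges p, where V = "perm_verts n"])
    show "(\<lambda>x. x) ` e \<subseteq> perm_verts n" if "e \<in> ?E" for e using perm_edges_verts[of ?E n] that by auto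
    fix T assume T: "T \<subseteq> perm_verts n" "finite T"
    show "card (touch (\<lambda>x. x) ?E T) \<le> n * k" if "card T = k"
      using card_touch_swap_le[of "{1..n}" n T] T that by (simp add: perm_edges_eq)
    assume "{v} \<subseteq> T" "card {v} < card T" "card T < k"
    then have "h * card T \<le> card (bnd (\<lambda>x. x) ?E T)" using T by (intro iso) auto
    moreover have "h * (card T - card {v}) + card F = h * card T"
      using \<open>card {v} < card T\<close> F(2) by (simp add: diff_mult_distrib2)
    ultimately show "h * (card T - card {v}) + card F \<le> card (bnd (\<lambda>x. x) ?E T)" by simp
  qed (use v k F in auto)
  moreover have "(1 - (1 - p) ^ h) ^ (k - 1) = (1 - (1 - p) ^ h) * (1 - (1 - p) ^ h) ^ (k - card {v} - 1)"
    using k by (cases k) (auto simp: power_Suc[symmetric] Suc_diff_le simp del: power_Suc)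
  ultimately show ?thesis using F(2) by (simp only: mult.assoc)
qed

text \<open>Prescribing the order exactly keeps the Lipschitz constant of the vertex count
  polynomial. With \<open>N = (n + 1)!\<close> the mean is at least \<open>N exp (- C0 k)\<close>,
  so by Chebyshev the count vanishes with probability at most \<open>exp (2 C0 k) / N\<close> up to
  polynomial factors.\<close>

lemma exact_size_cluster_exists:
  assumes c: "0 < c"
  shows "\<exists>a k. 0 < a \<and> (\<forall>\<^sub>F n in sequentially. a * (real n * ln (real n)) \<le> real (k n) \<and> k n \<le> n\<^sup>2) \<and>
    (\<lambda>n. pprob (perm_edges n) (c / real n) (\<lambda>R. \<not> (\<exists>v\<in>perm_verts n. card (cluster R v) = k n))) \<longlonglongrightarrow> 0"
proof -
  \<comment> \<open>Lower bound for the success of a stage with \<open>h = n div 2\<close>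
    candidates, using \<open>h \<ge> n / 3\<close>.\<close>
  define q0 where "q0 = 1 - exp (- c / 3)"
  have q0: "0 < q0" "q0 < 1" using c by (auto simp: q0_def)
  \<comment> \<open>Cost per vertex: \<open>- ln q0\<close> for its stage and \<open>2 c\<close> for
    closing the edges at it.\<close>
  define C0 where "C0 = 2 * c - ln q0"
  have "ln q0 < 0" using q0 by simp
  then have C0: "0 < C0" using c by (simp add: C0_def)
  \<comment> \<open>Gives \<open>2 C0 k \<le> 2 C0 + n ln n / 8\<close>, safely below the exponent
    \<open>n ln n / 2\<close> of \<open>fact_lower\<close>.\<close>
  define a where "a = 1 / (16 * C0)"
  have a: "0 < a" using C0 by (simp add: a_def)
  define k where "k = (\<lambda>n::nat. nat \<lceil>a * (real n * ln (real n))\<rceil>)"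
  have ak: "a * (real n * ln (real n)) \<le> real (k n)" for n
    by (simp add: k_def real_nat_ceiling_ge)
  have e1: "\<forall>\<^sub>F n in sequentially. c / real n \<le> 1 / 2" using c by real_asymp
  have e2: "\<forall>\<^sub>F n in sequentially. 2 \<le> a * (real n * ln (real n))" using a by real_asymp
  have e3: "\<forall>\<^sub>F n in sequentially. a * (real n * ln (real n)) + 1 \<le> real n ^ 2" using a by real_asymp
  have e4: "\<forall>\<^sub>F n in sequentially. real n / 2 + 3 * ln (real n ^ 2) \<le> real n" by real_asymp
  have kb: "\<forall>\<^sub>F n in sequentially. 2 \<le> k n \<and> k n \<le> n\<^sup>2 \<and> real (k n) \<le> a * (real n * ln (real n)) + 1"
    using e2 e3
  proof eventually_elim
    case (elim n)
    have "2 \<le> real (k n)" using ak[of n] elim by linarith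
    moreover have le: "real (k n) \<le> a * (real n * ln (real n)) + 1"
      using elim(1) of_int_ceiling_le_add_one[of "a * (real n * ln (real n))"] by (simp add: k_def)
    moreover have "real (k n) \<le> real (n\<^sup>2)" using le elim(2) by (simp only: of_nat_power)
    ultimately show ?case by (simp only: of_nat_le_iff) simp
  qed
  have "(\<lambda>n. pprob (perm_edges n) (c / real n) (\<lambda>R. \<not> (\<exists>v\<in>perm_verts n. card (cluster R v) = k n))) \<longlonglongrightarrow> 0"
  proof (rule pprob_tendsto_0[OF eventually_edge_prob[OF c]])
    show "(\<lambda>n. 4 * c * (real n ^ 2)\<^sup>2 * exp (2 * C0 + real n * ln (real n) / 8 - real n * ln (real n) / 2)) \<longlonglongrightarrow> 0"
      using c by real_asymp
    show "\<forall>\<^sub>F n in sequentially. pprob (perm_edges n) (c / real n) (\<lambda>R. \<not> (\<exists>v\<in>perm_verts n. card (cluster R v) = k n))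
      \<le> 4 * c * (real n ^ 2)\<^sup>2 * exp (2 * C0 + real n * ln (real n) / 8 - real n * ln (real n) / 2)"
      using e1 e4 kb fact_lower eventually_ge_at_top[of 3]
    proof eventually_elim
      case (elim n)
      let ?p = "c / real n" and ?E = "perm_edges n" and ?k = "k n" and ?N = "fact (n + 1) :: real"
      define h where "h = n div 2"
      have p: "0 \<le> ?p" "?p \<le> 1" using c elim by (auto intro: order_trans)
      have n: "0 < real n" using elim by simp
      have h1: "real n / 3 \<le> real h" "real h \<le> real n / 2"
        using elim(5) by (auto simp: h_def real_of_nat_div)
      have "ln (real ?k) \<le> ln (real n ^ 2)"
      proof -
        have "real ?k \<le> real (n\<^sup>2)" using elim(3) by (simp only: of_nat_le_iff)
        then have "real ?k \<le> real n ^ 2" by (simp only: of_nat_power)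
        moreover have "0 < real ?k" using elim(3) by simp
        ultimately show ?thesis using n by (subst ln_le_cancel_iff) auto
      qed
      then have h2: "real h + 3 * ln (real ?k) \<le> real n" using h1 elim(2) by linarith
      have q: "q0 \<le> 1 - (1 - ?p) ^ h"
      proof -
        have "(1 - ?p) ^ h \<le> exp (- (real h * ?p))" using p by (intro power_le_exp) simp
        also have "\<dots> \<le> exp (- c / 3)"
        proof -
          have "real n / 3 * ?p \<le> real h * ?p" using h1 p by (intro mult_right_mono) auto
          then show ?thesis using n by simp
        qed
        finally show ?thesis by (simp add: q0_def)
      qed
      have r: "exp (- (2 * c)) \<le> (1 - ?p) ^ n"
      proof -
        have "- ?p - 2 * ?p\<^sup>2 \<le> ln (1 - ?p)"
          using p elim(1) by (intro ln_one_minus_pos_lower_bound) auto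
        moreover have "2 * ?p\<^sup>2 \<le> ?p"
          using mult_left_mono[OF elim(1) p(1)] by (simp add: power2_eq_square)
        ultimately have "- (2 * ?p) \<le> ln (1 - ?p)" by linarith
        then have "exp (- (2 * ?p)) \<le> exp (ln (1 - ?p))" by (subst exp_le_cancel_iff)
        then have "exp (- (2 * ?p)) \<le> 1 - ?p" using elim(1) by simp
        then have "exp (- (2 * ?p)) ^ n \<le> (1 - ?p) ^ n" by (intro power_mono) auto
        moreover have "exp (- (2 * ?p)) ^ n = exp (- (2 * c))"
          unfolding exp_of_nat_mult[symmetric] using n by simp
        ultimately show ?thesis by simp
      qed
      have P: "exp (- (C0 * real ?k)) \<le> pprob ?E ?p (\<lambda>R. card (cluster R v) = ?k)" if v: "v \<in> perm_verts n" for v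
      proof -
        have "exp (- (C0 * real ?k)) = exp (real ?k * (ln q0 - 2 * c))" by (simp add: C0_def algebra_simps)
        also have "\<dots> = (q0 * exp (- (2 * c))) ^ ?k"
          unfolding exp_of_nat_mult using q0 by (simp add: exp_diff exp_minus divide_inverse)
        also have "\<dots> = q0 ^ ?k * exp (- (2 * c)) ^ ?k" by (rule power_mult_distrib)
        also have "\<dots> \<le> (1 - (1 - ?p) ^ h) ^ (?k - 1) * ((1 - ?p) ^ n) ^ ?k"
        proof (rule mult_mono)
          have "q0 ^ ?k \<le> q0 ^ (?k - 1)" using q0 by (intro power_decreasing) auto
          also have "\<dots> \<le> (1 - (1 - ?p) ^ h) ^ (?k - 1)" using q q0 by (intro power_mono) auto
          finally show "q0 ^ ?k \<le> (1 - (1 - ?p) ^ h) ^ (?k - 1)" .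
          show "exp (- (2 * c)) ^ ?k \<le> ((1 - ?p) ^ n) ^ ?k" using r by (intro power_mono) auto
          show "0 \<le> (1 - (1 - ?p) ^ h) ^ (?k - 1)" using q q0 by simp
        qed simp
        also have "\<dots> = (1 - (1 - ?p) ^ h) ^ (?k - 1) * (1 - ?p) ^ (n * ?k)" by (simp only: power_mult)
        also have "\<dots> \<le> pprob ?E ?p (\<lambda>R. card (cluster R v) = ?k)"
          using elim(3) by (intro cluster_exact_size_lower[OF v p _ h2]) simp
        finally show ?thesis .
      qed
      define Q where "Q = (\<lambda>s. s = ?k)"
      define t where "t = pexp ?E ?p (cluster_count n Q)"
      define u where "u = ?N * exp (- (C0 * real ?k))"
      have N: "0 < ?N" by simp
      have "(\<Sum>v\<in>perm_verts n. exp (- (C0 * real ?k))) \<le> t"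
        unfolding t_def pexp_cluster_count Q_def using P by (intro sum_mono) auto
      then have ut: "u \<le> t" by (simp only: sum_constant card_perm_verts of_nat_fact u_def)
      have u: "0 < u" by (simp add: u_def)
      \<comment> \<open>Without such a cluster the count is 0, a deviation by its full mean
        \<open>t\<close>.\<close>
      have "pprob ?E ?p (\<lambda>R. \<not> (\<exists>v\<in>perm_verts n. card (cluster R v) = ?k)) \<le>
          pprob ?E ?p (\<lambda>R. t \<le> \<bar>cluster_count n Q R - t\<bar>)"
      proof (intro pprob_mono p)
        fix R assume "\<not> (\<exists>v\<in>perm_verts n. card (cluster R v) = ?k)"
        then have "{v \<in> perm_verts n. Q (card (cluster R v))} = {}" by (auto simp: Q_def)
        then have "cluster_count n Q R = 0" unfolding cluster_count_def by (simp only: card.empty of_nat_0)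
        then show "t \<le> \<bar>cluster_count n Q R - t\<bar>" by simp
      qed
      also have "\<dots> \<le> real n * ?N * (?p * (2 * real ?k)\<^sup>2) / t\<^sup>2"
        unfolding t_def
        by (rule cluster_count_concentration[OF p]) (use ut u in \<open>auto simp: Q_def t_def\<close>)
      also have "\<dots> \<le> real n * ?N * (?p * (2 * real ?k)\<^sup>2) / u\<^sup>2"
        using ut u p by (intro divide_left_mono power_mono mult_nonneg_nonneg mult_pos_pos zero_less_power) auto
      also have "\<dots> = 4 * c * (real ?k)\<^sup>2 * exp (2 * (C0 * real ?k)) / ?N"
      proof -
        have "u\<^sup>2 = ?N * (?N * exp (- (2 * (C0 * real ?k))))"
          by (simp add: u_def power2_eq_square mult_exp_exp mult_ac del: fact_Suc)
        moreover have "real n * ?N * (?p * (2 * real ?k)\<^sup>2) = ?N * (4 * c * (real ?k)\<^sup>2)"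
          using n by (simp add: power2_eq_square del: fact_Suc)
        ultimately have "real n * ?N * (?p * (2 * real ?k)\<^sup>2) / u\<^sup>2 =
            4 * c * (real ?k)\<^sup>2 / (?N * exp (- (2 * (C0 * real ?k))))"
          by (simp del: fact_Suc)
        also have "\<dots> = 4 * c * (real ?k)\<^sup>2 * exp (2 * (C0 * real ?k)) / ?N"
          by (simp add: exp_minus divide_inverse del: fact_Suc)
        finally show ?thesis .
      qed
      also have "\<dots> \<le> 4 * c * (real n ^ 2)\<^sup>2 * exp (2 * C0 + real n * ln (real n) / 8) / exp (real n * ln (real n) / 2)"
      proof (rule frac_le)
        have "real ?k \<le> real (n\<^sup>2)" using elim(3) by (simp only: of_nat_le_iff)
        then have "(real ?k)\<^sup>2 \<le> (real n ^ 2)\<^sup>2" by (intro power_mono) auto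
        moreover have "2 * (C0 * real ?k) \<le> 2 * C0 + real n * ln (real n) / 8"
        proof -
          have "C0 * real ?k \<le> C0 * (a * (real n * ln (real n)) + 1)"
            using elim(3) C0 by (intro mult_left_mono) auto
          also have "\<dots> = (C0 * a) * (real n * ln (real n)) + C0" by (simp add: algebra_simps)
          also have "C0 * a = 1 / 16" using C0 by (simp add: a_def)
          finally show ?thesis by simp
        qed
        ultimately show "4 * c * (real ?k)\<^sup>2 * exp (2 * (C0 * real ?k)) \<le>
            4 * c * (real n ^ 2)\<^sup>2 * exp (2 * C0 + real n * ln (real n) / 8)"
          using c by (intro mult_mono mult_nonneg_nonneg) auto
        show "exp (real n * ln (real n) / 2) \<le> ?N" by (rule elim(4))
      qed (use c in auto)
      also have "\<dots> = 4 * c * (real n ^ 2)\<^sup>2 * exp (2 * C0 + real n * ln (real n) / 8 - real n * ln (real n) / 2)"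
        by (simp only: exp_diff times_divide_eq_right)
      finally show ?case .
    qed
  qed
  moreover have "\<forall>\<^sub>F n in sequentially. a * (real n * ln (real n)) \<le> real (k n) \<and> k n \<le> n\<^sup>2"
    using kb by eventually_elim (use ak in auto)
  ultimately show ?thesis using a by blast
qed

section \<open>Absence of intermediate clusters\<close>

lemma tendsto_mult_ratio:
  fixes p :: "nat \<Rightarrow> real" and d :: "nat \<Rightarrow> nat"
  assumes "(\<lambda>n. p n * real n) \<longlonglongrightarrow> c" "(\<lambda>n. real (d n) / real n) \<longlonglongrightarrow> r"
  shows "(\<lambda>n. p n * real (d n)) \<longlonglongrightarrow> c * r"
proof (rule Lim_transform_eventually[OF tendsto_mult[OF assms]])
  show "\<forall>\<^sub>F n in sequentially. p n * real n * (real (d n) / real n) = p n * real (d n)"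
    using eventually_gt_at_top[of 0] by eventually_elim simp
qed

text \<open>In the merging bound, five sprinkled edges of probability \<open>n^-4\<close> give
  \<open>n^-20\<close>, multiplied by \<open>n^30 / (80 n^3 (n + 1))\<close>: an exponent of order
  \<open>n^6\<close>, far above \<open>n log n\<close>. Local isoperimetry at this order still loses
  only \<open>3 ln (n^30) = 90 ln n\<close> directions.\<close>

definition large_size :: "nat \<Rightarrow> nat" where
  "large_size n = n ^ 30"

lemma ln_large_size: "0 < n \<Longrightarrow> ln (real (large_size n)) = 30 * ln (real n)"
  by (simp add: large_size_def ln_realpow)

text \<open>The sequence \<open>p\<close> is general because the first round of the sprinkling has a
  probability that is only asymptotically \<open>c / n\<close>.\<close>

lemma eventually_supercritical_perm:
  assumes lim: "(\<lambda>n. p n * real n) \<longlonglongrightarrow> c" and p: "\<forall>\<^sub>F n in sequentially. 0 \<le> p n \<and> p n < 1"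
    and lam: "0 < lam" "lam < 1" "0 < surv c lam"
  shows "\<exists>rho>1. \<forall>\<^sub>F n in sequentially. \<forall>v\<in>perm_verts n. \<forall>m.
    rho ^ m * pprob (perm_edges n) (p n) (\<lambda>R. m \<le> card (cluster R v) \<and> card (cluster R v) < large_size n) \<le> lam"
proof -
  define d where "d = (\<lambda>n::nat. nat \<lfloor>real n - 90 * ln (real n)\<rfloor>)"
  have "(\<lambda>n. real (d n) / real n) \<longlonglongrightarrow> 1" unfolding d_def by real_asymp
  from tendsto_mult_ratio[OF lim this] have "(\<lambda>n. p n * real (d n)) \<longlonglongrightarrow> c" by simp
  then obtain rho where rho: "1 < rho" "\<forall>\<^sub>F n in sequentially. rho * (1 - p n * (1 - lam)) ^ d n \<le> lam"
    using eventually_supercritical[OF _ p lam] by blast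
  have "\<forall>\<^sub>F n in sequentially. 0 \<le> real n - 90 * ln (real n)" by real_asymp
  with rho(2) p eventually_gt_at_top[of 0] have "\<forall>\<^sub>F n in sequentially. \<forall>v\<in>perm_verts n. \<forall>m.
    rho ^ m * pprob (perm_edges n) (p n) (\<lambda>R. m \<le> card (cluster R v) \<and> card (cluster R v) < large_size n) \<le> lam"
  proof eventually_elim
    case (elim n)
    have "real (d n) \<le> real n - 90 * ln (real n)" using elim(4) by (simp add: d_def)
    then have "real (d n) + 3 * ln (real (large_size n)) \<le> real n" using elim(3) by (simp add: ln_large_size)
    then show ?case using elim(1,2) rho(1) lam
      by (intro ballI allI perm_cluster_gap[where d = "d n"]) auto
  qed
  with rho(1) show ?thesis by blast
qed

text \<open>The cutoff \<open>m\<close> stays free: it becomes \<open>n^2\<close> in the sprinkling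
  and a multiple of \<open>n ln n\<close> for the second-largest cluster.\<close>

lemma supercritical_gap:
  assumes lim: "(\<lambda>n. p n * real n) \<longlonglongrightarrow> c" and p: "\<forall>\<^sub>F n in sequentially. 0 \<le> p n \<and> p n < 1"
    and c: "1 < c"
  shows "\<exists>rho>1. \<forall>\<^sub>F n in sequentially. \<forall>m.
    pprob (perm_edges n) (p n) (\<lambda>R. \<exists>v\<in>perm_verts n. m \<le> card (cluster R v) \<and> card (cluster R v) < large_size n)
      \<le> exp (2 * (real n * ln (real n))) * (1 / rho) ^ m"
proof -
  obtain lam where lam: "0 < lam" "lam < 1" "0 < surv c lam" using exists_surv_pos[OF c] by auto
  obtain rho where rho: "1 < rho" "\<forall>\<^sub>F n in sequentially. \<forall>v\<in>perm_verts n. \<forall>m.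
    rho ^ m * pprob (perm_edges n) (p n) (\<lambda>R. m \<le> card (cluster R v) \<and> card (cluster R v) < large_size n) \<le> lam"
    using eventually_supercritical_perm[OF lim p lam] by blast
  from rho(2) p fact_upper have "\<forall>\<^sub>F n in sequentially. \<forall>m.
    pprob (perm_edges n) (p n) (\<lambda>R. \<exists>v\<in>perm_verts n. m \<le> card (cluster R v) \<and> card (cluster R v) < large_size n)
      \<le> exp (2 * (real n * ln (real n))) * (1 / rho) ^ m"
  proof eventually_elim
    case (elim n)
    show ?case
    proof
      fix m
      have "pprob (perm_edges n) (p n) (\<lambda>R. m \<le> card (cluster R v) \<and> card (cluster R v) < large_size n) \<le> (1 / rho) ^ m"
        if "v \<in> perm_verts n" for v
      proof -
        have "rho ^ m * pprob (perm_edges n) (p n) (\<lambda>R. m \<le> card (cluster R v) \<and> card (cluster R v) < large_size n) \<le> 1"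
          using elim(1) that lam(2) by (meson less_imp_le order_trans)
        then show ?thesis using rho(1) by (simp add: power_one_over field_simps)
      qed
      then have "pprob (perm_edges n) (p n)
        (\<lambda>R. \<exists>v\<in>perm_verts n. m \<le> card (cluster R v) \<and> card (cluster R v) < large_size n) \<le> fact (n + 1) * (1 / rho) ^ m"
        using elim(2) by (intro pprob_ex_vertex) auto
      also have "\<dots> \<le> exp (2 * (real n * ln (real n))) * (1 / rho) ^ m"
        using elim(3) rho(1) by (intro mult_right_mono) auto
      finally show "pprob (perm_edges n) (p n)
        (\<lambda>R. \<exists>v\<in>perm_verts n. m \<le> card (cluster R v) \<and> card (cluster R v) < large_size n)
        \<le> exp (2 * (real n * ln (real n))) * (1 / rho) ^ m" .
    qed
  qed
  with rho(1) show ?thesis by blast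
qed

section \<open>Density and uniqueness of the large clusters\<close>

lemma near_large_everywhere:
  assumes lim: "(\<lambda>n. p n * real n) \<longlonglongrightarrow> c" and p: "\<forall>\<^sub>F n in sequentially. 0 \<le> p n \<and> p n < 1"
    and c: "1 < c"
  shows "(\<lambda>n. pprob (perm_edges n) (p n) (\<lambda>R. \<exists>v\<in>perm_verts n. \<not> near_large n (large_size n) R v)) \<longlonglongrightarrow> 0"
proof -
  \<comment> \<open>Chosen so that \<open>c (1 - 2 e) = (c + 1) / 2 > 1\<close>: the cosets stay
    supercritical after giving up about \<open>2 e n\<close> swaps.\<close>
  define e where "e = (c - 1) / (4 * c)"
  have e: "0 < e" "e < 1 / 4" using c by (auto simp: e_def field_simps)
  define l where "l = (\<lambda>n::nat. nat \<lfloor>e * real n\<rfloor>)"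
  \<comment> \<open>A coset will have \<open>m - 1 = n - 2 l - 2\<close> swaps, with
    \<open>l \<le> e n\<close>; isoperimetry takes another \<open>90 ln n\<close>.\<close>
  define d where "d = (\<lambda>n::nat. nat \<lfloor>real n - 2 * e * real n - 2 - 90 * ln (real n)\<rfloor>)"
  have "(\<lambda>n. real (d n) / real n) \<longlonglongrightarrow> 1 - 2 * e" unfolding d_def using e by real_asymp
  from tendsto_mult_ratio[OF lim this] have lim': "(\<lambda>n. p n * real (d n)) \<longlonglongrightarrow> c * (1 - 2 * e)" .
  have "c * (1 - 2 * e) = (c + 1) / 2" using c by (simp add: e_def field_simps)
  then have "1 < c * (1 - 2 * e)" using c by simp
  then obtain lam where lam: "0 < lam" "lam < 1" "0 < surv (c * (1 - 2 * e)) lam" using exists_surv_pos by blast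
  obtain rho where rho: "1 < rho" "\<forall>\<^sub>F n in sequentially. rho * (1 - p n * (1 - lam)) ^ d n \<le> lam"
    using eventually_supercritical[OF lim' p lam] by blast
  define K where "K = - ln lam"
  have K: "0 < K" using lam by (simp add: K_def)
  have e1: "\<forall>\<^sub>F n in sequentially. 0 \<le> real n - 2 * e * real n - 2 - 90 * ln (real n)"
    using e by real_asymp
  have e2: "\<forall>\<^sub>F n in sequentially. 1 \<le> e * real n" using e by real_asymp
  show ?thesis
  proof (rule pprob_tendsto_0[OF p])
    show "(\<lambda>n. exp (2 * (real n * ln (real n)) - K * (e * real n - 1)\<^sup>2)) \<longlonglongrightarrow> 0"
      using K e by real_asymp
    show "\<forall>\<^sub>F n in sequentially. pprob (perm_edges n) (p n) (\<lambda>R. \<exists>v\<in>perm_verts n. \<not> near_large n (large_size n) R v)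
        \<le> exp (2 * (real n * ln (real n)) - K * (e * real n - 1)\<^sup>2)"
      using rho(2) p e1 e2 fact_upper eventually_gt_at_top[of 3]
    proof eventually_elim
      case (elim n)
      have l: "e * real n - 1 \<le> real (l n)" "real (l n) \<le> e * real n"
        using elim(4) by (auto simp: l_def)
      define m where "m = n - 2 * l n - 1"
      have "e * real n \<le> 1 / 4 * real n" using e by (intro mult_right_mono) auto
      then have "2 * l n + 2 \<le> n" using l(2) elim(6) by linarith
      then have m: "1 \<le> m" "m + 2 * l n + 1 \<le> n" "real (m - 1) = real n - 2 * real (l n) - 2"
        by (auto simp: m_def of_nat_diff)
      have "real (d n) \<le> real n - 2 * e * real n - 2 - 90 * ln (real n)" using elim(3) by (simp add: d_def)
      moreover have "3 * ln (real (large_size n)) = 90 * ln (real n)" using elim(6) by (simp add: ln_large_size)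
      ultimately have dm: "real (d n) + 3 * ln (real (large_size n)) \<le> real (m - 1)"
        using l(2) m(3) by linarith
      have "1 * (1 - p n * (1 - lam)) ^ d n \<le> rho * (1 - p n * (1 - lam)) ^ d n"
      proof (rule mult_right_mono)
        have "p n * (1 - lam) \<le> 1 * 1" using elim(2) lam by (intro mult_mono) auto
        then show "0 \<le> (1 - p n * (1 - lam)) ^ d n" by simp
      qed (use rho in simp)
      then have pl: "(1 - p n * (1 - lam)) ^ d n \<le> lam" using elim(1) by simp
      have "pprob (perm_edges n) (p n) (\<lambda>R. \<exists>v\<in>perm_verts n. \<not> near_large n (large_size n) R v)
          \<le> fact (n + 1) * lam ^ (l n * l n)"
        using not_near_large_prob[OF _ m(1,2) _ _ _ _ dm pl] elim(2) lam by (intro pprob_ex_vertex) auto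
      also have "\<dots> \<le> exp (2 * (real n * ln (real n))) * exp (- (K * (e * real n - 1)\<^sup>2))"
      proof (rule mult_mono)
        have "lam ^ (l n * l n) = exp (- (K * (real (l n))\<^sup>2))"
        proof -
          have "lam ^ (l n * l n) = exp (ln lam) ^ (l n * l n)" using lam by simp
          also have "\<dots> = exp (real (l n * l n) * ln lam)" by (rule exp_of_nat_mult[symmetric])
          finally show ?thesis by (simp add: K_def power2_eq_square mult_ac)
        qed
        also have "\<dots> \<le> exp (- (K * (e * real n - 1)\<^sup>2))"
          using K l elim(4) by (simp add: power_mono)
        finally show "lam ^ (l n * l n) \<le> exp (- (K * (e * real n - 1)\<^sup>2))" .
      qed (use elim(5) lam in auto)
      also have "\<dots> = exp (2 * (real n * ln (real n)) - K * (e * real n - 1)\<^sup>2)"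
        by (simp add: mult_exp_exp)
      finally show ?case .
    qed
  qed
qed

lemma unique_large_cluster:
  assumes c: "1 < c"
  shows "(\<lambda>n. pprob (perm_edges n) (c / real n) (\<lambda>G. \<exists>u\<in>perm_verts n. \<exists>w\<in>perm_verts n.
    large_size n \<le> card (cluster G u) \<and> large_size n \<le> card (cluster G w) \<and> cluster G u \<noteq> cluster G w)) \<longlonglongrightarrow> 0"
proof -
  \<comment> \<open>With leftovers of order at most \<open>n^2\<close> the contracted degrees are at
    most \<open>n^3\<close>, and \<open>n^3 p2 = 1 / n\<close> keeps the second round
    subcritical.\<close>
  define p2 where "p2 = (\<lambda>n::nat. 1 / real n ^ 4)"
  \<comment> \<open>Solves \<open>1 - c / n = (1 - p1) (1 - p2)\<close>; \<open>n p1\<close> still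
    tends to \<open>c\<close>.\<close>
  define p1 where "p1 = (\<lambda>n::nat. (c / real n - p2 n) / (1 - p2 n))"
  have lim: "(\<lambda>n. p1 n * real n) \<longlonglongrightarrow> c" unfolding p1_def p2_def using c by real_asymp
  have p1: "\<forall>\<^sub>F n in sequentially. 0 \<le> p1 n \<and> p1 n < 1"
  proof (rule eventually_conj)
    show "\<forall>\<^sub>F n in sequentially. 0 \<le> p1 n" unfolding p1_def p2_def using c by real_asymp
    show "\<forall>\<^sub>F n in sequentially. p1 n < 1" unfolding p1_def p2_def using c by real_asymp
  qed
  have e2: "\<forall>\<^sub>F n in sequentially. p2 n < 1" unfolding p2_def by real_asymp
  have e3: "\<forall>\<^sub>F n in sequentially. exp (1 / real n) \<le> 4 / 3" by real_asymp
  have e4: "\<forall>\<^sub>F n in sequentially. real n ^ 2 \<le> (1 / real n ^ 4) ^ 5 * (real n ^ 30 / (80 * real n ^ 3 * (real n + 1)))"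
    by real_asymp
  obtain rho where rho: "1 < rho" "\<forall>\<^sub>F n in sequentially. \<forall>m.
    pprob (perm_edges n) (p1 n) (\<lambda>R. \<exists>v\<in>perm_verts n. m \<le> card (cluster R v) \<and> card (cluster R v) < large_size n)
      \<le> exp (2 * (real n * ln (real n))) * (1 / rho) ^ m"
    using supercritical_gap[OF lim p1 c] by blast
  define K where "K = ln rho"
  have K: "0 < K" using rho by (simp add: K_def)
  have e5: "(1 / rho) ^ (n\<^sup>2) = exp (- (K * real n ^ 2))" for n :: nat
  proof -
    have "1 / rho = exp (- K)" using rho by (simp add: K_def exp_minus field_simps)
    then have "(1 / rho) ^ (n\<^sup>2) = exp (real (n\<^sup>2) * - K)" by (simp only: exp_of_nat_mult)
    then show ?thesis by (simp add: mult.commute)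
  qed
  define D where "D = (\<lambda>n. pprob (perm_edges n) (p1 n) (\<lambda>R. \<exists>v\<in>perm_verts n. \<not> near_large n (large_size n) R v))"
  have D: "D \<longlonglongrightarrow> 0" unfolding D_def by (rule near_large_everywhere[OF lim p1 c])
  \<comment> \<open>The three errors are intermediate clusters in the first round, failure to merge,
    and stray clusters that avoid the large ones.\<close>
  have g: "(\<lambda>n. exp (2 * (real n * ln (real n)) - K * real n ^ 2)
      + (exp (exp (2 * (real n * ln (real n)) - real n ^ 2)) - 1)
      + 2 * exp (2 * (real n * ln (real n)) - ln (3 / 2) * real n ^ 2)) \<longlonglongrightarrow> 0"
  proof -
    have "(\<lambda>n. exp (2 * (real n * ln (real n)) - K * real n ^ 2)) \<longlonglongrightarrow> 0" using K by real_asymp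
    moreover have "(\<lambda>n. exp (exp (2 * (real n * ln (real n)) - real n ^ 2)) - 1) \<longlonglongrightarrow> 0" by real_asymp
    moreover have "(\<lambda>n. 2 * exp (2 * (real n * ln (real n)) - ln (3 / 2) * real n ^ 2)) \<longlonglongrightarrow> 0" by real_asymp
    ultimately show ?thesis using tendsto_add[OF tendsto_add] by fastforce
  qed
  show ?thesis
  proof (rule pprob_tendsto_0[OF eventually_edge_prob])
    show "(\<lambda>n. D n + (exp (2 * (real n * ln (real n)) - K * real n ^ 2)
      + (exp (exp (2 * (real n * ln (real n)) - real n ^ 2)) - 1)
      + 2 * exp (2 * (real n * ln (real n)) - ln (3 / 2) * real n ^ 2))) \<longlonglongrightarrow> 0"
      using tendsto_add[OF D g] by simp
    show "\<forall>\<^sub>F n in sequentially. pprob (perm_edges n) (c / real n) (\<lambda>G. \<exists>u\<in>perm_verts n. \<exists>w\<in>perm_verts n.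
      large_size n \<le> card (cluster G u) \<and> large_size n \<le> card (cluster G w) \<and> cluster G u \<noteq> cluster G w)
      \<le> D n + (exp (2 * (real n * ln (real n)) - K * real n ^ 2)
      + (exp (exp (2 * (real n * ln (real n)) - real n ^ 2)) - 1)
      + 2 * exp (2 * (real n * ln (real n)) - ln (3 / 2) * real n ^ 2))"
      using p1 e2 e3 e4 rho(2) fact_upper eventually_gt_at_top[of 0]
    proof eventually_elim
      case (elim n)
      let ?t = "2 * (real n * ln (real n))" and ?N = "fact (n + 1) :: real"
      define x where "x = exp (- (p2 n ^ 5 * (real (large_size n) / (80 * real n ^ 3 * (real n + 1)))))"
      have n: "1 \<le> n" "0 < n\<^sup>2" using elim(7) by auto
      have p2: "0 \<le> p2 n" "p2 n \<le> 1" using elim(2) by (auto simp: p2_def)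
      have sp: "1 - c / real n = (1 - p1 n) * (1 - p2 n)" using elim(2) by (simp add: p1_def field_simps)
      \<comment> \<open>Stray clusters are bounded with \<open>s = m = n^2\<close>: the factor
        \<open>2 / 3\<close> to the power \<open>n^2\<close> beats the number of vertices.\<close>
      have sm: "n\<^sup>2 * n\<^sup>2 \<le> large_size n"
        unfolding large_size_def power_add[symmetric] using n by (intro power_increasing) auto
      have ps: "(1 + p2 n) ^ (n * n\<^sup>2) \<le> 4 / 3"
      proof -
        have "(1 - - p2 n) ^ (n * n\<^sup>2) \<le> exp (- (real (n * n\<^sup>2) * - p2 n))"
          using p2 by (intro power_le_exp) auto
        also have "- (real (n * n\<^sup>2) * - p2 n) = 1 / real n"
          using n by (simp add: p2_def power2_eq_square power4_eq_xxxx)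
        finally show ?thesis using elim(3) by simp
      qed
      have "pprob (perm_edges n) (c / real n) (\<lambda>G. \<exists>u\<in>perm_verts n. \<exists>w\<in>perm_verts n.
        large_size n \<le> card (cluster G u) \<and> large_size n \<le> card (cluster G w) \<and> cluster G u \<noteq> cluster G w)
        \<le> D n + pprob (perm_edges n) (p1 n) (\<lambda>X. \<exists>v\<in>perm_verts n. n\<^sup>2 \<le> card (cluster X v) \<and> card (cluster X v) < large_size n)
          + ((1 + x) ^ fact (n + 1) - 1) + ?N * (2 * (2 / 3) ^ n\<^sup>2)"
        unfolding D_def
        by (rule two_large_clusters_prob[OF n(1) n(2) sm sp _ _ p2 ps x_def]) (use elim(1) in auto)
      moreover have "pprob (perm_edges n) (p1 n) (\<lambda>X. \<exists>v\<in>perm_verts n. n\<^sup>2 \<le> card (cluster X v) \<and> card (cluster X v) < large_size n)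
          \<le> exp (?t - K * real n ^ 2)"
        using spec[OF elim(5), of "n\<^sup>2"] by (simp add: e5 mult_exp_exp)
      moreover have "(1 + x) ^ fact (n + 1) \<le> exp (exp (?t - real n ^ 2))"
      proof -
        have "x \<le> exp (- (real n ^ 2))" using elim(4) by (simp add: x_def p2_def large_size_def)
        then have "?N * x \<le> exp ?t * exp (- (real n ^ 2))"
          using elim(6) by (intro mult_mono) (auto simp: x_def)
        then have Nx: "?N * x \<le> exp (?t - real n ^ 2)" by (simp add: mult_exp_exp)
        have "(1 + x) ^ fact (n + 1) \<le> exp x ^ fact (n + 1)"
          by (intro power_mono exp_ge_add_one_self) (auto simp: x_def)
        also have "\<dots> = exp (?N * x)" by (simp only: exp_of_nat_mult[symmetric] of_nat_fact)
        finally show ?thesis using Nx by (meson exp_le_cancel_iff order_trans)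
      qed
      moreover have "?N * (2 * (2 / 3) ^ n\<^sup>2) \<le> 2 * exp (?t - ln (3 / 2) * real n ^ 2)"
      proof -
        have "(2 / 3 :: real) = exp (- ln (3 / 2))" by (simp add: exp_minus)
        then have "(2 / 3 :: real) ^ n\<^sup>2 = exp (real (n\<^sup>2) * - ln (3 / 2))" by (simp only: exp_of_nat_mult)
        also have "\<dots> = exp (- (ln (3 / 2) * real n ^ 2))" by (simp add: mult.commute)
        finally have "?N * (2 * (2 / 3) ^ n\<^sup>2) = 2 * (?N * exp (- (ln (3 / 2) * real n ^ 2)))" by simp
        also have "\<dots> \<le> 2 * (exp ?t * exp (- (ln (3 / 2) * real n ^ 2)))"
          using elim(6) by (intro mult_left_mono mult_right_mono) auto
        finally show ?thesis by (simp add: mult_exp_exp)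
      qed
      ultimately show ?case by linarith
    qed
  qed (use c in simp)
qed

section \<open>Mean number of vertices in small clusters\<close>

text \<open>For \<open>lam\<close> slightly above \<open>1 - \<gamma>(c)\<close>, where
  \<open>surv\<close> is positive, the gap estimate with \<open>m = 0\<close> bounds the probability
  of a small cluster by \<open>lam\<close>. For \<open>lam\<close> slightly below,
  \<open>surv\<close> is negative and \<open>cluster_small_lower\<close> gives at least
  \<open>lam - rho ^ large_size n\<close> with \<open>rho < 1\<close>.\<close>

lemma mean_small_count:
  assumes c: "1 < c"
  shows "(\<lambda>n. pexp (perm_edges n) (c / real n) (cluster_count n (\<lambda>s. s < large_size n)) / fact (n + 1))
    \<longlonglongrightarrow> 1 - gamma_const c"
proof -
  let ?m = "\<lambda>n. pexp (perm_edges n) (c / real n) (cluster_count n (\<lambda>s. s < large_size n))"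
  note gamma = gamma_const_props[OF c]
  have c0: "0 < c" using c by simp
  note p = eventually_edge_prob[OF c0]
  have lim: "(\<lambda>n. c / real n * real n) \<longlonglongrightarrow> c" using c by real_asymp
  have mean_ge: "fact (n + 1) * a \<le> ?m n"
    if "\<And>v. v \<in> perm_verts n \<Longrightarrow> a \<le> pprob (perm_edges n) (c / real n) (\<lambda>R. card (cluster R v) < large_size n)" for n a
  proof -
    have "(\<Sum>v\<in>perm_verts n. a) \<le> ?m n" unfolding pexp_cluster_count using that by (intro sum_mono)
    then show ?thesis by (simp only: sum_constant card_perm_verts of_nat_fact)
  qed
  have mean_le: "?m n \<le> fact (n + 1) * a"
    if "\<And>v. v \<in> perm_verts n \<Longrightarrow> pprob (perm_edges n) (c / real n) (\<lambda>R. card (cluster R v) < large_size n) \<le> a" for n a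
  proof -
    have "?m n \<le> (\<Sum>v\<in>perm_verts n. a)" unfolding pexp_cluster_count using that by (intro sum_mono)
    then show ?thesis by (simp only: sum_constant card_perm_verts of_nat_fact)
  qed
  show ?thesis
  proof (rule order_tendstoI)
    fix y assume y: "1 - gamma_const c < y"
    \<comment> \<open>Strictly between \<open>1 - \<gamma>(c)\<close> and \<open>y\<close>; the
      minimum keeps it below 1.\<close>
    define lam where "lam = (1 - gamma_const c + min y 1) / 2"
    have lam: "1 - gamma_const c < lam" "lam < 1" "lam < y" "0 < lam" using y gamma(1,2) by (auto simp: lam_def)
    obtain rho where "1 < rho" and rho: "\<forall>\<^sub>F n in sequentially. \<forall>v\<in>perm_verts n. \<forall>m.
      rho ^ m * pprob (perm_edges n) (c / real n) (\<lambda>R. m \<le> card (cluster R v) \<and> card (cluster R v) < large_size n) \<le> lam"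
      using eventually_supercritical_perm[OF lim p lam(4,2) gamma(4)[OF lam(1,2)]] by blast
    from rho show "\<forall>\<^sub>F n in sequentially. ?m n / fact (n + 1) < y"
    proof eventually_elim
      case (elim n)
      have "pprob (perm_edges n) (c / real n) (\<lambda>R. card (cluster R v) < large_size n) \<le> lam" if "v \<in> perm_verts n" for v
        using spec[OF bspec[OF elim that], of 0] by simp
      then have "?m n \<le> fact (n + 1) * lam" by (rule mean_le)
      then have "?m n / fact (n + 1) \<le> lam" by (simp add: divide_le_eq mult.commute del: fact_Suc)
      then show ?case using lam by linarith
    qed
  next
    fix y assume y: "y < 1 - gamma_const c"
    \<comment> \<open>Strictly between \<open>y\<close> and \<open>1 - \<gamma>(c)\<close>; the
      maximum keeps it positive.\<close>
    define lam where "lam = (1 - gamma_const c + max y 0) / 2"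
    have lam: "lam < 1 - gamma_const c" "0 < lam" "y < lam" "lam < 1" using y gamma(1,2) by (auto simp: lam_def)
    have neg: "surv c lam < 0" using gamma(3) lam by simp
    define rho where "rho = exp (surv c lam / 2)"
    have rho: "0 < rho" "rho < 1" using neg by (auto simp: rho_def)
    have "(\<lambda>n. rho * (1 - c / real n * (1 - lam)) ^ n) \<longlonglongrightarrow> rho * exp (- (c * (1 - lam)))"
    proof (intro tendsto_intros)
      have "(\<lambda>n. (1 + (- (c * (1 - lam))) / real n) ^ n) \<longlonglongrightarrow> exp (- (c * (1 - lam)))"
        by (rule tendsto_exp_limit_sequentially)
      then show "(\<lambda>n. (1 - c / real n * (1 - lam)) ^ n) \<longlonglongrightarrow> exp (- (c * (1 - lam)))" by simp
    qed
    moreover have "lam < rho * exp (- (c * (1 - lam)))"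
    proof -
      have "lam = exp (ln lam)" using lam by simp
      also have "\<dots> < exp (surv c lam / 2 + - (c * (1 - lam)))"
        using neg by (subst exp_less_cancel_iff) (simp add: surv_def field_simps)
      finally show ?thesis by (simp only: rho_def mult_exp_exp)
    qed
    ultimately have e1: "\<forall>\<^sub>F n in sequentially. lam < rho * (1 - c / real n * (1 - lam)) ^ n"
      by (rule order_tendstoD(1))
    have "(\<lambda>n. lam - rho ^ n) \<longlonglongrightarrow> lam - 0"
      using rho by (intro tendsto_intros LIMSEQ_realpow_zero) auto
    then have "(\<lambda>n. lam - rho ^ n) \<longlonglongrightarrow> lam" by simp
    from order_tendstoD(1)[OF this lam(3)] have e2: "\<forall>\<^sub>F n in sequentially. y < lam - rho ^ n" .
    show "\<forall>\<^sub>F n in sequentially. y < ?m n / fact (n + 1)"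
      using p e1 e2 eventually_gt_at_top[of 0]
    proof eventually_elim
      case (elim n)
      have "lam - rho ^ n \<le> pprob (perm_edges n) (c / real n) (\<lambda>R. card (cluster R v) < large_size n)" for v
      proof -
        have "lam \<le> pprob (perm_edges n) (c / real n) (\<lambda>R. card (cluster R v) < large_size n) + rho ^ large_size n"
        proof (rule cluster_small_lower[OF graph_perm_edges, where D = n])
          fix R assume "R \<subseteq> perm_edges n"
          then show "card (touch (\<lambda>x. x) (perm_edges n) (cluster R v)) \<le> n * card (cluster R v)"
            using card_touch_swap_le[of "{1..n}" n "cluster R v"] perm_cluster_finite by (simp add: perm_edges_eq)
        qed (use elim lam rho in auto)
        moreover have "rho ^ large_size n \<le> rho ^ n"
          using rho elim(4) by (intro power_decreasing) (auto simp: large_size_def self_le_power)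
        ultimately show ?thesis by linarith
      qed
      then have "fact (n + 1) * (lam - rho ^ n) \<le> ?m n" by (rule mean_ge)
      then have "lam - rho ^ n \<le> ?m n / fact (n + 1)" by (simp add: le_divide_eq mult.commute del: fact_Suc)
      then show ?case using elim(3) by linarith
    qed
  qed
qed

section \<open>From unlikely bad events to the limit statements\<close>

lemma prob_tendsto_1:
  assumes p: "\<forall>\<^sub>F n in sequentially. 0 \<le> p n \<and> p n < 1"
    and good: "\<forall>\<^sub>F n in sequentially. \<forall>R\<subseteq>perm_edges n. \<not> Q n R \<longrightarrow> R \<in> S n"
    and lim: "(\<lambda>n. pprob (perm_edges n) (p n) (Q n)) \<longlonglongrightarrow> 0"
  shows "(\<lambda>n. measure_pmf.prob (random_edges (perm_edges n) (p n)) (S n)) \<longlonglongrightarrow> 1"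
proof (rule tendsto_sandwich[OF _ _ _ tendsto_const])
  show "(\<lambda>n. 1 - pprob (perm_edges n) (p n) (Q n)) \<longlonglongrightarrow> 1"
    using tendsto_diff[OF tendsto_const lim, of 1] by simp
  show "\<forall>\<^sub>F n in sequentially. 1 - pprob (perm_edges n) (p n) (Q n)
      \<le> measure_pmf.prob (random_edges (perm_edges n) (p n)) (S n)"
    using p good
  proof eventually_elim
    case (elim n)
    have "1 - pprob (perm_edges n) (p n) (Q n) = pprob (perm_edges n) (p n) (\<lambda>R. \<not> Q n R)"
      by (rule pprob_not[symmetric]) simp
    also have "\<dots> \<le> pprob (perm_edges n) (p n) (\<lambda>R. R \<in> S n)"
      using elim by (intro pprob_mono) auto
    also have "\<dots> = measure_pmf.prob (random_edges (perm_edges n) (p n)) (S n)"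
      using elim by (intro prob_random_edges[symmetric]) auto
    finally show ?case .
  qed
qed simp

lemma pprob_disj_tendsto_0:
  assumes "\<forall>\<^sub>F n in sequentially. 0 \<le> p n \<and> p n < 1"
    "(\<lambda>n. pprob (U n) (p n) (Q n)) \<longlonglongrightarrow> 0" "(\<lambda>n. pprob (U n) (p n) (Q' n)) \<longlonglongrightarrow> 0"
  shows "(\<lambda>n. pprob (U n) (p n) (\<lambda>R. Q n R \<or> Q' n R)) \<longlonglongrightarrow> 0"
proof (rule pprob_tendsto_0[OF assms(1)])
  show "(\<lambda>n. pprob (U n) (p n) (Q n) + pprob (U n) (p n) (Q' n)) \<longlonglongrightarrow> 0"
    using tendsto_add[OF assms(2,3)] by simp
  show "\<forall>\<^sub>F n in sequentially. pprob (U n) (p n) (\<lambda>R. Q n R \<or> Q' n R)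
      \<le> pprob (U n) (p n) (Q n) + pprob (U n) (p n) (Q' n)"
    using assms(1)
  proof eventually_elim
    case (elim n)
    then show ?case by (intro pprob_disj) auto
  qed
qed

lemma perm_graph_components:
  assumes "R \<subseteq> perm_edges n"
  shows "graph_components (perm_verts n) R = cluster R ` perm_verts n"
    "finite (graph_components (perm_verts n) R)"
proof -
  show "graph_components (perm_verts n) R = cluster R ` perm_verts n"
    using assms by (intro graph_components_eq graph_edges_subset[OF graph_perm_edges] perm_edges_verts)
  then show "finite (graph_components (perm_verts n) R)" by simp
qed

lemma supercritical_gap_tendsto:
  assumes c: "1 < c"
  shows "\<exists>b>0. (\<lambda>n. pprob (perm_edges n) (c / real n) (\<lambda>R. \<exists>v\<in>perm_verts n.
    b * (real n * ln (real n)) < real (card (cluster R v)) \<and> card (cluster R v) < large_size n)) \<longlonglongrightarrow> 0"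
proof -
  have c0: "0 < c" using c by simp
  note p = eventually_edge_prob[OF c0]
  have lim: "(\<lambda>n. c / real n * real n) \<longlonglongrightarrow> c" using c by real_asymp
  obtain rho where rho: "1 < rho" "\<forall>\<^sub>F n in sequentially. \<forall>m.
    pprob (perm_edges n) (c / real n) (\<lambda>R. \<exists>v\<in>perm_verts n. m \<le> card (cluster R v) \<and> card (cluster R v) < large_size n)
      \<le> exp (2 * (real n * ln (real n))) * (1 / rho) ^ m"
    using supercritical_gap[OF lim p c] by blast
  \<comment> \<open>As in the subcritical case, \<open>rho ^ m\<close> reaches
    \<open>exp (3 n ln n)\<close> and beats the union bound.\<close>
  define b where "b = 3 / ln rho"
  have b: "0 < b" "b * ln rho = 3" using rho(1) by (auto simp: b_def)
  have "(\<lambda>n. pprob (perm_edges n) (c / real n) (\<lambda>R. \<exists>v\<in>perm_verts n.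
    b * (real n * ln (real n)) < real (card (cluster R v)) \<and> card (cluster R v) < large_size n)) \<longlonglongrightarrow> 0"
  proof (rule pprob_tendsto_0[OF p])
    show "(\<lambda>n. exp (2 * (real n * ln (real n))) * exp (- (3 * (real n * ln (real n))))) \<longlonglongrightarrow> 0" by real_asymp
    show "\<forall>\<^sub>F n in sequentially. pprob (perm_edges n) (c / real n) (\<lambda>R. \<exists>v\<in>perm_verts n.
      b * (real n * ln (real n)) < real (card (cluster R v)) \<and> card (cluster R v) < large_size n)
      \<le> exp (2 * (real n * ln (real n))) * exp (- (3 * (real n * ln (real n))))"
      using p rho(2)
    proof eventually_elim
      case (elim n)
      let ?t = "real n * ln (real n)"
      define m where "m = nat \<lceil>b * ?t\<rceil>"
      have tm: "b * ?t \<le> real m" by (simp add: m_def real_nat_ceiling_ge)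
      have "pprob (perm_edges n) (c / real n) (\<lambda>R. \<exists>v\<in>perm_verts n.
          b * ?t < real (card (cluster R v)) \<and> card (cluster R v) < large_size n)
        \<le> pprob (perm_edges n) (c / real n) (\<lambda>R. \<exists>v\<in>perm_verts n. m \<le> card (cluster R v) \<and> card (cluster R v) < large_size n)"
      proof (intro pprob_mono)
        fix R assume "\<exists>v\<in>perm_verts n. b * ?t < real (card (cluster R v)) \<and> card (cluster R v) < large_size n"
        moreover have "m \<le> k" if "b * ?t < real k" for k using that by (simp add: m_def nat_ceiling_le_eq)
        ultimately show "\<exists>v\<in>perm_verts n. m \<le> card (cluster R v) \<and> card (cluster R v) < large_size n" by blast
      qed (use elim in auto)
      also have "\<dots> \<le> exp (2 * ?t) * (1 / rho) ^ m" using elim(2) by blast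
      also have "\<dots> \<le> exp (2 * ?t) * exp (- (3 * ?t))"
      proof -
        have "b * ?t * ln rho = 3 * ?t" unfolding b(2)[symmetric] by (simp only: mult_ac)
        then have "exp (3 * ?t) \<le> rho ^ m" using power_ge_exp[OF rho(1) tm] by (simp only:)
        then have "inverse (rho ^ m) \<le> inverse (exp (3 * ?t))" by (rule le_imp_inverse_le) simp
        then have "(1 / rho) ^ m \<le> exp (- (3 * ?t))"
          by (simp only: exp_minus power_one_over inverse_eq_divide)
        then show ?thesis by (intro mult_left_mono) auto
      qed
      finally show ?case .
    qed
  qed
  with b show ?thesis by blast
qed

section \<open>Assembling the two regimes\<close>

theorem theorem1p6:
  fixes c :: real
  assumes "c > 0"
  shows
    "(c < 1 \<longrightarrow>
       (\<exists>a b. 0 < a \<and> 0 < b \<and>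
         (\<lambda>n::nat. measure_pmf.prob (random_edges (perm_edges n) (c / real n))
            {E. a * (real n * ln (real n)) \<le> real (largest_order (perm_verts n) E) \<and>
                real (largest_order (perm_verts n) E) \<le> b * (real n * ln (real n))})
         \<longlonglongrightarrow> 1)) \<and>
     (c > 1 \<longrightarrow>
       (\<exists>a b (\<delta> :: nat \<Rightarrow> real). 0 < a \<and> 0 < b \<and> \<delta> \<in> o(\<lambda>_. 1) \<and>
         (\<lambda>n::nat. measure_pmf.prob (random_edges (perm_edges n) (c / real n))
            {E. (\<exists>C \<in> graph_components (perm_verts n) E.
                   \<bar>real (card C) - gamma_const c * fact (n + 1)\<bar>
                     \<le> \<delta> n * (gamma_const c * fact (n + 1))) \<and>
                a * (real n * ln (real n)) \<le> real (second_largest_order (perm_verts n) E) \<and>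
                real (second_largest_order (perm_verts n) E) \<le> b * (real n * ln (real n))})
         \<longlonglongrightarrow> 1))"
proof (intro conjI impI)
  assume c1: "c < 1"
  note p = eventually_edge_prob[OF assms]
  obtain b where b: "0 < b" "(\<lambda>n. pprob (perm_edges n) (c / real n)
    (\<lambda>R. \<exists>v\<in>perm_verts n. b * (real n * ln (real n)) < real (card (cluster R v)))) \<longlonglongrightarrow> 0"
    using subcritical_clusters[OF assms c1] by blast
  obtain a k where a: "0 < a" "\<forall>\<^sub>F n in sequentially. a * (real n * ln (real n)) \<le> real (k n) \<and> k n \<le> n\<^sup>2"
    "(\<lambda>n. pprob (perm_edges n) (c / real n) (\<lambda>R. \<not> (\<exists>v\<in>perm_verts n. card (cluster R v) = k n))) \<longlonglongrightarrow> 0"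
    using exact_size_cluster_exists[OF assms] by blast
  have "(\<lambda>n. measure_pmf.prob (random_edges (perm_edges n) (c / real n))
      {E. a * (real n * ln (real n)) \<le> real (largest_order (perm_verts n) E) \<and>
          real (largest_order (perm_verts n) E) \<le> b * (real n * ln (real n))}) \<longlonglongrightarrow> 1"
  proof (rule prob_tendsto_1[OF p _ pprob_disj_tendsto_0[OF p b(2) a(3)]])
    show "\<forall>\<^sub>F n in sequentially. \<forall>R\<subseteq>perm_edges n.
      \<not> ((\<exists>v\<in>perm_verts n. b * (real n * ln (real n)) < real (card (cluster R v))) \<or>
         \<not> (\<exists>v\<in>perm_verts n. card (cluster R v) = k n)) \<longrightarrow>
      R \<in> {E. a * (real n * ln (real n)) \<le> real (largest_order (perm_verts n) E) \<and>
          real (largest_order (perm_verts n) E) \<le> b * (real n * ln (real n))}"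
      using a(2) eventually_gt_at_top[of 0]
    proof (eventually_elim, intro allI impI)
      fix n R
      assume n: "a * (real n * ln (real n)) \<le> real (k n) \<and> k n \<le> n\<^sup>2" "0 < n" and R: "R \<subseteq> perm_edges n"
        and "\<not> ((\<exists>v\<in>perm_verts n. b * (real n * ln (real n)) < real (card (cluster R v))) \<or>
         \<not> (\<exists>v\<in>perm_verts n. card (cluster R v) = k n))"
      then obtain v where v: "v \<in> perm_verts n" "card (cluster R v) = k n"
        and le: "\<And>w. w \<in> perm_verts n \<Longrightarrow> real (card (cluster R w)) \<le> b * (real n * ln (real n))"
        by (auto simp: not_less)
      note comps = perm_graph_components[OF R]
      have "k n \<le> largest_order (perm_verts n) R"
        using card_le_largest_order[OF comps(2), of "cluster R v"] v by (simp add: comps(1))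
      then have "real (k n) \<le> real (largest_order (perm_verts n) R)" by simp
      then have lo: "a * (real n * ln (real n)) \<le> real (largest_order (perm_verts n) R)" using n(1) by linarith
      have "0 \<le> b * (real n * ln (real n))" using b(1) n(2) by simp
      moreover have "largest_order (perm_verts n) R \<le> nat \<lfloor>b * (real n * ln (real n))\<rfloor>"
      proof (rule largest_order_le[OF comps(2)])
        fix C assume "C \<in> graph_components (perm_verts n) R"
        then obtain w where "w \<in> perm_verts n" "C = cluster R w" by (auto simp: comps(1))
        then show "card C \<le> nat \<lfloor>b * (real n * ln (real n))\<rfloor>" using le[of w] by (simp add: le_nat_floor)
      qed
      ultimately have "real (largest_order (perm_verts n) R) \<le> b * (real n * ln (real n))"
        by (meson le_floor_iff le_nat_iff of_int_of_nat_eq order_trans of_nat_le_iff zero_le_floor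
          of_nat_floor)
      with lo show "R \<in> {E. a * (real n * ln (real n)) \<le> real (largest_order (perm_verts n) E) \<and>
          real (largest_order (perm_verts n) E) \<le> b * (real n * ln (real n))}" by simp
    qed
  qed
  with a(1) b(1) show "\<exists>a b. 0 < a \<and> 0 < b \<and>
         (\<lambda>n::nat. measure_pmf.prob (random_edges (perm_edges n) (c / real n))
            {E. a * (real n * ln (real n)) \<le> real (largest_order (perm_verts n) E) \<and>
                real (largest_order (perm_verts n) E) \<le> b * (real n * ln (real n))})
         \<longlonglongrightarrow> 1" by blast
next
  assume c1: "c > 1"
  note p = eventually_edge_prob[OF assms]
  note gamma = gamma_const_props[OF c1]
  obtain b where b: "0 < b" "(\<lambda>n. pprob (perm_edges n) (c / real n) (\<lambda>R. \<exists>v\<in>perm_verts n.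
    b * (real n * ln (real n)) < real (card (cluster R v)) \<and> card (cluster R v) < large_size n)) \<longlonglongrightarrow> 0"
    using supercritical_gap_tendsto[OF c1] by blast
  obtain a k where a: "0 < a" "\<forall>\<^sub>F n in sequentially. a * (real n * ln (real n)) \<le> real (k n) \<and> k n \<le> n\<^sup>2"
    "(\<lambda>n. pprob (perm_edges n) (c / real n) (\<lambda>R. \<not> (\<exists>v\<in>perm_verts n. card (cluster R v) = k n))) \<longlonglongrightarrow> 0"
    using exact_size_cluster_exists[OF assms] by blast
  define Q where "Q = (\<lambda>n s. s < large_size n)"
  define m where "m = (\<lambda>n. pexp (perm_edges n) (c / real n) (cluster_count n (Q n)))"
  define N where "N = (\<lambda>n. fact (n + 1) :: real)"
  \<comment> \<open>Error relative to \<open>N n\<close>: the distance of the mean from its limit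
    plus the \<open>1 / n\<close> granted to Chebyshev. Division by \<open>gamma_const c\<close>
    makes it relative to the giant.\<close>
  define d where "d = (\<lambda>n. \<bar>m n / N n - (1 - gamma_const c)\<bar> + 1 / real n)"
  define \<delta> where "\<delta> = (\<lambda>n. d n / gamma_const c)"
  have N0: "0 < N n" for n by (simp add: N_def)
  have "(\<lambda>n. m n / N n) \<longlonglongrightarrow> 1 - gamma_const c"
    using mean_small_count[OF c1] by (simp only: m_def N_def Q_def)
  then have "(\<lambda>n. \<bar>m n / N n - (1 - gamma_const c)\<bar>) \<longlonglongrightarrow> 0"
    by (intro tendsto_rabs_zero) (simp add: LIM_zero)
  moreover have "(\<lambda>n. 1 / real n) \<longlonglongrightarrow> 0" by real_asymp
  ultimately have d: "d \<longlonglongrightarrow> 0" unfolding d_def using tendsto_add by fastforce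
  then have "\<delta> \<longlonglongrightarrow> 0" unfolding \<delta>_def using tendsto_divide[OF d tendsto_const, of "gamma_const c"] gamma(1) by simp
  then have \<delta>: "\<delta> \<in> o(\<lambda>_. 1)" by (intro smalloI_tendsto) auto
  have dlt: "\<forall>\<^sub>F n in sequentially. d n < gamma_const c" using order_tendstoD(2)[OF d gamma(1)] .
  \<comment> \<open>The variance is at most \<open>N\<close> times a polynomial in \<open>n\<close>,
    so a deviation by \<open>N / n\<close> has probability at most a polynomial divided by
    \<open>N\<close>.\<close>
  have dev: "(\<lambda>n. pprob (perm_edges n) (c / real n) (\<lambda>R. N n / real n \<le> \<bar>cluster_count n (Q n) R - m n\<bar>)) \<longlonglongrightarrow> 0"
  proof (rule pprob_tendsto_0[OF p])
    show "(\<lambda>n. 4 * c * (real n ^ 30)\<^sup>2 * real n ^ 2 * exp (- (real n * ln (real n) / 2))) \<longlonglongrightarrow> 0"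
      using assms by real_asymp
    show "\<forall>\<^sub>F n in sequentially. pprob (perm_edges n) (c / real n) (\<lambda>R. N n / real n \<le> \<bar>cluster_count n (Q n) R - m n\<bar>)
      \<le> 4 * c * (real n ^ 30)\<^sup>2 * real n ^ 2 * exp (- (real n * ln (real n) / 2))"
      using p fact_lower eventually_gt_at_top[of 0]
    proof eventually_elim
      case (elim n)
      have n: "0 < real n" using elim(3) by simp
      have "pprob (perm_edges n) (c / real n) (\<lambda>R. N n / real n \<le> \<bar>cluster_count n (Q n) R - m n\<bar>)
        \<le> real n * fact (n + 1) * (c / real n * (2 * real (large_size n))\<^sup>2) / (N n / real n)\<^sup>2"
        unfolding m_def
        by (rule cluster_count_concentration) (use elim N0[of n] n in \<open>auto simp: Q_def\<close>)
      also have "\<dots> = 4 * c * (real n ^ 30)\<^sup>2 * real n ^ 2 * (1 / N n)"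
      proof -
        have "real n * N n * (c / real n * (2 * real (large_size n))\<^sup>2) / (N n / real n)\<^sup>2
            = (N n * N n) * (4 * c * (real n ^ 30)\<^sup>2 * real n ^ 2) / (N n * N n * N n)"
          using n N0[of n] by (simp add: large_size_def power2_eq_square field_simps)
        also have "\<dots> = 4 * c * (real n ^ 30)\<^sup>2 * real n ^ 2 * (1 / N n)"
          using N0[of n] by simp
        finally show ?thesis unfolding N_def .
      qed
      also have "\<dots> \<le> 4 * c * (real n ^ 30)\<^sup>2 * real n ^ 2 * exp (- (real n * ln (real n) / 2))"
      proof (rule mult_left_mono)
        have "inverse (N n) \<le> inverse (exp (real n * ln (real n) / 2))"
          using elim(2) unfolding N_def by (rule le_imp_inverse_le) simp
        then show "1 / N n \<le> exp (- (real n * ln (real n) / 2))" by (simp only: exp_minus inverse_eq_divide)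
      qed (use assms in simp)
      finally show ?case .
    qed
  qed
  let ?two = "\<lambda>n G. \<exists>u\<in>perm_verts n. \<exists>w\<in>perm_verts n. large_size n \<le> card (cluster G u) \<and>
    large_size n \<le> card (cluster G w) \<and> cluster G u \<noteq> cluster G w"
  let ?gap = "\<lambda>n R. \<exists>v\<in>perm_verts n. b * (real n * ln (real n)) < real (card (cluster R v)) \<and>
    card (cluster R v) < large_size n"
  let ?none = "\<lambda>n R. \<not> (\<exists>v\<in>perm_verts n. card (cluster R v) = k n)"
  let ?dev = "\<lambda>n R. N n / real n \<le> \<bar>cluster_count n (Q n) R - m n\<bar>"
  have bad: "(\<lambda>n. pprob (perm_edges n) (c / real n) (\<lambda>R. (?two n R \<or> ?gap n R) \<or> (?none n R \<or> ?dev n R))) \<longlonglongrightarrow> 0"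
    by (intro pprob_disj_tendsto_0[OF p] unique_large_cluster[OF c1] b(2) a(3) dev)
  have "(\<lambda>n. measure_pmf.prob (random_edges (perm_edges n) (c / real n))
            {E. (\<exists>C \<in> graph_components (perm_verts n) E.
                   \<bar>real (card C) - gamma_const c * fact (n + 1)\<bar>
                     \<le> \<delta> n * (gamma_const c * fact (n + 1))) \<and>
                a * (real n * ln (real n)) \<le> real (second_largest_order (perm_verts n) E) \<and>
                real (second_largest_order (perm_verts n) E) \<le> b * (real n * ln (real n))}) \<longlonglongrightarrow> 1"
  proof (rule prob_tendsto_1[OF p _ bad])
    show "\<forall>\<^sub>F n in sequentially. \<forall>R\<subseteq>perm_edges n.
      \<not> ((?two n R \<or> ?gap n R) \<or> (?none n R \<or> ?dev n R)) \<longrightarrow>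
      R \<in> {E. (\<exists>C \<in> graph_components (perm_verts n) E.
                   \<bar>real (card C) - gamma_const c * fact (n + 1)\<bar>
                     \<le> \<delta> n * (gamma_const c * fact (n + 1))) \<and>
                a * (real n * ln (real n)) \<le> real (second_largest_order (perm_verts n) E) \<and>
                real (second_largest_order (perm_verts n) E) \<le> b * (real n * ln (real n))}"
      using a(2) dlt eventually_gt_at_top[of 1]
    proof (eventually_elim, intro allI impI)
      fix n R
      assume n: "a * (real n * ln (real n)) \<le> real (k n) \<and> k n \<le> n\<^sup>2" "d n < gamma_const c" "1 < n"
        and R: "R \<subseteq> perm_edges n" and good: "\<not> ((?two n R \<or> ?gap n R) \<or> (?none n R \<or> ?dev n R))"
      let ?V = "perm_verts n"
      have two: "\<And>u w. u \<in> ?V \<Longrightarrow> w \<in> ?V \<Longrightarrow> large_size n \<le> card (cluster R u) \<Longrightarrow>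
          large_size n \<le> card (cluster R w) \<Longrightarrow> cluster R u = cluster R w"
        using good by blast
      have gap: "\<And>v. v \<in> ?V \<Longrightarrow> card (cluster R v) < large_size n \<Longrightarrow> real (card (cluster R v)) \<le> b * (real n * ln (real n))"
        using good by (meson not_le)
      have dev: "\<bar>cluster_count n (Q n) R - m n\<bar> < N n / real n"
        using good by (meson not_le)
      obtain v where v: "v \<in> ?V" "card (cluster R v) = k n" using good by auto
      \<comment> \<open>The cluster of order \<open>k n\<close> cannot be the giant, so it bounds
        the second-largest order from below.\<close>
      have kM: "k n < large_size n"
      proof -
        have "k n \<le> n ^ 2" using n(1) by simp
        also have "\<dots> < n ^ 30" using n(3) by (intro power_strict_increasing) auto
        finally show ?thesis by (simp add: large_size_def)
      qed
      note comps = perm_graph_components[OF R]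
      \<comment> \<open>All vertices in large clusters. Their number is known from the complementary
        count before they are seen to form a single cluster.\<close>
      define L where "L = {u \<in> ?V. large_size n \<le> card (cluster R u)}"
      have "card ?V = card L + card {u \<in> ?V. Q n (card (cluster R u))}"
      proof -
        have "?V = L \<union> {u \<in> ?V. Q n (card (cluster R u))}" "L \<inter> {u \<in> ?V. Q n (card (cluster R u))} = {}"
          by (auto simp: L_def Q_def)
        moreover have "finite L" by (simp add: L_def)
        ultimately show ?thesis using card_Un_disjoint[of L "{u \<in> ?V. Q n (card (cluster R u))}"] by simp
      qed
      then have "real (card ?V) = real (card L) + cluster_count n (Q n) R"
        unfolding cluster_count_def by (simp only: of_nat_add)
      then have cL: "real (card L) = N n - cluster_count n (Q n) R"
        by (simp add: card_perm_verts N_def del: fact_Suc)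
      have dist: "\<bar>real (card L) - gamma_const c * N n\<bar> \<le> d n * N n"
      proof -
        have "\<bar>m n / N n - (1 - gamma_const c)\<bar> * N n = \<bar>(m n / N n - (1 - gamma_const c)) * N n\<bar>"
          using N0[of n] by (simp add: abs_mult)
        also have "(m n / N n - (1 - gamma_const c)) * N n = m n - (1 - gamma_const c) * N n"
          using N0[of n] by (simp add: field_simps)
        finally have "d n * N n = \<bar>m n - (1 - gamma_const c) * N n\<bar> + N n / real n"
          by (simp add: d_def algebra_simps)
        moreover have "real (card L) - gamma_const c * N n = (1 - gamma_const c) * N n - cluster_count n (Q n) R"
          unfolding cL by (simp add: algebra_simps)
        ultimately show ?thesis using dev by linarith
      qed
      \<comment> \<open>\<open>d n < gamma_const c\<close> leaves no room for an empty
        \<open>L\<close>.\<close>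
      have "0 < real (card L)"
      proof -
        have "d n * N n < gamma_const c * N n" using n(2) N0[of n] by (intro mult_strict_right_mono)
        then show ?thesis using dist by linarith
      qed
      then obtain u where u: "u \<in> L" by (metis card.empty equals0I of_nat_0 less_irrefl)
      then have uV: "u \<in> ?V" "large_size n \<le> card (cluster R u)" by (auto simp: L_def)
      have Lu: "L = cluster R u"
      proof (intro antisym subsetI)
        fix w assume "w \<in> L"
        then have "cluster R w = cluster R u" using two uV by (auto simp: L_def)
        then show "w \<in> cluster R u" using self_in_cluster[of w R] by simp
      next
        fix w assume w: "w \<in> cluster R u"
        then have "w \<in> ?V" using perm_cluster_verts[OF R uV(1)] by auto
        then show "w \<in> L" using cluster_eq[OF w] uV by (simp add: L_def)
      qed
      have "\<delta> n * (gamma_const c * N n) = d n * N n" using gamma(1) by (simp add: \<delta>_def)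
      then have giant: "\<bar>real (card (cluster R u)) - gamma_const c * fact (n + 1)\<bar> \<le> \<delta> n * (gamma_const c * fact (n + 1))"
        using dist unfolding Lu N_def by (simp only:)
      have neq: "cluster R v \<noteq> cluster R u" using v(2) uV(2) kM by auto
      have "k n \<le> second_largest_order ?V R"
        by (rule second_largest_order_ge[OF comps(2) _ _ neq]) (use v uV kM in \<open>auto simp: comps(1)\<close>)
      then have "real (k n) \<le> real (second_largest_order ?V R)" by simp
      then have lo: "a * (real n * ln (real n)) \<le> real (second_largest_order ?V R)" using n(1) by linarith
      \<comment> \<open>Uniqueness puts every component other than the giant below
        \<open>large_size n\<close>, where \<open>gap\<close> applies.\<close>
      have "second_largest_order ?V R \<le> nat \<lfloor>b * (real n * ln (real n))\<rfloor>"
      proof (rule second_largest_order_le[OF comps(2), where K = "cluster R u"])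
        fix C assume C: "C \<in> graph_components ?V R" "C \<noteq> cluster R u"
        then obtain w where w: "w \<in> ?V" "C = cluster R w" by (auto simp: comps(1))
        have "card (cluster R w) < large_size n" using two[OF w(1) uV(1) _ uV(2)] C(2) w(2) by (meson not_le)
        then show "card C \<le> nat \<lfloor>b * (real n * ln (real n))\<rfloor>" using gap[OF w(1)] w(2) by (simp add: le_nat_floor)
      qed
      moreover have "0 \<le> b * (real n * ln (real n))" using b(1) n(3) by simp
      ultimately have "real (second_largest_order ?V R) \<le> b * (real n * ln (real n))"
        by (meson of_nat_floor of_nat_le_iff order_trans)
      with lo giant uV(1) show "R \<in> {E. (\<exists>C \<in> graph_components ?V E.
                   \<bar>real (card C) - gamma_const c * fact (n + 1)\<bar>
                     \<le> \<delta> n * (gamma_const c * fact (n + 1))) \<and>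
                a * (real n * ln (real n)) \<le> real (second_largest_order ?V E) \<and>
                real (second_largest_order ?V E) \<le> b * (real n * ln (real n))}"
        unfolding mem_Collect_eq comps(1) by blast
    qed
  qed
  with a(1) b(1) \<delta> show "\<exists>a b (\<delta> :: nat \<Rightarrow> real). 0 < a \<and> 0 < b \<and> \<delta> \<in> o(\<lambda>_. 1) \<and>
         (\<lambda>n::nat. measure_pmf.prob (random_edges (perm_edges n) (c / real n))
            {E. (\<exists>C \<in> graph_components (perm_verts n) E.
                   \<bar>real (card C) - gamma_const c * fact (n + 1)\<bar>
                     \<le> \<delta> n * (gamma_const c * fact (n + 1))) \<and>
                a * (real n * ln (real n)) \<le> real (second_largest_order (perm_verts n) E) \<and>
                real (second_largest_order (perm_verts n) E) \<le> b * (real n * ln (real n))})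
         \<longlonglongrightarrow> 1" by blast
qed

end
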